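(* Let $G$ be a Lie groupoid with base $M$, let $S$ be an action of $G$ on a fibered manifold $\phi\colon F\to M$, and let $E$ be a vector bundle with base $F$. To any representation of the action groupoid $G\ltimes F$ on $E$ there corresponds a representation of the group of bisections $\mathcal B(G)$ of $G$ by semi-linear isomorphisms of $\Gamma E$ (that is, a group morphism $R$ from $\mathcal B(G)$ to the group of semi-linear isomorphisms of $\Gamma E$), associated to the given action $S$.
   Context: All manifolds are smooth and second countable, and all maps are smooth. A fibered manifold $\phi\colon F\to M$ is a surjective submersion; $F_m=\phi^{-1}(m)$ for $m\in M$. $\Gamma E$ is the module of smooth sections of $E\to F$. The source and target maps of $G$ are denoted $\alpha$ and $\beta$; a product $g_2g_1$ is defined when $\beta(g_1)=\alpha(g_2)$. Action of a Lie groupoid: let $\phi^*G=\{(g,p)\in G\times F:\alpha(g)=\phi(p)\}$. An action of $G$ on $\phi\colon F\to M$ is a map $S$ from $G$ to the set of smooth bijective maps from a fiber of $F$ to some (in general different) fiber of $F$, such that (i) for any $g\in G$, $S(g)$ is a map from $F_{\alpha(g)}$ to $F_{\beta(g)}$; (ii) $S(g_2g_1)=S(g_2)\circ S(g_1)$ whenever $\beta(g_1)=\alpha(g_2)$; (iii) the map $\phi^*G\to F$, $(g,p)\mapsto S(g)(p)$, is smooth. Action groupoid: $G\ltimes F$ is the manifold $\phi^*G$ with the Lie groupoid structure on base $F$ with source map $(g,p)\mapsto p$, target map $(g,p)\mapsto S(g)(p)$, partial multiplication $((g_1,p_1),(g_2,p_2))\mapsto(g_1g_2,p_2)$, defined if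 and only if $p_1=S(g_2)p_2$, and inversion $(g,p)\mapsto(g^{-1},S(g)(p))$. The groupoid $\Phi(E)$: $\Phi(E)$ is the Lie groupoid with base $F$ of all linear isomorphisms from a fiber of $E$ to some (in general different) fiber of $E$ (an isomorphism $E_p\to E_{p'}$ has source $p$ and target $p'$), with multiplication the composition of maps and smooth structure given by locally identifying $\Phi(F\times V)$ with $F\times GL(V)\times F$. A representation of a Lie groupoid with base $F$ on $E$ is a base-preserving morphism of Lie groupoids from it to $\Phi(E)$. Bisections: a (smooth) map $b\colon M\to G$ is a bisection of $G$ if $\alpha\circ b=\mathrm{Id}_M$ and $\beta\circ b$ is a diffeomorphism of $M$. The set $\mathcal B(G)$ of bisections is a group under $(b_1\cdot b_2)(m)=b_1((\beta\circ b_2)(m))\,b_2(m)$. Semi-linear isomorphisms: a semi-linear isomorphism of $\Gamma E$ is an $\mathbb R$-linear automorphism $\mu$ of $\Gamma E$ for which there is an $\mathbb R$-linear isomorphism $\mu^F$ of $C^\infty(F)$ with $\mu(f\psi)=\mu^F(f)\mu(\psi)$ for all $f\in C^\infty(F)$, $\psi\in\Gamma E$. Semi-linear isomorphisms of $\Gamma E$ are identified with (not necessarily base-preserving) vector bundle automorphisms $\nu$ of $E$, projecting onto a diffeomorphism $\nu_F$ of $F$, via $\psi\mapsto\nu\circ\psi\circ(\nu_F)^{-1}$; in this way a semi-linear isomorphism also acts on elements $v\in E$. Associated: a group morphism $R$ from $\mathcal B(G)$ to the group of semi-linear isomorphisms of $\Gamma E$ is associated to the action $S$ if, for all $b\in\mathcal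 B(G)$, $p\in F$ and $v\in E_p$, one has $R(b)v\in E_{p'}$ where $p'=S(b(\phi(p)))p$. *)

theory Defs
  imports "HOL-Analysis.Analysis" "HOL-Algebra.Group"
begin

section \<open>Smooth maps between open subsets of \<open>\<real>\<^sup>n\<close>\<close>

text \<open>
  \<open>\<real>\<^sup>n\<close> is the library's \<open>Euclidean_space n\<close>, i.e. the sequences vanishing from index \<open>n\<close> on. Thus
  \<open>n = 0\<close> is allowed, \<open>n\<close> is an ordinary natural number, and \<open>\<real>\<^sup>k \<subseteq> \<real>\<^sup>n\<close> for \<open>k \<le> n\<close> is literally
  the subspace on which the last \<open>n - k\<close> coordinates vanish.
\<close>

abbreviation Rset :: "nat \<Rightarrow> (nat \<Rightarrow> real) set" where
  "Rset n \<equiv> topspace (Euclidean_space n)"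

definition partial_deriv :: "nat \<Rightarrow> ((nat \<Rightarrow> real) \<Rightarrow> real) \<Rightarrow> (nat \<Rightarrow> real) \<Rightarrow> real" where
  "partial_deriv i f z = deriv (\<lambda>s. f (z(i := s))) (z i)"

text \<open>\<open>Ck_on k n W f\<close>: on the open set \<open>W \<subseteq> \<real>\<^sup>n\<close>, all iterated partial derivatives of \<open>f\<close> of order
  at most \<open>k\<close> exist and are continuous. Values of \<open>f\<close> outside \<open>W\<close> are irrelevant.\<close>

primrec Ck_on :: "nat \<Rightarrow> nat \<Rightarrow> (nat \<Rightarrow> real) set \<Rightarrow> ((nat \<Rightarrow> real) \<Rightarrow> real) \<Rightarrow> bool" where
  "Ck_on 0 n W f \<longleftrightarrow> continuous_map (subtopology (Euclidean_space n) W) euclideanreal f"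
| "Ck_on (Suc k) n W f \<longleftrightarrow>
     continuous_map (subtopology (Euclidean_space n) W) euclideanreal f \<and>
     (\<forall>i<n. (\<forall>z\<in>W. (\<lambda>s. f (z(i := s))) field_differentiable at (z i)) \<and>
            Ck_on k n W (partial_deriv i f))"

definition smooth_on :: "nat \<Rightarrow> nat \<Rightarrow> (nat \<Rightarrow> real) set \<Rightarrow> ((nat \<Rightarrow> real) \<Rightarrow> nat \<Rightarrow> real) \<Rightarrow> bool" where
  "smooth_on n m W f \<longleftrightarrow> f ` W \<subseteq> Rset m \<and> (\<forall>j<m. \<forall>k. Ck_on k n W (\<lambda>z. f z j))"

section \<open>Manifolds\<close>

text \<open>A chart \<open>(n, U, x)\<close> is a homeomorphism \<open>x\<close> from the open set \<open>U\<close> onto an open subset of \<open>\<real>\<^sup>n\<close>.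
  The dimension belongs to the chart, so it may vary between connected components.\<close>

type_synonym 'a chart = "nat \<times> 'a set \<times> ('a \<Rightarrow> nat \<Rightarrow> real)"

record 'a mfld =
  mtop :: "'a topology"
  atlas :: "'a chart set"

abbreviation pts :: "'a mfld \<Rightarrow> 'a set" where
  "pts X \<equiv> topspace (mtop X)"

fun is_chart :: "'a topology \<Rightarrow> 'a chart \<Rightarrow> bool" where
  "is_chart T (n, U, x) \<longleftrightarrow>
     openin T U \<and> openin (Euclidean_space n) (x ` U) \<and>
     homeomorphic_map (subtopology T U) (subtopology (Euclidean_space n) (x ` U)) x"

fun compatible :: "'a chart \<Rightarrow> 'a chart \<Rightarrow> bool" where
  "compatible (n, U, x) (m, V, y) \<longleftrightarrow>
     smooth_on n m (x ` (U \<inter> V)) (y \<circ> inv_into U x) \<and>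
     smooth_on m n (y ` (U \<inter> V)) (x \<circ> inv_into V y)"

definition manifold :: "'a mfld \<Rightarrow> bool" where
  "manifold X \<longleftrightarrow>
     Hausdorff_space (mtop X) \<and> second_countable (mtop X) \<and>
     (\<forall>c\<in>atlas X. is_chart (mtop X) c) \<and>
     (\<Union>(n, U, x)\<in>atlas X. U) = pts X \<and>
     (\<forall>c\<in>atlas X. \<forall>d\<in>atlas X. compatible c d)"

definition max_atlas :: "'a mfld \<Rightarrow> 'a chart set" where
  "max_atlas X = {c. is_chart (mtop X) c \<and> (\<forall>d\<in>atlas X. compatible c d)}"

definition smooth_map :: "'a mfld \<Rightarrow> 'b mfld \<Rightarrow> ('a \<Rightarrow> 'b) \<Rightarrow> bool" where
  "smooth_map X Y f \<longleftrightarrow>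
     continuous_map (mtop X) (mtop Y) f \<and>
     (\<forall>p\<in>pts X. \<exists>n U x m V y.
        (n, U, x) \<in> atlas X \<and> (m, V, y) \<in> atlas Y \<and> p \<in> U \<and> f p \<in> V \<and>
        smooth_on n m (x ` (U \<inter> f -` V)) (y \<circ> f \<circ> inv_into U x))"

definition diffeo :: "'a mfld \<Rightarrow> 'b mfld \<Rightarrow> ('a \<Rightarrow> 'b) \<Rightarrow> bool" where
  "diffeo X Y f \<longleftrightarrow>
     bij_betw f (pts X) (pts Y) \<and> smooth_map X Y f \<and> smooth_map Y X (inv_into (pts X) f)"

text \<open>Surjectivity of the differential at every point: with respect to charts around \<open>p\<close> and \<open>f p\<close>,
  the Jacobian matrix maps \<open>\<real>\<^sup>n\<close> onto \<open>\<real>\<^sup>m\<close>.\<close>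

definition submersion :: "'a mfld \<Rightarrow> 'b mfld \<Rightarrow> ('a \<Rightarrow> 'b) \<Rightarrow> bool" where
  "submersion X Y f \<longleftrightarrow>
     smooth_map X Y f \<and>
     (\<forall>(n, U, x)\<in>atlas X. \<forall>(m, V, y)\<in>atlas Y. \<forall>p\<in>U. f p \<in> V \<longrightarrow>
        (\<forall>w\<in>Rset m. \<exists>v\<in>Rset n. \<forall>j<m.
           w j = (\<Sum>i<n. partial_deriv i (\<lambda>z. y (f (inv_into U x z)) j) (x p) * v i)))"

definition Rmfld :: "nat \<Rightarrow> (nat \<Rightarrow> real) mfld" where
  "Rmfld n = \<lparr>mtop = Euclidean_space n, atlas = {(n, Rset n, \<lambda>z. z)}\<rparr>"

definition real_line :: "real mfld" where
  "real_line = \<lparr>mtop = euclideanreal, atlas = {(1, UNIV, \<lambda>s i. if i = 0 then s else 0)}\<rparr>"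

definition cat :: "nat \<Rightarrow> (nat \<Rightarrow> real) \<Rightarrow> (nat \<Rightarrow> real) \<Rightarrow> nat \<Rightarrow> real" where
  "cat n u v = (\<lambda>i. if i < n then u i else v (i - n))"

definition prod_mfld :: "'a mfld \<Rightarrow> 'b mfld \<Rightarrow> ('a \<times> 'b) mfld" where
  "prod_mfld X Y =
     \<lparr>mtop = prod_topology (mtop X) (mtop Y),
      atlas = {(n + m, U \<times> V, \<lambda>(p, q). cat n (x p) (y q)) | n U x m V y.
                 (n, U, x) \<in> atlas X \<and> (m, V, y) \<in> atlas Y}\<rparr>"

text \<open>The embedded submanifold carried by \<open>N\<close>: its charts are the restrictions to \<open>N\<close> of the slice
  charts of \<open>X\<close>. For open \<open>N\<close> (take \<open>k = n\<close>) this is the open submanifold.\<close>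

definition submfld :: "'a mfld \<Rightarrow> 'a set \<Rightarrow> 'a mfld" where
  "submfld X N =
     \<lparr>mtop = subtopology (mtop X) N,
      atlas = {(k, U \<inter> N, x) | k n U x.
                 (n, U, x) \<in> max_atlas X \<and> k \<le> n \<and> x ` (U \<inter> N) = x ` U \<inter> Rset k}\<rparr>"

definition fibered_manifold :: "'f mfld \<Rightarrow> 'm mfld \<Rightarrow> ('f \<Rightarrow> 'm) \<Rightarrow> bool" where
  "fibered_manifold F M \<phi> \<longleftrightarrow>
     manifold F \<and> manifold M \<and> submersion F M \<phi> \<and> \<phi> ` pts F = pts M"

section \<open>Lie groupoids, bisections and actions\<close>

text \<open>The product \<open>gmul G g h\<close> is meaningful only when \<open>gsrc G g = gtgt G h\<close>.\<close>

record ('g, 'm) groupoid =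
  arrows :: "'g mfld"
  gbase :: "'m mfld"
  gsrc :: "'g \<Rightarrow> 'm"
  gtgt :: "'g \<Rightarrow> 'm"
  gmul :: "'g \<Rightarrow> 'g \<Rightarrow> 'g"
  gunit :: "'m \<Rightarrow> 'g"
  ginv :: "'g \<Rightarrow> 'g"

definition composable :: "('g, 'm) groupoid \<Rightarrow> ('g \<times> 'g) set" where
  "composable G =
     {(g, h). g \<in> pts (arrows G) \<and> h \<in> pts (arrows G) \<and> gsrc G g = gtgt G h}"

definition groupoid_laws :: "('g, 'm) groupoid \<Rightarrow> bool" where
  "groupoid_laws G \<longleftrightarrow>
     (\<forall>(g, h)\<in>composable G. gsrc G (gmul G g h) = gsrc G h \<and> gtgt G (gmul G g h) = gtgt G g) \<and>
     (\<forall>g h k. (g, h) \<in> composable G \<longrightarrow> (h, k) \<in> composable G \<longrightarrow>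
        gmul G (gmul G g h) k = gmul G g (gmul G h k)) \<and>
     (\<forall>m\<in>pts (gbase G). gsrc G (gunit G m) = m \<and> gtgt G (gunit G m) = m) \<and>
     (\<forall>g\<in>pts (arrows G).
        gmul G g (gunit G (gsrc G g)) = g \<and> gmul G (gunit G (gtgt G g)) g = g) \<and>
     (\<forall>g\<in>pts (arrows G).
        gsrc G (ginv G g) = gtgt G g \<and> gtgt G (ginv G g) = gsrc G g \<and>
        gmul G (ginv G g) g = gunit G (gsrc G g) \<and> gmul G g (ginv G g) = gunit G (gtgt G g))"

definition lie_groupoid :: "('g, 'm) groupoid \<Rightarrow> bool" where
  "lie_groupoid G \<longleftrightarrow>
     manifold (arrows G) \<and> manifold (gbase G) \<and>
     submersion (arrows G) (gbase G) (gsrc G) \<and>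
     submersion (arrows G) (gbase G) (gtgt G) \<and>
     smooth_map (submfld (prod_mfld (arrows G) (arrows G)) (composable G)) (arrows G)
       (\<lambda>(g, h). gmul G g h) \<and>
     smooth_map (gbase G) (arrows G) (gunit G) \<and>
     smooth_map (arrows G) (arrows G) (ginv G) \<and>
     groupoid_laws G"

definition base_preserving_morphism ::
    "('g, 'm) groupoid \<Rightarrow> ('h, 'm) groupoid \<Rightarrow> ('g \<Rightarrow> 'h) \<Rightarrow> bool" where
  "base_preserving_morphism G H \<rho> \<longleftrightarrow>
     gbase G = gbase H \<and> smooth_map (arrows G) (arrows H) \<rho> \<and>
     (\<forall>g\<in>pts (arrows G). gsrc H (\<rho> g) = gsrc G g \<and> gtgt H (\<rho> g) = gtgt G g) \<and>
     (\<forall>(g, h)\<in>composable G. \<rho> (gmul G g h) = gmul H (\<rho> g) (\<rho> h)) \<and>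
     (\<forall>m\<in>pts (gbase G). \<rho> (gunit G m) = gunit H m)"

text \<open>Functions on a manifold's carrier that have to be compared for equality (bisections, sections,
  smooth functions) are taken to be \<open>extensional\<close>.\<close>

definition bisections :: "('g, 'm) groupoid \<Rightarrow> ('m \<Rightarrow> 'g) set" where
  "bisections G =
     {b \<in> extensional (pts (gbase G)).
        smooth_map (gbase G) (arrows G) b \<and>
        (\<forall>m\<in>pts (gbase G). gsrc G (b m) = m) \<and>
        diffeo (gbase G) (gbase G) (gtgt G \<circ> b)}"

definition bisection_group :: "('g, 'm) groupoid \<Rightarrow> ('m \<Rightarrow> 'g) monoid" where
  "bisection_group G =
     \<lparr>carrier = bisections G,
      mult = (\<lambda>b1 b2. \<lambda>m\<in>pts (gbase G). gmul G (b1 (gtgt G (b2 m))) (b2 m)),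
      one = (\<lambda>m\<in>pts (gbase G). gunit G m)\<rparr>"

definition fib :: "'f mfld \<Rightarrow> ('f \<Rightarrow> 'm) \<Rightarrow> 'm \<Rightarrow> 'f set" where
  "fib F \<phi> m = {p \<in> pts F. \<phi> p = m}"

definition pullback_arrows ::
    "('g, 'm) groupoid \<Rightarrow> 'f mfld \<Rightarrow> ('f \<Rightarrow> 'm) \<Rightarrow> ('g \<times> 'f) mfld" where
  "pullback_arrows G F \<phi> =
     submfld (prod_mfld (arrows G) F)
       {(g, p). g \<in> pts (arrows G) \<and> p \<in> pts F \<and> gsrc G g = \<phi> p}"

text \<open>Only the values of \<open>S g\<close> on the fiber over \<open>gsrc G g\<close> are relevant.\<close>

definition groupoid_action ::
    "('g, 'm) groupoid \<Rightarrow> 'f mfld \<Rightarrow> ('f \<Rightarrow> 'm) \<Rightarrow> ('g \<Rightarrow> 'f \<Rightarrow> 'f) \<Rightarrow> bool" where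
  "groupoid_action G F \<phi> S \<longleftrightarrow>
     (\<forall>g\<in>pts (arrows G).
        bij_betw (S g) (fib F \<phi> (gsrc G g)) (fib F \<phi> (gtgt G g)) \<and>
        smooth_map (submfld F (fib F \<phi> (gsrc G g))) (submfld F (fib F \<phi> (gtgt G g))) (S g)) \<and>
     (\<forall>(g2, g1)\<in>composable G. \<forall>p\<in>fib F \<phi> (gsrc G g1). S (gmul G g2 g1) p = S g2 (S g1 p)) \<and>
     smooth_map (pullback_arrows G F \<phi>) F (\<lambda>(g, p). S g p)"

definition action_groupoid ::
    "('g, 'm) groupoid \<Rightarrow> 'f mfld \<Rightarrow> ('f \<Rightarrow> 'm) \<Rightarrow> ('g \<Rightarrow> 'f \<Rightarrow> 'f) \<Rightarrow> ('g \<times> 'f, 'f) groupoid" where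
  "action_groupoid G F \<phi> S =
     \<lparr>arrows = pullback_arrows G F \<phi>,
      gbase = F,
      gsrc = (\<lambda>(g, p). p),
      gtgt = (\<lambda>(g, p). S g p),
      gmul = (\<lambda>(g1, p1) (g2, p2). (gmul G g1 g2, p2)),
      gunit = (\<lambda>p. (gunit G (\<phi> p), p)),
      ginv = (\<lambda>(g, p). (ginv G g, S g p))\<rparr>"

section \<open>Vector bundles and the groupoid \<open>\<Phi>(E)\<close>\<close>

record ('e, 'f) vbundle =
  total :: "'e mfld"
  vbase :: "'f mfld"
  proj :: "'e \<Rightarrow> 'f"
  vadd :: "'e \<Rightarrow> 'e \<Rightarrow> 'e"
  vscale :: "real \<Rightarrow> 'e \<Rightarrow> 'e"

definition fiber :: "('e, 'f) vbundle \<Rightarrow> 'f \<Rightarrow> 'e set" where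
  "fiber E p = {v \<in> pts (total E). proj E v = p}"

text \<open>In a local trivialization \<open>(r, U, t)\<close>, \<open>v \<mapsto> (proj v, t v)\<close> is a diffeomorphism from the part
  of \<open>E\<close> over \<open>U\<close> onto \<open>U \<times> \<real>\<^sup>r\<close>. As \<open>t\<close> is bijective and linear from each fiber to \<open>\<real>\<^sup>r\<close>, the fibers
  are vector spaces of dimension \<open>r\<close>; the vector space axioms need not be listed separately.
  The rank \<open>r\<close> may vary between connected components of the base.\<close>

fun local_triv :: "('e, 'f) vbundle \<Rightarrow> nat \<times> 'f set \<times> ('e \<Rightarrow> nat \<Rightarrow> real) \<Rightarrow> bool" where
  "local_triv E (r, U, t) \<longleftrightarrow>
     openin (mtop (vbase E)) U \<and>
     diffeo (submfld (total E) {v \<in> pts (total E). proj E v \<in> U})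
       (prod_mfld (submfld (vbase E) U) (Rmfld r)) (\<lambda>v. (proj E v, t v)) \<and>
     (\<forall>p\<in>U. \<forall>v\<in>fiber E p. \<forall>w\<in>fiber E p.
        vadd E v w \<in> fiber E p \<and> t (vadd E v w) = (\<lambda>i. t v i + t w i)) \<and>
     (\<forall>p\<in>U. \<forall>v\<in>fiber E p. \<forall>c.
        vscale E c v \<in> fiber E p \<and> t (vscale E c v) = (\<lambda>i. c * t v i))"

definition vector_bundle :: "('e, 'f) vbundle \<Rightarrow> bool" where
  "vector_bundle E \<longleftrightarrow>
     manifold (total E) \<and> manifold (vbase E) \<and>
     smooth_map (total E) (vbase E) (proj E) \<and>
     proj E ` pts (total E) = pts (vbase E) \<and>
     (\<forall>p\<in>pts (vbase E). \<exists>r U t. p \<in> U \<and> local_triv E (r, U, t))"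

definition linear_iso :: "('e, 'f) vbundle \<Rightarrow> 'f \<Rightarrow> 'f \<Rightarrow> ('e \<Rightarrow> 'e) \<Rightarrow> bool" where
  "linear_iso E p p' A \<longleftrightarrow>
     bij_betw A (fiber E p) (fiber E p') \<and>
     (\<forall>v\<in>fiber E p. \<forall>w\<in>fiber E p. A (vadd E v w) = vadd E (A v) (A w)) \<and>
     (\<forall>v\<in>fiber E p. \<forall>c. A (vscale E c v) = vscale E c (A v))"

text \<open>An element \<open>(p, A, p')\<close> of \<open>\<Phi>(E)\<close> is a linear isomorphism \<open>A\<close> from \<open>fiber E p\<close> to \<open>fiber E p'\<close>.\<close>

type_synonym ('e, 'f) fiber_iso = "'f \<times> ('e \<Rightarrow> 'e) \<times> 'f"

definition fiber_isos :: "('e, 'f) vbundle \<Rightarrow> ('e, 'f) fiber_iso set" where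
  "fiber_isos E =
     {(p, A, p'). p \<in> pts (vbase E) \<and> p' \<in> pts (vbase E) \<and>
                  A \<in> extensional (fiber E p) \<and> linear_iso E p p' A}"

text \<open>The \<open>r \<times> r\<close> matrix of \<open>A\<close> with respect to the frames given by \<open>t\<close> and \<open>t'\<close>, listed row by row;
  column \<open>j\<close> is the image of the \<open>j\<close>-th standard basis vector.\<close>

definition matrix_coords ::
    "('e, 'f) vbundle \<Rightarrow> nat \<Rightarrow> ('e \<Rightarrow> nat \<Rightarrow> real) \<Rightarrow> ('e \<Rightarrow> nat \<Rightarrow> real) \<Rightarrow>
     ('e, 'f) fiber_iso \<Rightarrow> nat \<Rightarrow> real" where
  "matrix_coords E r t t' = (\<lambda>(p, A, p') k.
     if k < r * r
     then t' (A (inv_into (fiber E p) t (\<lambda>i. if i = k mod r then 1 else 0))) (k div r)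
     else 0)"

text \<open>Two trivializations with the same typical fiber identify the isomorphisms between fibers over \<open>V\<close>
  and fibers over \<open>V'\<close> with \<open>V \<times> GL(r) \<times> V'\<close>; charts of the base make this an open subset of
  \<open>\<real>\<^sup>n \<times> \<real>\<^bsup>r * r\<^esup> \<times> \<real>\<^bsup>n'\<^esup>\<close>. The topology is the one making these identifications homeomorphisms.\<close>

definition Phi_atlas :: "('e, 'f) vbundle \<Rightarrow> ('e, 'f) fiber_iso chart set" where
  "Phi_atlas E =
     {(n + (r * r + n'),
       {(p, A, p') \<in> fiber_isos E. p \<in> U \<inter> V \<and> p' \<in> U' \<inter> V'},
       (\<lambda>(p, A, p'). cat n (x p) (cat (r * r) (matrix_coords E r t t' (p, A, p')) (x' p'))))
      | n U x n' U' x' r V t V' t'.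
        (n, U, x) \<in> atlas (vbase E) \<and> (n', U', x') \<in> atlas (vbase E) \<and>
        local_triv E (r, V, t) \<and> local_triv E (r, V', t')}"

definition Phi_mfld :: "('e, 'f) vbundle \<Rightarrow> ('e, 'f) fiber_iso mfld" where
  "Phi_mfld E =
     \<lparr>mtop = topology_generated_by
        {D \<inter> \<kappa> -` Q | N D \<kappa> Q. (N, D, \<kappa>) \<in> Phi_atlas E \<and> openin (Euclidean_space N) Q},
      atlas = Phi_atlas E\<rparr>"

definition Phi :: "('e, 'f) vbundle \<Rightarrow> (('e, 'f) fiber_iso, 'f) groupoid" where
  "Phi E =
     \<lparr>arrows = Phi_mfld E,
      gbase = vbase E,
      gsrc = (\<lambda>(p, A, p'). p),
      gtgt = (\<lambda>(p, A, p'). p'),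
      gmul = (\<lambda>(q, B, q') (p, A, p'). (p, compose (fiber E p) B A, q')),
      gunit = (\<lambda>p. (p, \<lambda>v\<in>fiber E p. v, p)),
      ginv = (\<lambda>(p, A, p'). (p', \<lambda>w\<in>fiber E p'. inv_into (fiber E p) A w, p))\<rparr>"

definition groupoid_rep ::
    "('h, 'f) groupoid \<Rightarrow> ('e, 'f) vbundle \<Rightarrow> ('h \<Rightarrow> ('e, 'f) fiber_iso) \<Rightarrow> bool" where
  "groupoid_rep H E \<rho> \<longleftrightarrow> base_preserving_morphism H (Phi E) \<rho>"

section \<open>Sections and semi-linear isomorphisms\<close>

definition smooth_functions :: "'f mfld \<Rightarrow> ('f \<Rightarrow> real) set" where
  "smooth_functions F = {f \<in> extensional (pts F). smooth_map F real_line f}"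

definition fun_linear_iso :: "'f mfld \<Rightarrow> (('f \<Rightarrow> real) \<Rightarrow> 'f \<Rightarrow> real) \<Rightarrow> bool" where
  "fun_linear_iso F \<theta> \<longleftrightarrow>
     bij_betw \<theta> (smooth_functions F) (smooth_functions F) \<and>
     (\<forall>f\<in>smooth_functions F. \<forall>g\<in>smooth_functions F.
        \<theta> (\<lambda>p\<in>pts F. f p + g p) = (\<lambda>p\<in>pts F. \<theta> f p + \<theta> g p)) \<and>
     (\<forall>f\<in>smooth_functions F. \<forall>c.
        \<theta> (\<lambda>p\<in>pts F. c * f p) = (\<lambda>p\<in>pts F. c * \<theta> f p))"

definition sections :: "('e, 'f) vbundle \<Rightarrow> ('f \<Rightarrow> 'e) set" where
  "sections E =
     {\<psi> \<in> extensional (pts (vbase E)).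
        smooth_map (vbase E) (total E) \<psi> \<and> (\<forall>p\<in>pts (vbase E). proj E (\<psi> p) = p)}"

definition sec_add :: "('e, 'f) vbundle \<Rightarrow> ('f \<Rightarrow> 'e) \<Rightarrow> ('f \<Rightarrow> 'e) \<Rightarrow> 'f \<Rightarrow> 'e" where
  "sec_add E \<psi> \<eta> = (\<lambda>p\<in>pts (vbase E). vadd E (\<psi> p) (\<eta> p))"

definition sec_mult :: "('e, 'f) vbundle \<Rightarrow> ('f \<Rightarrow> real) \<Rightarrow> ('f \<Rightarrow> 'e) \<Rightarrow> 'f \<Rightarrow> 'e" where
  "sec_mult E f \<psi> = (\<lambda>p\<in>pts (vbase E). vscale E (f p) (\<psi> p))"

definition semilinear_isos :: "('e, 'f) vbundle \<Rightarrow> (('f \<Rightarrow> 'e) \<Rightarrow> 'f \<Rightarrow> 'e) set" where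
  "semilinear_isos E =
     {\<mu> \<in> extensional (sections E).
        bij_betw \<mu> (sections E) (sections E) \<and>
        (\<forall>\<psi>\<in>sections E. \<forall>\<eta>\<in>sections E. \<mu> (sec_add E \<psi> \<eta>) = sec_add E (\<mu> \<psi>) (\<mu> \<eta>)) \<and>
        (\<forall>\<psi>\<in>sections E. \<forall>c. \<mu> (sec_mult E (\<lambda>_. c) \<psi>) = sec_mult E (\<lambda>_. c) (\<mu> \<psi>)) \<and>
        (\<exists>\<theta>. fun_linear_iso (vbase E) \<theta> \<and>
           (\<forall>f\<in>smooth_functions (vbase E). \<forall>\<psi>\<in>sections E.
              \<mu> (sec_mult E f \<psi>) = sec_mult E (\<theta> f) (\<mu> \<psi>)))}"

definition semilinear_group :: "('e, 'f) vbundle \<Rightarrow> (('f \<Rightarrow> 'e) \<Rightarrow> 'f \<Rightarrow> 'e) monoid" where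
  "semilinear_group E =
     \<lparr>carrier = semilinear_isos E,
      mult = (\<lambda>\<mu>1 \<mu>2. compose (sections E) \<mu>1 \<mu>2),
      one = (\<lambda>\<psi>\<in>sections E. \<psi>)\<rparr>"

definition vb_automorphism :: "('e, 'f) vbundle \<Rightarrow> ('e \<Rightarrow> 'e) \<Rightarrow> ('f \<Rightarrow> 'f) \<Rightarrow> bool" where
  "vb_automorphism E \<nu> \<nu>F \<longleftrightarrow>
     diffeo (total E) (total E) \<nu> \<and> diffeo (vbase E) (vbase E) \<nu>F \<and>
     (\<forall>v\<in>pts (total E). proj E (\<nu> v) = \<nu>F (proj E v)) \<and>
     (\<forall>p\<in>pts (vbase E). linear_iso E p (\<nu>F p) \<nu>)"

definition induces :: "('e, 'f) vbundle \<Rightarrow> ('e \<Rightarrow> 'e) \<Rightarrow> ('f \<Rightarrow> 'f) \<Rightarrow> (('f \<Rightarrow> 'e) \<Rightarrow> 'f \<Rightarrow> 'e) \<Rightarrow> bool" where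
  "induces E \<nu> \<nu>F \<mu> \<longleftrightarrow>
     (\<forall>\<psi>\<in>sections E. \<mu> \<psi> = (\<lambda>p\<in>pts (vbase E). \<nu> (\<psi> (inv_into (pts (vbase E)) \<nu>F p))))"

text \<open>\<open>R b\<close> acts on elements of \<open>E\<close> through the vector bundle automorphism \<open>\<nu>\<close> that induces it.\<close>

definition associated ::
    "('g, 'm) groupoid \<Rightarrow> ('f \<Rightarrow> 'm) \<Rightarrow> ('g \<Rightarrow> 'f \<Rightarrow> 'f) \<Rightarrow> ('e, 'f) vbundle \<Rightarrow>
     (('m \<Rightarrow> 'g) \<Rightarrow> ('f \<Rightarrow> 'e) \<Rightarrow> 'f \<Rightarrow> 'e) \<Rightarrow> bool" where
  "associated G \<phi> S E R \<longleftrightarrow>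
     (\<forall>b\<in>bisections G. \<exists>\<nu> \<nu>F. vb_automorphism E \<nu> \<nu>F \<and> induces E \<nu> \<nu>F (R b) \<and>
        (\<forall>p\<in>pts (vbase E). \<forall>v\<in>fiber E p. \<nu> v \<in> fiber E (S (b (\<phi> p)) p)))"

end

theory Submission
  imports Defs
begin

text \<open>
  A bisection \<open>b\<close> acts on \<open>F\<close> by \<open>p \<mapsto> S (b (\<phi> p)) p\<close> and on \<open>E\<close> by applying to \<open>v \<in> E\<^sub>p\<close> the
  isomorphism \<open>\<rho> (b (\<phi> p), p)\<close>. The second map is linear on fibers and covers the first, and both
  are multiplicative in \<open>b\<close> because \<open>\<rho>\<close> is a morphism. Only smoothness needs work: both maps factor
  through the graph \<open>p \<mapsto> (b (\<phi> p), p)\<close>, and in local trivializations the second is \<open>t v \<mapsto> A t v\<close> with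
  a matrix \<open>A\<close> of smooth functions. The inverses come from the inverse bisection, hence are smooth for
  the same reason. Pushing sections forward along the resulting vector bundle automorphism gives \<open>R b\<close>.
\<close>

section \<open>The topology of coordinate space\<close>

text \<open>The obstacle lies in the spaces in the middle of these factorizations. The pullback, the
  two sides of a local trivialization and \<open>Phi E\<close> come with an atlas but are never
  shown to be manifolds, so a composition rule for manifolds does not apply to them. Smoothness is
  therefore carried by germs of real functions on the source (\<open>smooth_at\<close>), and the
  source is always a given manifold: \<open>gbase G\<close>, \<open>F\<close> or
  \<open>total E\<close>. From a middle space it suffices that charts are injective and open, from
  \<open>Phi E\<close> that chart domains are open. Reading germs through charts then rests on one
  analytic fact, the chain rule for iterated partial derivatives (\<open>Ck_on_compose\<close>),
  which in turn rests on differentiating a function along a curve; there the continuity of the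
  partial derivatives enters.\<close>

lemma Rset_iff: "z \<in> Rset n \<longleftrightarrow> (\<forall>i\<ge>n. z i = 0)"
  by (simp add: topspace_Euclidean_space)

lemma Rset_upd: "z \<in> Rset n \<Longrightarrow> i < n \<Longrightarrow> z(i := s) \<in> Rset n"
  by (auto simp: Rset_iff)

lemma Euclidean_space_top_of_set: "Euclidean_space n = top_of_set {z. \<forall>i\<ge>n. z i = 0}"
  by (simp add: Euclidean_space_def euclidean_product_topology)

lemma openin_Euclidean_space: "openin (Euclidean_space n) W \<longleftrightarrow> (\<exists>T. open T \<and> W = Rset n \<inter> T)"
  unfolding Euclidean_space_top_of_set openin_open by simp

definition ebox :: "nat \<Rightarrow> (nat \<Rightarrow> real) \<Rightarrow> real \<Rightarrow> (nat \<Rightarrow> real) set" where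
  "ebox n z e = {w \<in> Rset n. \<forall>i<n. \<bar>w i - z i\<bar> < e}"

lemma openin_ebox: "openin (Euclidean_space n) (ebox n z e)"
proof -
  have "open (\<Inter>i<n. {w :: nat \<Rightarrow> real. \<bar>w i - z i\<bar> < e})"
    by (intro open_INT ballI open_Collect_less continuous_intros) auto
  moreover have "ebox n z e = Rset n \<inter> (\<Inter>i<n. {w. \<bar>w i - z i\<bar> < e})"
    by (auto simp: ebox_def)
  ultimately show ?thesis
    by (auto simp: openin_Euclidean_space)
qed

text \<open>In a product neighbourhood of \<open>z\<close> the coordinates from \<open>n\<close> on
  take care of themselves: they are 0 at \<open>z\<close> and at every point of
  \<open>Rset n\<close>. Only finitely many radii remain, so one positive radius works for all of
  them.\<close>

lemma openin_Euclidean_box: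
  "openin (Euclidean_space n) W \<longleftrightarrow> W \<subseteq> Rset n \<and> (\<forall>z\<in>W. \<exists>e>0. ebox n z e \<subseteq> W)"
proof (intro iffI conjI ballI)
  assume W: "openin (Euclidean_space n) W"
  then show sub: "W \<subseteq> Rset n"
    by (rule openin_subset)
  fix z assume z: "z \<in> W"
  obtain T where T: "open T" "W = Rset n \<inter> T"
    using W by (auto simp: openin_Euclidean_space)
  then have "openin (product_topology (\<lambda>i. euclidean) UNIV) T"
    by (simp add: euclidean_product_topology)
  with z T obtain X where X: "z \<in> (\<Pi>\<^sub>E i\<in>UNIV. X i)" "\<And>i. open (X i :: real set)"
      "(\<Pi>\<^sub>E i\<in>UNIV. X i) \<subseteq> T"
    using product_topology_open_contains_basis[of "\<lambda>i. euclidean" UNIV T z] by auto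
  have "\<exists>e>0. \<forall>y. \<bar>y - z i\<bar> < e \<longrightarrow> y \<in> X i" for i
    using X(2)[of i] X(1) by (auto simp: open_dist dist_real_def PiE_iff)
  then obtain e where e: "\<And>i. e i > 0" "\<And>i y. \<bar>y - z i\<bar> < e i \<Longrightarrow> y \<in> X i"
    by metis
  \<comment> \<open>The element 1 keeps the set nonempty when \<open>n = 0\<close>.\<close>
  define d where "d = Min (insert 1 (e ` {..<n}))"
  have d: "d > 0" "\<And>i. i < n \<Longrightarrow> d \<le> e i"
    by (auto simp: d_def e(1) Min_gr_iff)
  have "ebox n z d \<subseteq> W"
  proof
    fix w assume w: "w \<in> ebox n z d"
    have "w i \<in> X i" for i
    proof (cases "i < n")
      case True
      then show ?thesis
        using w d(2)[OF True] by (intro e(2)) (auto simp: ebox_def)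
    next
      case False
      then show ?thesis
        using w z sub e(1)[of i] by (intro e(2)) (auto simp: ebox_def Rset_iff subset_iff)
    qed
    then show "w \<in> W"
      using w X(3) T by (auto simp: ebox_def)
  qed
  with d(1) show "\<exists>e>0. ebox n z e \<subseteq> W"
    by blast
next
  assume *: "W \<subseteq> Rset n \<and> (\<forall>z\<in>W. \<exists>e>0. ebox n z e \<subseteq> W)"
  show "openin (Euclidean_space n) W"
  proof (subst openin_subopen, intro ballI)
    fix z assume z: "z \<in> W"
    then obtain e where "e > 0" "ebox n z e \<subseteq> W"
      using * by blast
    moreover have "z \<in> ebox n z e"
      using z * \<open>e > 0\<close> by (auto simp: ebox_def)
    ultimately show "\<exists>T. openin (Euclidean_space n) T \<and> z \<in> T \<and> T \<subseteq> W"
      using openin_ebox by blast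
  qed
qed

lemma openin_Euclidean_subset: "openin (Euclidean_space n) W \<Longrightarrow> W \<subseteq> Rset n"
  by (rule openin_subset)

text \<open>Translates the topology used in \<open>Ck_on\<close> into \<open>continuous_on\<close>,
  where the rules for limits and derivatives are available.\<close>

lemma continuous_map_Euclidean_real:
  assumes "W \<subseteq> Rset n"
  shows "continuous_map (subtopology (Euclidean_space n) W) euclideanreal f \<longleftrightarrow> continuous_on W f"
proof -
  have "W \<subseteq> {z. \<forall>i\<ge>n. z i = 0}"
    using assms by (simp add: topspace_Euclidean_space)
  then show ?thesis
    unfolding Euclidean_space_top_of_set by (simp add: subtopology_subtopology Int_absorb1)
qed

lemma open_upd_line:
  assumes "openin (Euclidean_space n) W" "z \<in> W" "i < n"
  shows "\<exists>e>0. \<forall>s. \<bar>s - z i\<bar> < e \<longrightarrow> z(i := s) \<in> W"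
proof -
  obtain e where e: "e > 0" "ebox n z e \<subseteq> W"
    using assms by (auto simp: openin_Euclidean_box)
  have "z \<in> Rset n"
    using assms openin_Euclidean_subset by blast
  then have "z(i := s) \<in> ebox n z e" if "\<bar>s - z i\<bar> < e" for s
    using that e(1) Rset_upd[OF _ assms(3)] by (auto simp: ebox_def)
  with e show ?thesis
    by blast
qed

text \<open>This is what makes a partial derivative at a point of an open set depend only on the
  values in that set.\<close>

lemma eventually_upd_line:
  assumes "openin (Euclidean_space n) W" "z \<in> W" "i < n"
  shows "eventually (\<lambda>s. z(i := s) \<in> W) (nhds (z i))"
  using open_upd_line[OF assms] by (auto simp: eventually_nhds_metric dist_real_def)

section \<open>Differentiation along curves in coordinate space\<close>

lemma tendsto_componentwise_fun:
  fixes f :: "'a \<Rightarrow> nat \<Rightarrow> real"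
  assumes "\<And>i. ((\<lambda>x. f x i) \<longlongrightarrow> l i) A"
  shows "(f \<longlongrightarrow> l) A"
proof -
  have "limitin (product_topology (\<lambda>i. euclidean) UNIV) f l A"
    using assms by (simp add: limitin_componentwise)
  then show ?thesis
    by (simp add: euclidean_product_topology)
qed

text \<open>A curve may move a coordinate up, down or not at all, so the mean value theorem is
  needed for endpoints in either order and for equal ones.\<close>

lemma mean_value_segment:
  fixes F :: "real \<Rightarrow> real"
  assumes "\<And>t. t \<in> closed_segment a b \<Longrightarrow> (F has_field_derivative F' t) (at t)"
  shows "\<exists>t\<in>closed_segment a b. F b - F a = F' t * (b - a)"
proof -
  consider "a < b" | "a = b" | "b < a"
    by linarith
  then show ?thesis
  proof cases
    case 1
    then obtain t where "a < t" "t < b" "F b - F a = (b - a) * F' t"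
      using MVT2[of a b F F'] assms by (auto simp: closed_segment_eq_real_ivl)
    then show ?thesis
      by (intro bexI[of _ t]) (auto simp: closed_segment_eq_real_ivl)
  next
    case 2
    then show ?thesis by auto
  next
    case 3
    then obtain t where "b < t" "t < a" "F a - F b = (a - b) * F' t"
      using MVT2[of b a F F'] assms by (auto simp: closed_segment_eq_real_ivl)
    then show ?thesis
      by (intro bexI[of _ t]) (auto simp: closed_segment_eq_real_ivl algebra_simps)
  qed
qed

lemma partial_deriv_line:
  assumes "(\<lambda>s. f (z(i := s))) field_differentiable at (z i)"
  shows "((\<lambda>s. f (z(i := s))) has_field_derivative partial_deriv i f z) (at (z i))"
  using assms by (simp add: partial_deriv_def field_differentiable_derivI)

text \<open>The increment of \<open>h\<close> along the curve \<open>u\<close> is telescoped, one coordinate at a time.\<close>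

lemma has_derivative_along_curve:
  assumes D: "openin (Euclidean_space m) D"
    and diff: "\<And>j w. j < m \<Longrightarrow> w \<in> D \<Longrightarrow> (\<lambda>s. h (w(j := s))) field_differentiable at (w j)"
    and cont: "\<And>j. j < m \<Longrightarrow> continuous_on D (partial_deriv j h)"
    and u: "u s0 \<in> D" "\<And>s. u s \<in> Rset m"
    and du: "\<And>j. j < m \<Longrightarrow> ((\<lambda>s. u s j) has_field_derivative d j) (at s0)"
  shows "((\<lambda>s. h (u s)) has_field_derivative (\<Sum>j<m. partial_deriv j h (u s0) * d j)) (at s0)"
proof -
  define a where "a = u s0"
  \<comment> \<open>A staircase from \<open>a\<close> to \<open>u s\<close>: the first
    \<open>j\<close> coordinates have already moved. It ends exactly at \<open>u s\<close> because
    both points vanish from \<open>m\<close> on.\<close>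
  define w where "w j s = (\<lambda>i. if i < j then u s i else a i)" for j :: nat and s
  have w0: "w 0 s = a" and wm: "w m s = u s" for s
    using u(2)[of s] u(2)[of s0] by (auto simp: w_def a_def Rset_iff fun_eq_iff)
  obtain e where e: "e > 0" "ebox m a e \<subseteq> D"
    using D u(1) by (auto simp: openin_Euclidean_box a_def)
  have lim: "((\<lambda>s. u s j) \<longlongrightarrow> a j) (at s0)" if "j < m" for j
    using DERIV_isCont[OF du[OF that]] by (simp add: isCont_def a_def)
  have near: "eventually (\<lambda>s. \<forall>j<m. \<bar>u s j - a j\<bar> < e) (at s0)"
  proof -
    have "eventually (\<lambda>s. \<forall>j\<in>{..<m}. \<bar>u s j - a j\<bar> < e) (at s0)"
      using tendstoD[OF lim e(1)] by (intro eventually_ball_finite) (auto simp: dist_real_def)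
    then show ?thesis
      by (auto elim: eventually_mono)
  qed
  have step: "((\<lambda>s. h (w (Suc j) s) - h (w j s)) has_field_derivative partial_deriv j h a * d j) (at s0)"
    if j: "j < m" for j
  proof -
    \<comment> \<open>Passing from \<open>w j s\<close> to \<open>w (Suc j) s\<close> changes one
      coordinate only. The whole segment stays in the box around \<open>a\<close>, hence in
      \<open>D\<close>, and the mean value theorem applies.\<close>
    have "\<exists>t. t \<in> closed_segment (a j) (u s j) \<and> (w j s)(j := t) \<in> D \<and>
        h (w (Suc j) s) - h (w j s) = partial_deriv j h ((w j s)(j := t)) * (u s j - a j)"
      if s: "\<forall>j<m. \<bar>u s j - a j\<bar> < e" for s
    proof -
      have inD: "(w j s)(j := t) \<in> D" if t: "t \<in> closed_segment (a j) (u s j)" for t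
      proof -
        have "\<bar>t - a j\<bar> \<le> \<bar>u s j - a j\<bar>"
          using t by (auto simp: closed_segment_eq_real_ivl split: if_splits)
        also have "\<dots> < e"
          using s j by blast
        finally have "\<bar>t - a j\<bar> < e" .
        then have "(w j s)(j := t) \<in> ebox m a e"
          using s j e(1) u(2)[of s] u(2)[of s0] by (auto simp: ebox_def w_def a_def Rset_iff)
        then show ?thesis
          using e(2) by blast
      qed
      have "((\<lambda>t. h ((w j s)(j := t))) has_field_derivative partial_deriv j h ((w j s)(j := t))) (at t)"
        if "t \<in> closed_segment (a j) (u s j)" for t
        using partial_deriv_line[of h "(w j s)(j := t)" j, OF diff[OF j inD[OF that]]]
        by (simp only: fun_upd_upd fun_upd_same)
      from mean_value_segment[OF this] obtain t where t: "t \<in> closed_segment (a j) (u s j)"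
        "h ((w j s)(j := u s j)) - h ((w j s)(j := a j))
           = partial_deriv j h ((w j s)(j := t)) * (u s j - a j)"
        by blast
      have "(w j s)(j := u s j) = w (Suc j) s" "(w j s)(j := a j) = w j s"
        by (auto simp: w_def fun_eq_iff less_Suc_eq)
      with t inD show ?thesis
        by auto
    qed
    then obtain \<xi> where \<xi>: "\<And>s. \<forall>j<m. \<bar>u s j - a j\<bar> < e \<Longrightarrow>
        \<xi> s \<in> closed_segment (a j) (u s j) \<and> (w j s)(j := \<xi> s) \<in> D \<and>
        h (w (Suc j) s) - h (w j s) = partial_deriv j h ((w j s)(j := \<xi> s)) * (u s j - a j)"
      by metis
    \<comment> \<open>\<open>\<xi> s\<close> lies between \<open>a j\<close> and
      \<open>u s j\<close>, so it is squeezed to \<open>a j\<close>.\<close>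
    have \<xi>lim: "(\<xi> \<longlongrightarrow> a j) (at s0)"
    proof (rule Lim_transform_bound[OF _ lim[OF j, THEN LIM_zero], THEN LIM_zero_cancel])
      show "\<forall>\<^sub>F s in at s0. norm (\<xi> s - a j) \<le> norm (u s j - a j)"
        using near
      proof eventually_elim
        case (elim s)
        then show ?case
          using \<xi>[OF elim] by (auto simp: closed_segment_eq_real_ivl split: if_splits)
      qed
    qed
    have "((\<lambda>s. (w j s)(j := \<xi> s)) \<longlongrightarrow> a) (at s0)"
    proof (rule tendsto_componentwise_fun)
      fix i
      show "((\<lambda>s. ((w j s)(j := \<xi> s)) i) \<longlongrightarrow> a i) (at s0)"
        using \<xi>lim lim[of i] j by (cases "i = j"; cases "i < j") (simp_all add: w_def)
    qed
    then have plim: "((\<lambda>s. partial_deriv j h ((w j s)(j := \<xi> s))) \<longlongrightarrow> partial_deriv j h a) (at s0)"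
      by (rule continuous_on_tendsto_compose[OF cont[OF j]])
        (use u(1) near \<xi> in \<open>auto simp: a_def elim!: eventually_mono\<close>)
    \<comment> \<open>The difference quotient of the increment is the partial derivative at the
      intermediate point times the quotient of \<open>u s j\<close>. The former converges by
      continuity of the partial derivative, the latter by differentiability of the curve.\<close>
    have "((\<lambda>s. partial_deriv j h ((w j s)(j := \<xi> s)) * ((u s j - a j) / (s - s0)))
        \<longlongrightarrow> partial_deriv j h a * d j) (at s0)"
      using du[OF j] by (intro tendsto_mult plim) (auto simp: has_field_derivative_iff a_def)
    then show ?thesis
      unfolding has_field_derivative_iff
    proof (rule Lim_transform_eventually)
      have w_s0: "w i s0 = a" for i
        by (auto simp: w_def a_def)
      show "\<forall>\<^sub>F s in at s0. partial_deriv j h ((w j s)(j := \<xi> s)) * ((u s j - a j) / (s - s0))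
          = (h (w (Suc j) s) - h (w j s) - (h (w (Suc j) s0) - h (w j s0))) / (s - s0)"
        using near
      proof (rule eventually_mono)
        fix s assume elim: "\<forall>j<m. \<bar>u s j - a j\<bar> < e"
        have "h (w (Suc j) s) - h (w j s) = partial_deriv j h ((w j s)(j := \<xi> s)) * (u s j - a j)"
          by (rule \<xi>[OF elim, THEN conjunct2, THEN conjunct2])
        then show "partial_deriv j h ((w j s)(j := \<xi> s)) * ((u s j - a j) / (s - s0))
          = (h (w (Suc j) s) - h (w j s) - (h (w (Suc j) s0) - h (w j s0))) / (s - s0)"
          by (simp only: w_s0 diff_self diff_0_right times_divide_eq_right)
      qed
    qed
  qed
  have "((\<lambda>s. h a + (\<Sum>j<m. h (w (Suc j) s) - h (w j s))) has_field_derivative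
      0 + (\<Sum>j<m. partial_deriv j h a * d j)) (at s0)"
    by (intro derivative_intros step) auto
  moreover have "h a + (\<Sum>j<m. h (w (Suc j) s) - h (w j s)) = h (u s)" for s
    using sum_lessThan_telescope[of "\<lambda>j. h (w j s)" m] by (simp add: w0 wm)
  ultimately show ?thesis
    by (simp add: a_def)
qed

section \<open>Calculus of iterated partial derivatives\<close>

lemma partial_deriv_cong:
  assumes "openin (Euclidean_space n) W" "\<And>z. z \<in> W \<Longrightarrow> f z = g z" "z \<in> W" "i < n"
  shows "partial_deriv i f z = partial_deriv i g z"
  unfolding partial_deriv_def
  by (rule deriv_cong_ev[OF _ refl], rule eventually_mono[OF eventually_upd_line[OF assms(1,3,4)]])
    (use assms(2) in auto)

lemma field_differentiable_line_cong:
  assumes "openin (Euclidean_space n) W" "\<And>z. z \<in> W \<Longrightarrow> f z = g z" "z \<in> W" "i < n"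
    and "(\<lambda>s. f (z(i := s))) field_differentiable at (z i)"
  shows "(\<lambda>s. g (z(i := s))) field_differentiable at (z i)"
proof -
  have ev: "eventually (\<lambda>s. f (z(i := s)) = g (z(i := s))) (nhds (z i))"
    using eventually_upd_line[OF assms(1,3,4)] by (rule eventually_mono) (rule assms(2))
  have "((\<lambda>s. g (z(i := s))) has_field_derivative partial_deriv i f z) (at (z i))"
    using partial_deriv_line[OF assms(5)]
    by (rule DERIV_cong_ev[OF refl ev refl, THEN iffD1])
  then show ?thesis
    by (auto simp: field_differentiable_def)
qed

lemma Ck_on_continuous:
  assumes "openin (Euclidean_space n) W" "Ck_on k n W f"
  shows "continuous_on W f"
  using assms continuous_map_Euclidean_real[OF openin_Euclidean_subset[OF assms(1)]]
  by (cases k) auto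

lemma Ck_on_cong:
  assumes "openin (Euclidean_space n) W" "\<And>z. z \<in> W \<Longrightarrow> f z = g z" "Ck_on k n W f"
  shows "Ck_on k n W g"
  using assms(2,3)
proof (induction k arbitrary: f g)
  case 0
  then show ?case
    using openin_Euclidean_subset[OF assms(1)]
    by (auto simp: continuous_map_Euclidean_real cong: continuous_on_cong)
next
  case (Suc k)
  have "continuous_on W g"
    using Ck_on_continuous[OF assms(1) Suc.prems(2)] Suc.prems(1) by (auto cong: continuous_on_cong)
  moreover have "Ck_on k n W (partial_deriv i g)" if "i < n" for i
  proof (rule Suc.IH)
    show "Ck_on k n W (partial_deriv i f)"
      using Suc.prems(2) that by simp
    show "partial_deriv i f z = partial_deriv i g z" if "z \<in> W" for z
      by (rule partial_deriv_cong[OF assms(1) _ that \<open>i < n\<close>]) (rule Suc.prems(1))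
  qed
  moreover have "(\<lambda>s. g (z(i := s))) field_differentiable at (z i)" if "i < n" "z \<in> W" for i z
    using Suc.prems that by (auto intro: field_differentiable_line_cong[OF assms(1) _ that(2,1)])
  ultimately show ?case
    using openin_Euclidean_subset[OF assms(1)] by (auto simp: continuous_map_Euclidean_real)
qed

lemma Ck_on_subset:
  assumes "W' \<subseteq> W" "Ck_on k n W f"
  shows "Ck_on k n W' f"
  using assms(2)
proof (induction k arbitrary: f)
  case 0
  then show ?case
    using assms(1) continuous_map_from_subtopology_mono by auto
next
  case (Suc k)
  then show ?case
    using assms(1) continuous_map_from_subtopology_mono by auto
qed

text \<open>\<open>W'\<close> is not a neighbourhood of \<open>z\<close> in the space of all
  sequences, only in \<open>Rset n\<close>. Continuity is therefore first extended from
  \<open>W'\<close> to \<open>Rset n\<close> at \<open>z\<close> and then cut down to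
  \<open>W\<close>.\<close>

lemma continuous_on_local:
  assumes "openin (Euclidean_space n) W"
    and "\<And>z. z \<in> W \<Longrightarrow> \<exists>W'. openin (Euclidean_space n) W' \<and> z \<in> W' \<and> continuous_on W' f"
  shows "continuous_on W f"
  unfolding continuous_on_eq_continuous_within
proof
  fix z assume z: "z \<in> W"
  then obtain W' where W': "openin (Euclidean_space n) W'" "z \<in> W'" "continuous_on W' f"
    using assms(2) by blast
  then have "continuous (at z within W') f"
    by (simp add: continuous_on_eq_continuous_within)
  moreover obtain T where T: "open T" "W' = Rset n \<inter> T"
    using W'(1) by (auto simp: openin_Euclidean_space)
  moreover have "at z within Rset n = at z within W'"
    using T W'(2) by (intro at_within_nhd[of z T]) auto
  ultimately have "continuous (at z within Rset n) f"
    by simp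
  then show "continuous (at z within W) f"
    by (rule continuous_within_subset) (rule openin_Euclidean_subset[OF assms(1)])
qed

lemma Ck_on_local:
  assumes "openin (Euclidean_space n) W"
    and "\<And>z. z \<in> W \<Longrightarrow> \<exists>W'. openin (Euclidean_space n) W' \<and> z \<in> W' \<and> Ck_on k n W' f"
  shows "Ck_on k n W f"
  using assms(2)
proof (induction k arbitrary: f)
  case 0
  then show ?case
    using continuous_on_local[OF assms(1), of f] openin_Euclidean_subset[OF assms(1)]
    by (simp add: continuous_map_Euclidean_real) (metis Ck_on.simps(1) Ck_on_continuous)
next
  case (Suc k)
  have cont: "continuous_on W f"
    by (rule continuous_on_local[OF assms(1)]) (metis Suc.prems Ck_on_continuous)
  have "Ck_on k n W (partial_deriv i f)" if "i < n" for i
  proof (rule Suc.IH)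
    show "\<exists>W'. openin (Euclidean_space n) W' \<and> z \<in> W' \<and> Ck_on k n W' (partial_deriv i f)"
      if "z \<in> W" for z
      using Suc.prems[OF that] \<open>i < n\<close> by auto
  qed
  moreover have "(\<lambda>s. f (z(i := s))) field_differentiable at (z i)" if "i < n" "z \<in> W" for i z
    using Suc.prems[OF that(2)] that(1) by (auto simp del: fun_upd_apply)
  moreover note cont
  ultimately show ?case
    using openin_Euclidean_subset[OF assms(1)] by (simp add: continuous_map_Euclidean_real)
qed

text \<open>With a free candidate \<open>d\<close> for the derivatives, the sum, product and chain
  rules can hand their closed formulas to the induction hypothesis instead of
  \<open>partial_deriv\<close> of a compound function.\<close>

lemma Ck_on_SucI:
  assumes W: "openin (Euclidean_space n) W" and "continuous_on W f"
    and d: "\<And>i z. i < n \<Longrightarrow> z \<in> W \<Longrightarrow>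
      ((\<lambda>s. f (z(i := s))) has_field_derivative d i z) (at (z i))"
    and Ck: "\<And>i. i < n \<Longrightarrow> Ck_on k n W (d i)"
  shows "Ck_on (Suc k) n W f"
proof -
  have "Ck_on k n W (partial_deriv i f)" if "i < n" for i
    by (rule Ck_on_cong[OF W _ Ck[OF that]])
      (simp add: partial_deriv_def DERIV_imp_deriv[OF d[OF that]])
  moreover have "(\<lambda>s. f (z(i := s))) field_differentiable at (z i)" if "i < n" "z \<in> W" for i z
    using d[OF that] by (auto simp: field_differentiable_def)
  ultimately show ?thesis
    using assms(2) openin_Euclidean_subset[OF W] by (simp add: continuous_map_Euclidean_real)
qed

lemma Ck_on_Suc_derivative:
  assumes "Ck_on (Suc k) n W f" "i < n" "z \<in> W"
  shows "((\<lambda>s. f (z(i := s))) has_field_derivative partial_deriv i f z) (at (z i))"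
proof (rule partial_deriv_line)
  show "(\<lambda>s. f (z(i := s))) field_differentiable at (z i)"
    using assms by (simp del: fun_upd_apply)
qed

lemma Ck_on_Suc_partial: "Ck_on (Suc k) n W f \<Longrightarrow> i < n \<Longrightarrow> Ck_on k n W (partial_deriv i f)"
  by (meson Ck_on.simps(2))

text \<open>The product and chain rules multiply a derivative, which has order \<open>k\<close>, by
  a factor of order \<open>Suc k\<close>; the latter has to be lowered to the order of the induction
  hypothesis.\<close>

lemma Ck_on_SucD:
  assumes "Ck_on (Suc k) n W f"
  shows "Ck_on k n W f"
  using assms
proof (induction k arbitrary: f)
  case (Suc k)
  show ?case
    unfolding Ck_on.simps(2)[of k n W f]
    using Suc.prems Suc.IH[OF Ck_on_Suc_partial[OF Suc.prems]]
    by (auto simp del: Ck_on.simps simp: Ck_on.simps(2)[of "Suc k" n W f])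
qed simp

lemma Ck_on_const:
  assumes W: "openin (Euclidean_space n) W"
  shows "Ck_on k n W (\<lambda>z. c)"
proof (induction k arbitrary: c)
  case 0
  then show ?case by simp
next
  case (Suc k)
  show ?case
    by (rule Ck_on_SucI[where d = "\<lambda>i z. 0", OF W]) (auto intro: Suc)
qed

lemma Ck_on_coordinate:
  assumes W: "openin (Euclidean_space n) W"
  shows "Ck_on k n W (\<lambda>z. z j)"
proof (cases k)
  case 0
  then show ?thesis
    using openin_Euclidean_subset[OF W] continuous_on_product_then_coordinatewise[OF continuous_on_id]
    by (simp add: continuous_map_Euclidean_real)
next
  case (Suc k')
  show ?thesis
    unfolding Suc
  proof (rule Ck_on_SucI[OF W])
    show "continuous_on W (\<lambda>z. z j)"
      by (rule continuous_on_product_then_coordinatewise[OF continuous_on_id])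
    show "((\<lambda>s. (z(i := s)) j) has_field_derivative (if i = j then 1 else 0)) (at (z i))" for i z
      by auto
  qed (rule Ck_on_const[OF W])
qed

lemma Ck_on_add:
  assumes W: "openin (Euclidean_space n) W"
  shows "Ck_on k n W f \<Longrightarrow> Ck_on k n W g \<Longrightarrow> Ck_on k n W (\<lambda>z. f z + g z)"
proof (induction k arbitrary: f g)
  case 0
  then show ?case
    by (auto intro: continuous_map_add)
next
  case (Suc k)
  show ?case
  proof (rule Ck_on_SucI[OF W])
    show "continuous_on W (\<lambda>z. f z + g z)"
      using Suc.prems by (intro continuous_intros Ck_on_continuous[OF W])
    show "((\<lambda>s. f (z(i := s)) + g (z(i := s))) has_field_derivative
        partial_deriv i f z + partial_deriv i g z) (at (z i))" if "i < n" "z \<in> W" for i z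
      using Suc.prems that by (intro derivative_intros Ck_on_Suc_derivative)
    show "Ck_on k n W (\<lambda>z. partial_deriv i f z + partial_deriv i g z)" if "i < n" for i
      using Suc.prems that by (intro Suc.IH Ck_on_Suc_partial)
  qed
qed

lemma Ck_on_mult:
  assumes W: "openin (Euclidean_space n) W"
  shows "Ck_on k n W f \<Longrightarrow> Ck_on k n W g \<Longrightarrow> Ck_on k n W (\<lambda>z. f z * g z)"
proof (induction k arbitrary: f g)
  case 0
  then show ?case
    by (auto intro: continuous_map_real_mult)
next
  case (Suc k)
  show ?case
  proof (rule Ck_on_SucI[OF W])
    show "continuous_on W (\<lambda>z. f z * g z)"
      using Suc.prems by (intro continuous_intros Ck_on_continuous[OF W])
    show "((\<lambda>s. f (z(i := s)) * g (z(i := s))) has_field_derivative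
        partial_deriv i f z * g z + partial_deriv i g z * f z) (at (z i))" if "i < n" "z \<in> W" for i z
      using DERIV_mult[OF Ck_on_Suc_derivative[OF Suc.prems(1) that] Ck_on_Suc_derivative[OF Suc.prems(2) that]]
      by (simp only: fun_upd_triv)
    show "Ck_on k n W (\<lambda>z. partial_deriv i f z * g z + partial_deriv i g z * f z)" if "i < n" for i
      by (intro Ck_on_add[OF W]
          Suc.IH[OF Ck_on_Suc_partial[OF Suc.prems(1) that] Ck_on_SucD[OF Suc.prems(2)]]
          Suc.IH[OF Ck_on_Suc_partial[OF Suc.prems(2) that] Ck_on_SucD[OF Suc.prems(1)]])
  qed
qed

lemma Ck_on_sum:
  assumes W: "openin (Euclidean_space n) W"
    and "\<And>j. j \<in> J \<Longrightarrow> Ck_on k n W (f j)"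
  shows "Ck_on k n W (\<lambda>z. \<Sum>j\<in>J. f j z)"
  using assms(2)
proof (induction J rule: infinite_finite_induct)
  case (insert j J)
  then show ?case
    using Ck_on_add[OF W, of k "f j" "\<lambda>z. \<Sum>j\<in>J. f j z"] by simp
qed (simp_all add: Ck_on_const[OF W])

text \<open>The partial derivatives of \<open>h \<circ> u\<close> are sums of products of a partial
  derivative of \<open>h\<close> taken at \<open>u\<close> and one of \<open>u\<close>. The first
  factor is again a composite, with \<open>h\<close> replaced by its derivative, so the induction on
  \<open>k\<close> runs over all \<open>h\<close>.\<close>

lemma Ck_on_compose:
  assumes W: "openin (Euclidean_space n) W" and D: "openin (Euclidean_space m) D"
    and uD: "\<And>z. z \<in> W \<Longrightarrow> u z \<in> D"
  shows "Ck_on k m D h \<Longrightarrow> (\<And>j. j < m \<Longrightarrow> Ck_on k n W (\<lambda>z. u z j)) \<Longrightarrow> Ck_on k n W (\<lambda>z. h (u z))"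
proof (induction k arbitrary: h)
  case k: (0 h)
  have "continuous_on W u"
  proof (rule continuous_on_coordinatewise_then_product)
    fix i
    show "continuous_on W (\<lambda>z. u z i)"
    proof (cases "i < m")
      case True
      then show ?thesis
        using Ck_on_continuous[OF W k(2)] by blast
    next
      \<comment> \<open>The coordinates from \<open>m\<close> on are constantly 0, since
        \<open>D\<close> lies in \<open>Rset m\<close>.\<close>
      case False
      then have "u z i = 0" if "z \<in> W" for z
        using uD[OF that] openin_Euclidean_subset[OF D] by (auto simp: Rset_iff subset_iff)
      then show ?thesis
        by (simp cong: continuous_on_cong)
    qed
  qed
  then have "continuous_on W (\<lambda>z. h (u z))"
    using continuous_on_compose2[OF Ck_on_continuous[OF D k(1)]] uD by blast
  then show ?case
    using openin_Euclidean_subset[OF W] by (simp add: continuous_map_Euclidean_real)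
next
  case (Suc k)
  have sub: "\<And>z. z \<in> W \<Longrightarrow> u z \<in> Rset m"
    using uD openin_Euclidean_subset[OF D] by blast
  have pd: "\<And>j. j < m \<Longrightarrow> Ck_on k m D (partial_deriv j h)"
    using Suc.prems(1) by (rule Ck_on_Suc_partial)
  have uk: "\<And>j. j < m \<Longrightarrow> Ck_on k n W (\<lambda>z. u z j)"
    using Suc.prems(2) by (rule Ck_on_SucD)
  show ?case
  proof (rule Ck_on_SucI[OF W])
    show "continuous_on W (\<lambda>z. h (u z))"
      by (rule Ck_on_continuous[OF W Suc.IH[OF Ck_on_SucD[OF Suc.prems(1)] uk]])
    show "Ck_on k n W (\<lambda>z. \<Sum>j<m. partial_deriv j h (u z) * partial_deriv i (\<lambda>z. u z j) z)"
      if "i < n" for i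
    proof (rule Ck_on_sum[OF W], rule Ck_on_mult[OF W])
      fix j assume "j \<in> {..<m}"
      then have j: "j < m" by simp
      show "Ck_on k n W (\<lambda>z. partial_deriv j h (u z))"
        by (rule Suc.IH[OF pd[OF j] uk])
      show "Ck_on k n W (partial_deriv i (\<lambda>z. u z j))"
        by (rule Ck_on_Suc_partial[OF Suc.prems(2)[OF j] that])
    qed
    fix i z assume i: "i < n" and z: "z \<in> W"
    \<comment> \<open>The curve must take values in \<open>Rset m\<close> for every parameter, but
      nothing is known of \<open>u\<close> outside \<open>W\<close>. It is continued there by the
      constant \<open>u z\<close>, which changes nothing near \<open>z i\<close>.\<close>
    define c where "c s = (if z(i := s) \<in> W then u (z(i := s)) else u z)" for s
    have near: "eventually (\<lambda>s. u (z(i := s)) = c s) (nhds (z i))"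
      using eventually_upd_line[OF W z i] by (rule eventually_mono) (simp add: c_def)
    have cz: "c (z i) = u z"
      by (simp add: c_def)
    have "((\<lambda>s. h (c s)) has_field_derivative
        (\<Sum>j<m. partial_deriv j h (c (z i)) * partial_deriv i (\<lambda>z. u z j) z)) (at (z i))"
    proof (rule has_derivative_along_curve[OF D])
      show "(\<lambda>s. h (w(j := s))) field_differentiable at (w j)" if "j < m" "w \<in> D" for j w
        using Suc.prems(1) that by (simp del: fun_upd_apply)
      show "continuous_on D (partial_deriv j h)" if "j < m" for j
        by (rule Ck_on_continuous[OF D pd[OF that]])
      show "c (z i) \<in> D"
        unfolding cz by (rule uD[OF z])
      show "c s \<in> Rset m" for s
        using sub[of z] sub[of "z(i := s)"] z by (simp add: c_def)
      show "((\<lambda>s. c s j) has_field_derivative partial_deriv i (\<lambda>z. u z j) z) (at (z i))" if "j < m" for j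
      proof (rule DERIV_cong_ev[OF refl _ refl, THEN iffD1])
        show "((\<lambda>s. u (z(i := s)) j) has_field_derivative partial_deriv i (\<lambda>z. u z j) z) (at (z i))"
          using Ck_on_Suc_derivative[OF Suc.prems(2)[OF that] i z] .
        show "\<forall>\<^sub>F s in nhds (z i). u (z(i := s)) j = c s j"
          using near by (rule eventually_mono) simp
      qed
    qed
    moreover have "\<forall>\<^sub>F s in nhds (z i). h (c s) = h (u (z(i := s)))"
      using near by (rule eventually_mono) simp
    ultimately show "((\<lambda>s. h (u (z(i := s)))) has_field_derivative
        (\<Sum>j<m. partial_deriv j h (u z) * partial_deriv i (\<lambda>z. u z j) z)) (at (z i))"
      unfolding cz by (rule DERIV_cong_ev[OF refl _ refl, THEN iffD1, rotated])
  qed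
qed

section \<open>Germs of smooth functions\<close>

text \<open>The half of \<open>is_chart\<close> that says that the inverse of the chart is
  continuous on an open image. It can be checked directly for product charts, slice charts and the
  chart of the real line, and it turns neighbourhoods of points into neighbourhoods of
  coordinates.\<close>

fun open_chart :: "'a topology \<Rightarrow> 'a chart \<Rightarrow> bool" where
  "open_chart T (n, U, x) \<longleftrightarrow>
     openin T U \<and> inj_on x U \<and> (\<forall>Q. openin T Q \<longrightarrow> Q \<subseteq> U \<longrightarrow> openin (Euclidean_space n) (x ` Q))"

text \<open>The condition imposed on targets of smooth maps; it lets \<open>real_line\<close> serve
  as a target next to the manifolds.\<close>

definition smooth_atlas :: "'a mfld \<Rightarrow> bool" where
  "smooth_atlas X \<longleftrightarrow>
     (\<forall>c\<in>atlas X. open_chart (mtop X) c) \<and> (\<forall>c\<in>atlas X. \<forall>d\<in>atlas X. compatible c d)"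

text \<open>Smoothness on some neighbourhood of \<open>p\<close>, the same for all orders
  \<open>k\<close>. One chart is enough as a witness, since \<open>smooth_at_in_chart\<close> moves
  it to any other chart.\<close>

definition smooth_at :: "'a mfld \<Rightarrow> ('a \<Rightarrow> real) \<Rightarrow> 'a \<Rightarrow> bool" where
  "smooth_at X f p \<longleftrightarrow>
     (\<exists>n U x W. (n, U, x) \<in> atlas X \<and> p \<in> U \<and> openin (Euclidean_space n) W \<and> x p \<in> W \<and> W \<subseteq> x ` U \<and>
        (\<forall>k. Ck_on k n W (f \<circ> inv_into U x)))"

lemma compatible_sym: "compatible c d \<Longrightarrow> compatible d c"
  by (cases c; cases d) (auto simp: Int_commute)

lemma open_chartD:
  assumes "open_chart T (n, U, x)"
  shows "openin T U" "inj_on x U" "\<And>Q. openin T Q \<Longrightarrow> Q \<subseteq> U \<Longrightarrow> openin (Euclidean_space n) (x ` Q)"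
  using assms by auto

lemma open_chart_in_Rset: "open_chart T (n, U, x) \<Longrightarrow> p \<in> U \<Longrightarrow> x p \<in> Rset n"
  using openin_Euclidean_subset[of n "x ` U"] by auto

lemma is_chart_open_chart:
  assumes "is_chart T c"
  shows "open_chart T c"
proof -
  obtain n U x where c: "c = (n, U, x)"
    by (cases c)
  have U: "openin T U" and xU: "openin (Euclidean_space n) (x ` U)"
    and h: "homeomorphic_map (subtopology T U) (subtopology (Euclidean_space n) (x ` U)) x"
    using assms c by auto
  have "openin (Euclidean_space n) (x ` Q)" if "openin T Q" "Q \<subseteq> U" for Q
  proof -
    have "openin (subtopology T U) Q"
      using that by (simp add: openin_subset_topspace_eq openin_open_subtopology U)
    then have "openin (subtopology (Euclidean_space n) (x ` U)) (x ` Q)"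
      using homeomorphic_imp_open_map[OF h] by (auto simp: open_map_def)
    then show ?thesis
      using xU by (simp add: openin_open_subtopology)
  qed
  moreover have "inj_on x U"
    using homeomorphic_imp_injective_map[OF h] openin_subset[OF U] by (simp add: Int_absorb1)
  ultimately show ?thesis
    using U c by simp
qed

lemma is_chart_preimage:
  assumes "is_chart T (n, U, x)" "openin (Euclidean_space n) W"
  shows "openin T (U \<inter> x -` W)"
proof -
  have U: "openin T U"
    and "continuous_map (subtopology T U) (subtopology (Euclidean_space n) (x ` U)) x"
    using assms(1) by (auto intro: homeomorphic_imp_continuous_map)
  then have "continuous_map (subtopology T U) (Euclidean_space n) x"
    using continuous_map_into_fulltopology by blast
  then have "openin (subtopology T U) {q \<in> topspace (subtopology T U). x q \<in> W}"
    using assms(2) by (rule openin_continuous_map_preimage)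
  moreover have "{q \<in> topspace (subtopology T U). x q \<in> W} = U \<inter> x -` W"
    using openin_subset[OF U] by auto
  ultimately show ?thesis
    using U by (simp add: openin_open_subtopology)
qed

lemma smooth_atlas_open: "smooth_atlas Y \<Longrightarrow> c \<in> atlas Y \<Longrightarrow> openin (mtop Y) (fst (snd c))"
  by (cases c) (auto simp: smooth_atlas_def)

lemma manifold_smooth_atlas: "manifold X \<Longrightarrow> smooth_atlas X"
  by (auto simp: manifold_def smooth_atlas_def intro!: is_chart_open_chart)

lemma manifold_chart:
  assumes "manifold X" "p \<in> pts X"
  obtains n U x where "(n, U, x) \<in> atlas X" "p \<in> U"
proof -
  have "p \<in> (\<Union>(n, U, x)\<in>atlas X. U)"
    using assms by (simp add: manifold_def)
  then show ?thesis
    using that by auto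
qed

lemma manifold_is_chart: "manifold X \<Longrightarrow> c \<in> atlas X \<Longrightarrow> is_chart (mtop X) c"
  by (auto simp: manifold_def)

lemma manifold_open_chart: "manifold X \<Longrightarrow> c \<in> atlas X \<Longrightarrow> open_chart (mtop X) c"
  by (auto simp: manifold_def intro!: is_chart_open_chart)

lemma manifold_compatible: "manifold X \<Longrightarrow> c \<in> atlas X \<Longrightarrow> d \<in> atlas X \<Longrightarrow> compatible c d"
  by (auto simp: manifold_def)

lemma manifold_max_atlas: "manifold X \<Longrightarrow> c \<in> atlas X \<Longrightarrow> c \<in> max_atlas X"
  by (auto simp: max_atlas_def manifold_is_chart manifold_compatible)

lemma max_atlasD:
  assumes "c \<in> max_atlas X"
  shows "is_chart (mtop X) c" "open_chart (mtop X) c" "\<And>d. d \<in> atlas X \<Longrightarrow> compatible c d"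
  using assms by (auto simp: max_atlas_def intro: is_chart_open_chart)

text \<open>In the new chart the function is its old coordinate expression after the transition map,
  so the chain rule applies. The domain is the part of the overlap that \<open>y\<close> sends into
  the old neighbourhood.\<close>

lemma smooth_at_in_chart:
  assumes X: "manifold X" and c: "(n, U, x) \<in> atlas X" "p \<in> U" and f: "smooth_at X f p"
  shows "\<exists>W. openin (Euclidean_space n) W \<and> x p \<in> W \<and> W \<subseteq> x ` U \<and>
    (\<forall>k. Ck_on k n W (f \<circ> inv_into U x))"
proof -
  obtain m V y W' where d: "(m, V, y) \<in> atlas X" "p \<in> V" "openin (Euclidean_space m) W'" "y p \<in> W'"
    "W' \<subseteq> y ` V" and Ck: "\<And>k. Ck_on k m W' (f \<circ> inv_into V y)"
    using f by (auto simp: smooth_at_def)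
  note cx = manifold_open_chart[OF X c(1)] and cy = manifold_open_chart[OF X d(1)]
  note x = open_chartD[OF cx] and y = open_chartD[OF cy]
  have "openin (mtop X) (U \<inter> (V \<inter> y -` W'))"
    using is_chart_preimage[OF manifold_is_chart[OF X d(1)] d(3)] x(1) by blast
  then have W: "openin (Euclidean_space n) (x ` (U \<inter> (V \<inter> y -` W')))" (is "openin _ ?W")
    using x(3) by blast
  have sm: "smooth_on n m (x ` (U \<inter> V)) (y \<circ> inv_into U x)"
    using manifold_compatible[OF X c(1) d(1)] by simp
  have "Ck_on k n ?W (\<lambda>z. (f \<circ> inv_into V y) ((y \<circ> inv_into U x) z))" for k
  proof (rule Ck_on_compose[OF W d(3) _ Ck])
    show "(y \<circ> inv_into U x) z \<in> W'" if "z \<in> ?W" for z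
      using that x(2) by auto
    show "Ck_on k n ?W (\<lambda>z. (y \<circ> inv_into U x) z j)" if "j < m" for j
      using sm that by (intro Ck_on_subset[of ?W "x ` (U \<inter> V)"]) (auto simp: smooth_on_def)
  qed
  then have "Ck_on k n ?W (f \<circ> inv_into U x)" for k
    by (rule Ck_on_cong[OF W, rotated]) (use x(2) y(2) in auto)
  moreover have "x p \<in> ?W" "?W \<subseteq> x ` U"
    using c d by auto
  ultimately show ?thesis
    using W by blast
qed

text \<open>Prepares maps with several components for the chain rule: the finitely many
  neighbourhoods are intersected, and shrunk into the given \<open>Q\<close>.\<close>

lemma smooth_at_common_chart:
  assumes X: "manifold X" and c: "(n, U, x) \<in> atlas X" "p \<in> U"
    and "finite J" "\<And>j. j \<in> J \<Longrightarrow> smooth_at X (f j) p" and Q: "openin (mtop X) Q" "p \<in> Q"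
  shows "\<exists>W. openin (Euclidean_space n) W \<and> x p \<in> W \<and> W \<subseteq> x ` (U \<inter> Q) \<and>
    (\<forall>j\<in>J. \<forall>k. Ck_on k n W (f j \<circ> inv_into U x))"
  using assms(4,5)
proof (induction J rule: finite_induct)
  case empty
  have "openin (Euclidean_space n) (x ` (U \<inter> Q))"
    using open_chartD[OF manifold_open_chart[OF X c(1)]] Q by auto
  then show ?case
    using c(2) Q(2) by blast
next
  case (insert j J)
  have "\<exists>W. openin (Euclidean_space n) W \<and> x p \<in> W \<and> W \<subseteq> x ` (U \<inter> Q) \<and>
    (\<forall>j\<in>J. \<forall>k. Ck_on k n W (f j \<circ> inv_into U x))"
    using insert.prems by (intro insert.IH) simp
  then obtain W where W: "openin (Euclidean_space n) W" "x p \<in> W" "W \<subseteq> x ` (U \<inter> Q)"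
    "\<And>j k. j \<in> J \<Longrightarrow> Ck_on k n W (f j \<circ> inv_into U x)"
    by blast
  obtain W' where W': "openin (Euclidean_space n) W'" "x p \<in> W'"
    "\<And>k. Ck_on k n W' (f j \<circ> inv_into U x)"
    using smooth_at_in_chart[OF X c insert.prems[OF insertI1]] by blast
  have "openin (Euclidean_space n) (W \<inter> W')" "x p \<in> W \<inter> W'" "W \<inter> W' \<subseteq> x ` (U \<inter> Q)"
    using W W' by auto
  moreover have "Ck_on k n (W \<inter> W') (f i \<circ> inv_into U x)" if "i \<in> insert j J" for i k
    using that W(4)[of i k] W'(3)[of k] by (auto intro: Ck_on_subset[of "W \<inter> W'"])
  ultimately show ?case
    by blast
qed

section \<open>Composition and algebra of smooth germs\<close>

lemma smooth_at_in_pts: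
  assumes "manifold X" "smooth_at X f p"
  shows "p \<in> pts X"
proof -
  obtain n U x where "(n, U, x) \<in> atlas X" "p \<in> U"
    using assms(2) by (auto simp: smooth_at_def)
  then show ?thesis
    using open_chartD(1)[OF manifold_open_chart[OF assms(1)]] openin_subset by blast
qed

text \<open>The source of the closure properties of germs: \<open>g\<close> is written near
  \<open>p\<close> as a smooth function \<open>h\<close> of finitely many smooth germs.\<close>

lemma smooth_at_compose:
  assumes X: "manifold X" and D: "openin (Euclidean_space m) D"
    and Q: "openin (mtop X) Q" "p \<in> Q" "\<And>q. q \<in> Q \<Longrightarrow> u q \<in> D"
    and u: "\<And>j. j < m \<Longrightarrow> smooth_at X (\<lambda>q. u q j) p"
    and h: "\<And>k. Ck_on k m D h" and gh: "\<And>q. q \<in> Q \<Longrightarrow> g q = h (u q)"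
  shows "smooth_at X g p"
proof -
  have "p \<in> pts X"
    using Q openin_subset by blast
  then obtain n U x where c: "(n, U, x) \<in> atlas X" "p \<in> U"
    using manifold_chart[OF X] by blast
  obtain W where W: "openin (Euclidean_space n) W" "x p \<in> W" "W \<subseteq> x ` (U \<inter> Q)"
    "\<And>j k. j < m \<Longrightarrow> Ck_on k n W ((\<lambda>q. u q j) \<circ> inv_into U x)"
    using smooth_at_common_chart[OF X c, of "{..<m}" "\<lambda>j q. u q j" Q] u Q by auto
  have inj: "inj_on x U"
    by (rule open_chartD(2)[OF manifold_open_chart[OF X c(1)]])
  have inO: "inv_into U x z \<in> Q" if "z \<in> W" for z
    using that W(3) inj by auto
  have "Ck_on k n W (\<lambda>z. h ((u \<circ> inv_into U x) z))" for k
    by (rule Ck_on_compose[OF W(1) D _ h]) (use inO Q(3) W(4) in \<open>auto simp: comp_def\<close>)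
  then have "Ck_on k n W (g \<circ> inv_into U x)" for k
    by (rule Ck_on_cong[OF W(1), rotated]) (use inO gh in auto)
  then show ?thesis
    unfolding smooth_at_def using c W(1-3) by blast
qed

text \<open>\<open>g\<close> is near \<open>p\<close> the coordinate \<open>z 0\<close> of the
  one-component map given by \<open>f\<close>, so this is a trivial composition.\<close>

lemma smooth_at_cong:
  assumes X: "manifold X" and f: "smooth_at X f p"
    and Q: "openin (mtop X) Q" "p \<in> Q" "\<And>q. q \<in> Q \<Longrightarrow> f q = g q"
  shows "smooth_at X g p"
proof (rule smooth_at_compose[OF X, of 1 "Rset 1" Q p "\<lambda>q i. if i = 0 then f q else 0" "\<lambda>z. z 0"])
  show "openin (Euclidean_space 1) (Rset 1)"
    by simp
  then show "Ck_on k 1 (Rset 1) (\<lambda>z. z 0)" for k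
    by (rule Ck_on_coordinate)
qed (use assms in \<open>auto simp: Rset_iff\<close>)

text \<open>Stated for \<open>max_atlas\<close> because slice charts are restrictions of such
  charts. Read in a chart of the atlas, the coordinate is a component of the transition map, and
  this is smooth by compatibility.\<close>

lemma smooth_at_chart_coordinate:
  assumes X: "manifold X" and c: "(n, U, x) \<in> max_atlas X" "p \<in> U" and j: "j < n"
  shows "smooth_at X (\<lambda>q. x q j) p"
proof -
  have "p \<in> pts X"
    using max_atlasD(2)[OF c(1)] c(2) openin_subset by fastforce
  then obtain m V y where d: "(m, V, y) \<in> atlas X" "p \<in> V"
    using manifold_chart[OF X] by blast
  have "openin (mtop X) (V \<inter> U)"
    using open_chartD(1)[OF max_atlasD(2)[OF c(1)]] open_chartD(1)[OF manifold_open_chart[OF X d(1)]] by blast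
  then have "openin (Euclidean_space m) (y ` (V \<inter> U))"
    using open_chartD(3)[OF manifold_open_chart[OF X d(1)]] by blast
  moreover have "Ck_on k m (y ` (V \<inter> U)) ((\<lambda>q. x q j) \<circ> inv_into V y)" for k
    using max_atlasD(3)[OF c(1) d(1)] j by (simp add: smooth_on_def comp_def Int_commute)
  ultimately show ?thesis
    unfolding smooth_at_def using c(2) d by (metis IntI image_eqI image_mono inf.cobounded1)
qed

text \<open>A constant factors through \<open>Rset 0\<close>, which leaves no coordinates to
  check.\<close>

lemma smooth_at_const:
  assumes X: "manifold X" and "p \<in> pts X"
  shows "smooth_at X (\<lambda>q. c) p"
  by (rule smooth_at_compose[OF X, of 0 "Rset 0" "pts X" p "\<lambda>q i. 0" "\<lambda>z. c"])
    (use assms in \<open>auto simp: Rset_iff intro!: Ck_on_const\<close>)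

lemma smooth_at_binop:
  assumes X: "manifold X" and "smooth_at X f p" "smooth_at X g p"
    and h: "\<And>k. Ck_on k 2 (Rset 2) (\<lambda>z. h (z 0) (z 1))"
  shows "smooth_at X (\<lambda>q. h (f q) (g q)) p"
  by (rule smooth_at_compose[OF X, of 2 "Rset 2" "pts X" p
        "\<lambda>q i. if i = 0 then f q else if i = 1 then g q else 0" "\<lambda>z. h (z 0) (z 1)"])
    (use assms smooth_at_in_pts[OF X assms(2)] in \<open>auto simp: Rset_iff less_Suc_eq numeral_2_eq_2\<close>)

lemma smooth_at_add:
  "manifold X \<Longrightarrow> smooth_at X f p \<Longrightarrow> smooth_at X g p \<Longrightarrow> smooth_at X (\<lambda>q. f q + g q) p"
  by (rule smooth_at_binop[where h = "(+)"]) (auto intro!: Ck_on_add Ck_on_coordinate)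

lemma smooth_at_mult:
  "manifold X \<Longrightarrow> smooth_at X f p \<Longrightarrow> smooth_at X g p \<Longrightarrow> smooth_at X (\<lambda>q. f q * g q) p"
  by (rule smooth_at_binop[where h = "(*)"]) (auto intro!: Ck_on_mult Ck_on_coordinate)

lemma smooth_at_sum:
  assumes X: "manifold X" and "p \<in> pts X" and "\<And>j. j \<in> J \<Longrightarrow> smooth_at X (f j) p"
  shows "smooth_at X (\<lambda>q. \<Sum>j\<in>J. f j q) p"
  using assms(3)
  by (induction J rule: infinite_finite_induct)
    (auto intro!: smooth_at_add[OF X] smooth_at_const[OF X] assms(2))

lemma smooth_at_continuous:
  assumes X: "manifold X" and f: "smooth_at X f p"
  shows "\<exists>Q. openin (mtop X) Q \<and> p \<in> Q \<and> continuous_map (subtopology (mtop X) Q) euclideanreal f"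
proof -
  obtain n U x W where c: "(n, U, x) \<in> atlas X" "p \<in> U" "openin (Euclidean_space n) W" "x p \<in> W"
    "W \<subseteq> x ` U" "Ck_on 0 n W (f \<circ> inv_into U x)"
    using f unfolding smooth_at_def by blast
  note ch = manifold_is_chart[OF X c(1)]
  define Q where "Q = U \<inter> x -` W"
  have Q: "openin (mtop X) Q"
    using is_chart_preimage[OF ch c(3)] by (simp add: Q_def)
  have "continuous_map (subtopology (mtop X) U) (subtopology (Euclidean_space n) (x ` U)) x"
    using ch by (auto intro: homeomorphic_imp_continuous_map)
  then have "continuous_map (subtopology (mtop X) U) (Euclidean_space n) x"
    by (rule continuous_map_into_fulltopology)
  then have "continuous_map (subtopology (mtop X) Q) (Euclidean_space n) x"
    by (rule continuous_map_from_subtopology_mono) (simp add: Q_def)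
  then have "continuous_map (subtopology (mtop X) Q) (subtopology (Euclidean_space n) W) x"
    by (rule continuous_map_into_subtopology) (simp add: Q_def Pi_iff)
  then have "continuous_map (subtopology (mtop X) Q) euclideanreal ((f \<circ> inv_into U x) \<circ> x)"
    using c(6) by (intro continuous_map_compose[of _ "subtopology (Euclidean_space n) W"]) simp_all
  then have "continuous_map (subtopology (mtop X) Q) euclideanreal f"
    by (rule continuous_map_eq)
      (use open_chartD(2)[OF is_chart_open_chart[OF ch]] in \<open>auto simp: Q_def\<close>)
  then show ?thesis
    using Q c by (auto simp: Q_def)
qed

section \<open>Smooth maps in terms of coordinate germs\<close>

lemma openin_preimage_subtopology:
  assumes "openin T Q" "continuous_map (subtopology T Q) T' f" "openin T' V"
  shows "openin T {q \<in> Q. f q \<in> V}"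
proof -
  have "openin (subtopology T Q) {q \<in> topspace (subtopology T Q). f q \<in> V}"
    using assms by (intro openin_continuous_map_preimage)
  moreover have "{q \<in> topspace (subtopology T Q). f q \<in> V} = {q \<in> Q. f q \<in> V}"
    using openin_subset[OF assms(1)] by auto
  ultimately show ?thesis
    using assms(1) by (simp add: openin_open_subtopology)
qed

text \<open>The target is a bare topology and compatibility is asked of the two charts involved
  only. This covers charts of the product of \<open>arrows G\<close> and \<open>F\<close> and charts
  from a maximal atlas.\<close>

lemma smooth_at_change_chart:
  assumes X: "manifold X" and Q: "openin (mtop X) Q" "p \<in> Q"
    and f: "continuous_map (subtopology (mtop X) Q) T f"
    and V: "open_chart T (m, V, y)" "f p \<in> V" and V': "openin T V'" "f p \<in> V'"
    and yy': "compatible (m, V, y) (m', V', y')"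
    and fy: "\<And>j. j < m \<Longrightarrow> smooth_at X (\<lambda>q. y (f q) j) p" and j: "j < m'"
  shows "smooth_at X (\<lambda>q. y' (f q) j) p"
proof (rule smooth_at_compose[OF X, of m "y ` (V \<inter> V')" "{q \<in> Q. f q \<in> V \<inter> V'}" p "\<lambda>q. y (f q)"
      "\<lambda>z. y' (inv_into V y z) j"])
  have VV': "openin T (V \<inter> V')"
    using V V' by auto
  show "openin (Euclidean_space m) (y ` (V \<inter> V'))"
    using open_chartD(3)[OF V(1) VV'] by blast
  show "openin (mtop X) {q \<in> Q. f q \<in> V \<inter> V'}"
    by (rule openin_preimage_subtopology[OF Q(1) f VV'])
  show "Ck_on k m (y ` (V \<inter> V')) (\<lambda>z. y' (inv_into V y z) j)" for k
    using yy' j by (auto simp: smooth_on_def)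
qed (use Q V V' fy open_chartD(2)[OF V(1)] in auto)

text \<open>By continuity of \<open>f\<close> the coordinate domain in \<open>smooth_map_def\<close>
  is open, so it can serve as the neighbourhood in \<open>smooth_at_def\<close>.\<close>

lemma smooth_map_coordinates_ex:
  assumes X: "manifold X" and f: "smooth_map X Y f" and p: "p \<in> pts X"
    and Y: "\<And>c. c \<in> atlas Y \<Longrightarrow> openin (mtop Y) (fst (snd c))"
  shows "\<exists>m V y. (m, V, y) \<in> atlas Y \<and> f p \<in> V \<and> (\<forall>j<m. smooth_at X (\<lambda>q. y (f q) j) p)"
proof -
  obtain n U x m V y where c: "(n, U, x) \<in> atlas X" "(m, V, y) \<in> atlas Y" "p \<in> U" "f p \<in> V"
    "smooth_on n m (x ` (U \<inter> f -` V)) (y \<circ> f \<circ> inv_into U x)"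
    using f p unfolding smooth_map_def by blast
  note ch = open_chartD[OF manifold_open_chart[OF X c(1)]]
  have "continuous_map (mtop X) (mtop Y) f"
    using f by (simp add: smooth_map_def)
  then have "openin (mtop X) {q \<in> U. f q \<in> V}"
    using ch(1) Y[OF c(2), simplified] by (intro openin_preimage_subtopology continuous_map_from_subtopology)
  then have "openin (Euclidean_space n) (x ` {q \<in> U. f q \<in> V})"
    using ch(3) by blast
  moreover have "{q \<in> U. f q \<in> V} = U \<inter> f -` V"
    by auto
  ultimately have "openin (Euclidean_space n) (x ` (U \<inter> f -` V))"
    by simp
  moreover have "Ck_on k n (x ` (U \<inter> f -` V)) ((\<lambda>q. y (f q) j) \<circ> inv_into U x)" if "j < m" for j k
    using c(5) that by (auto simp: smooth_on_def comp_def)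
  moreover have "x p \<in> x ` (U \<inter> f -` V)" "x ` (U \<inter> f -` V) \<subseteq> x ` U"
    using c by auto
  ultimately have "smooth_at X (\<lambda>q. y (f q) j) p" if "j < m" for j
    unfolding smooth_at_def using c(1,3) that by blast
  then show ?thesis
    using c by blast
qed

lemma smooth_map_coordinates:
  assumes X: "manifold X" and Y: "manifold Y" and f: "smooth_map X Y f" and p: "p \<in> pts X"
    and c: "(m, V, y) \<in> max_atlas Y" "f p \<in> V" and j: "j < m"
  shows "smooth_at X (\<lambda>q. y (f q) j) p"
proof -
  obtain m' V' y' where d: "(m', V', y') \<in> atlas Y" "f p \<in> V'" "\<And>j. j < m' \<Longrightarrow> smooth_at X (\<lambda>q. y' (f q) j) p"
    using smooth_map_coordinates_ex[OF X f p smooth_atlas_open[OF manifold_smooth_atlas[OF Y]]] by blast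
  show ?thesis
  proof (rule smooth_at_change_chart[OF X _ p _ _ d(2) _ c(2) _ d(3) j])
    show "continuous_map (subtopology (mtop X) (pts X)) (mtop Y) f"
      using f by (simp add: smooth_map_def)
  qed (use manifold_open_chart[OF Y d(1)] open_chartD(1)[OF max_atlasD(2)[OF c(1)]]
      compatible_sym[OF max_atlasD(3)[OF c(1) d(1)]] in auto)
qed

text \<open>The chart of \<open>Y\<close> in which \<open>g\<close> is smooth is dictated by
  \<open>g\<close>, and charts of \<open>Y\<close> are not assumed compatible. Hence
  \<open>f\<close> is required to have smooth coordinates in every chart of \<open>Y\<close> around
  \<open>f p\<close>, and the dictated one is among them. This is the composition rule for middle
  spaces that are not known to be manifolds.\<close>

lemma smooth_map_compose_germ:
  assumes X: "manifold X" and Q: "openin (mtop X) Q" "p \<in> Q"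
    and f: "continuous_map (subtopology (mtop X) Q) (mtop Y) f"
    and Y: "\<And>c. c \<in> atlas Y \<Longrightarrow> open_chart (mtop Y) c"
    and fy: "\<And>m V y j. (m, V, y) \<in> atlas Y \<Longrightarrow> f p \<in> V \<Longrightarrow> j < m \<Longrightarrow> smooth_at X (\<lambda>q. y (f q) j) p"
    and g: "smooth_map Y Z g" and Z: "\<And>c. c \<in> atlas Z \<Longrightarrow> openin (mtop Z) (fst (snd c))"
  shows "\<exists>m V y. (m, V, y) \<in> atlas Z \<and> g (f p) \<in> V \<and> (\<forall>j<m. smooth_at X (\<lambda>q. y (g (f q)) j) p)"
proof -
  have "f p \<in> pts Y"
    using f Q openin_subset[OF Q(1)] by (auto simp: continuous_map_def)
  then obtain n V y m W e where c: "(n, V, y) \<in> atlas Y" "(m, W, e) \<in> atlas Z" "f p \<in> V" "g (f p) \<in> W"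
    "smooth_on n m (y ` (V \<inter> g -` W)) (e \<circ> g \<circ> inv_into V y)"
    using g unfolding smooth_map_def by blast
  note ch = open_chartD[OF Y[OF c(1)]]
  have "continuous_map (mtop Y) (mtop Z) g"
    using g by (simp add: smooth_map_def)
  then have "openin (mtop Y) {q \<in> V. g q \<in> W}"
    using ch(1) Z[OF c(2), simplified] by (intro openin_preimage_subtopology continuous_map_from_subtopology)
  moreover have eq: "{q \<in> V. g q \<in> W} = V \<inter> g -` W"
    by auto
  ultimately have op: "openin (mtop Y) (V \<inter> g -` W)"
    by simp
  have "smooth_at X (\<lambda>q. e (g (f q)) j) p" if "j < m" for j
  proof (rule smooth_at_compose[OF X, of n "y ` (V \<inter> g -` W)" "{q \<in> Q. f q \<in> V \<inter> g -` W}" p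
        "\<lambda>q. y (f q)" "\<lambda>z. e (g (inv_into V y z)) j"])
    show "openin (Euclidean_space n) (y ` (V \<inter> g -` W))"
      using ch(3)[OF op] by blast
    show "openin (mtop X) {q \<in> Q. f q \<in> V \<inter> g -` W}"
      by (rule openin_preimage_subtopology[OF Q(1) f op])
    show "Ck_on k n (y ` (V \<inter> g -` W)) (\<lambda>z. e (g (inv_into V y z)) j)" for k
      using c(5) that by (auto simp: smooth_on_def)
  qed (use Q c fy ch(2) in auto)
  then show ?thesis
    using c by blast
qed

text \<open>\<open>smooth_map\<close> demands smoothness on the whole overlap domain of one pair of
  charts, while germs are given point by point, each in its own chart of \<open>Y\<close>. Every
  germ is moved to the fixed chart, and \<open>Ck_on_local\<close> glues the results.\<close>

lemma smooth_mapI: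
  assumes X: "manifold X" and Y: "smooth_atlas Y" and f: "continuous_map (mtop X) (mtop Y) f"
    and fy: "\<And>p. p \<in> pts X \<Longrightarrow>
      \<exists>m V y. (m, V, y) \<in> atlas Y \<and> f p \<in> V \<and> (\<forall>j<m. smooth_at X (\<lambda>q. y (f q) j) p)"
  shows "smooth_map X Y f"
  unfolding smooth_map_def
proof (intro conjI f ballI)
  have f': "continuous_map (subtopology (mtop X) (pts X)) (mtop Y) f"
    using f by simp
  fix p assume p: "p \<in> pts X"
  obtain n U x where c: "(n, U, x) \<in> atlas X" "p \<in> U"
    using manifold_chart[OF X p] by blast
  obtain m V y where d: "(m, V, y) \<in> atlas Y" "f p \<in> V"
    using fy[OF p] by blast
  note cU = open_chartD[OF manifold_open_chart[OF X c(1)]]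
  have cV: "open_chart (mtop Y) (m, V, y)"
    using d Y by (auto simp: smooth_atlas_def)
  have Usub: "U \<subseteq> pts X"
    using cU(1) openin_subset by blast
  have "openin (mtop X) {q \<in> U. f q \<in> V}"
    using cU(1) open_chartD(1)[OF cV] f by (intro openin_preimage_subtopology continuous_map_from_subtopology)
  moreover have "{q \<in> U. f q \<in> V} = U \<inter> f -` V"
    by auto
  ultimately have W: "openin (Euclidean_space n) (x ` (U \<inter> f -` V))"
    using cU(3) by (metis inf.cobounded1)
  have "smooth_on n m (x ` (U \<inter> f -` V)) (y \<circ> f \<circ> inv_into U x)"
    unfolding smooth_on_def
  proof (intro conjI allI impI)
    show "(y \<circ> f \<circ> inv_into U x) ` (x ` (U \<inter> f -` V)) \<subseteq> Rset m"
      using open_chart_in_Rset[OF cV] cU(2) by auto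
    fix j k assume j: "j < m"
    show "Ck_on k n (x ` (U \<inter> f -` V)) (\<lambda>z. (y \<circ> f \<circ> inv_into U x) z j)"
    proof (rule Ck_on_local[OF W])
      fix z assume "z \<in> x ` (U \<inter> f -` V)"
      then obtain q where q: "z = x q" "q \<in> U" "f q \<in> V"
        by auto
      then obtain m' V' y' where d': "(m', V', y') \<in> atlas Y" "f q \<in> V'"
        "\<And>j. j < m' \<Longrightarrow> smooth_at X (\<lambda>q. y' (f q) j) q"
        using fy[of q] Usub by blast
      have "smooth_at X (\<lambda>q. y (f q) j) q"
      proof (rule smooth_at_change_chart[OF X _ _ f' _ d'(2) _ q(3) _ d'(3) j])
        show "open_chart (mtop Y) (m', V', y')" "compatible (m', V', y') (m, V, y)"
          using d d' Y by (auto simp: smooth_atlas_def simp del: compatible.simps)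
      qed (use q(2) Usub open_chartD(1)[OF cV] in auto)
      from smooth_at_in_chart[OF X c(1) q(2) this]
      show "\<exists>W'. openin (Euclidean_space n) W' \<and> z \<in> W' \<and> Ck_on k n W' (\<lambda>z. (y \<circ> f \<circ> inv_into U x) z j)"
        using q(1) by (auto simp: comp_def)
    qed
  qed
  then show "\<exists>n U x m V y. (n, U, x) \<in> atlas X \<and> (m, V, y) \<in> atlas Y \<and> p \<in> U \<and> f p \<in> V \<and>
      smooth_on n m (x ` (U \<inter> f -` V)) (y \<circ> f \<circ> inv_into U x)"
    using c d by blast
qed

lemma smooth_map_continuous: "smooth_map X Y f \<Longrightarrow> continuous_map (mtop X) (mtop Y) f"
  by (simp add: smooth_map_def)

lemma smooth_map_in_pts: "smooth_map X Y f \<Longrightarrow> p \<in> pts X \<Longrightarrow> f p \<in> pts Y"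
  by (auto simp: smooth_map_def continuous_map_def)

lemma smooth_map_compose:
  assumes X: "manifold X" and Y: "manifold Y" and Z: "smooth_atlas Z"
    and f: "smooth_map X Y f" and g: "smooth_map Y Z g"
  shows "smooth_map X Z (\<lambda>p. g (f p))"
proof (rule smooth_mapI[OF X Z])
  show "continuous_map (mtop X) (mtop Z) (\<lambda>p. g (f p))"
    using continuous_map_compose[OF smooth_map_continuous[OF f] smooth_map_continuous[OF g]]
    by (simp add: comp_def)
  fix p assume p: "p \<in> pts X"
  show "\<exists>m V y. (m, V, y) \<in> atlas Z \<and> g (f p) \<in> V \<and> (\<forall>j<m. smooth_at X (\<lambda>q. y (g (f q)) j) p)"
  proof (rule smooth_map_compose_germ[OF X _ p _ manifold_open_chart[OF Y] _ g smooth_atlas_open[OF Z]])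
    show "continuous_map (subtopology (mtop X) (pts X)) (mtop Y) f"
      using smooth_map_continuous[OF f] by simp
    show "smooth_at X (\<lambda>q. y (f q) j) p" if "(m, V, y) \<in> atlas Y" "f p \<in> V" "j < m" for m V y j
      by (rule smooth_map_coordinates[OF X Y f p manifold_max_atlas[OF Y that(1)] that(2,3)])
  qed auto
qed

lemma smooth_map_cong:
  assumes X: "manifold X" and Y: "smooth_atlas Y" and f: "smooth_map X Y f"
    and eq: "\<And>p. p \<in> pts X \<Longrightarrow> f p = g p"
  shows "smooth_map X Y g"
proof (rule smooth_mapI[OF X Y])
  show "continuous_map (mtop X) (mtop Y) g"
    using smooth_map_continuous[OF f] eq by (rule continuous_map_eq)
  fix p assume p: "p \<in> pts X"
  obtain m V y where c: "(m, V, y) \<in> atlas Y" "f p \<in> V" "\<And>j. j < m \<Longrightarrow> smooth_at X (\<lambda>q. y (f q) j) p"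
    using smooth_map_coordinates_ex[OF X f p smooth_atlas_open[OF Y]] by blast
  have "smooth_at X (\<lambda>q. y (g q) j) p" if "j < m" for j
    by (rule smooth_at_cong[OF X c(3)[OF that] _ p]) (use eq in auto)
  then show "\<exists>m V y. (m, V, y) \<in> atlas Y \<and> g p \<in> V \<and> (\<forall>j<m. smooth_at X (\<lambda>q. y (g q) j) p)"
    using c(1,2) eq[OF p] by auto
qed

text \<open>Used to move components in a trivialization and matrix entries from the space where they
  are defined to the source of a map.\<close>

lemma smooth_at_pullback:
  assumes X: "manifold X" and Y: "manifold Y" and f: "smooth_map X Y f" and p: "p \<in> pts X"
    and a: "smooth_at Y a (f p)"
  shows "smooth_at X (\<lambda>q. a (f q)) p"
proof -
  obtain n U x W where c: "(n, U, x) \<in> atlas Y" "f p \<in> U" "openin (Euclidean_space n) W" "x (f p) \<in> W"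
    "W \<subseteq> x ` U" "\<And>k. Ck_on k n W (a \<circ> inv_into U x)"
    using a unfolding smooth_at_def by blast
  have Q: "openin (mtop Y) (U \<inter> x -` W)"
    by (rule is_chart_preimage[OF manifold_is_chart[OF Y c(1)] c(3)])
  show ?thesis
  proof (rule smooth_at_compose[OF X c(3), of "{q \<in> pts X. f q \<in> U \<inter> x -` W}" p "\<lambda>q. x (f q)" "a \<circ> inv_into U x"])
    show "openin (mtop X) {q \<in> pts X. f q \<in> U \<inter> x -` W}"
      by (rule openin_continuous_map_preimage[OF smooth_map_continuous[OF f] Q])
    show "smooth_at X (\<lambda>q. x (f q) j) p" if "j < n" for j
      by (rule smooth_map_coordinates[OF X Y f p manifold_max_atlas[OF Y c(1)] c(2) that])
  qed (use p c open_chartD(2)[OF manifold_open_chart[OF Y c(1)]] in auto)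
qed

section \<open>Products, submanifolds and the real line\<close>

lemma cat_less: "i < n \<Longrightarrow> cat n u v i = u i"
  and cat_plus: "cat n u v (n + i) = v i"
  by (auto simp: cat_def)

lemma openin_cat:
  assumes A: "openin (Euclidean_space n) A" and B: "openin (Euclidean_space m) B"
  shows "openin (Euclidean_space (n + m)) {cat n u v | u v. u \<in> A \<and> v \<in> B}"
  unfolding openin_Euclidean_box
proof (intro conjI ballI)
  note sub = openin_Euclidean_subset[OF A] openin_Euclidean_subset[OF B]
  show "{cat n u v | u v. u \<in> A \<and> v \<in> B} \<subseteq> Rset (n + m)"
    using sub by (auto simp: Rset_iff cat_def subset_iff)
  fix z assume "z \<in> {cat n u v | u v. u \<in> A \<and> v \<in> B}"
  then obtain u v where z: "z = cat n u v" "u \<in> A" "v \<in> B"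
    by auto
  obtain d e where d: "d > 0" "ebox n u d \<subseteq> A" and e: "e > 0" "ebox m v e \<subseteq> B"
    using A B z by (metis openin_Euclidean_box)
  have "ebox (n + m) z (min d e) \<subseteq> {cat n u v | u v. u \<in> A \<and> v \<in> B}"
  proof
    fix w assume w: "w \<in> ebox (n + m) z (min d e)"
    \<comment> \<open>Cutting \<open>w\<close> off at \<open>n\<close> puts \<open>?u\<close> into
      \<open>Rset n\<close>; \<open>cat\<close> never reads its first argument from \<open>n\<close>
      on.\<close>
    let ?u = "\<lambda>i. if i < n then w i else 0" and ?v = "\<lambda>i. w (n + i)"
    have "w = cat n ?u ?v"
      by (auto simp: cat_def fun_eq_iff)
    moreover have near: "\<bar>w i - z i\<bar> < d" "\<bar>w i - z i\<bar> < e" if "i < n + m" for i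
      using w that by (auto simp: ebox_def)
    have "\<bar>w i - u i\<bar> < d" if "i < n" for i
      using near(1)[of i] that by (simp add: z(1) cat_less)
    then have "?u \<in> ebox n u d"
      by (simp add: ebox_def Rset_iff)
    moreover have "\<bar>w (n + i) - v i\<bar> < e" if "i < m" for i
      using near(2)[of "n + i"] that by (simp add: z(1) cat_plus)
    then have "?v \<in> ebox m v e"
      using w by (simp add: ebox_def Rset_iff)
    ultimately show "w \<in> {cat n u v | u v. u \<in> A \<and> v \<in> B}"
      using d(2) e(2) by blast
  qed
  with d(1) e(1) show "\<exists>e>0. ebox (n + m) z e \<subseteq> {cat n u v | u v. u \<in> A \<and> v \<in> B}"
    by (intro exI[of _ "min d e"]) simp
qed

text \<open>\<open>cat\<close> forgets the tail of its first argument, and membership in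
  \<open>Rset n\<close> fixes that tail.\<close>

lemma cat_inject:
  assumes "u \<in> Rset n" "u' \<in> Rset n"
  shows "cat n u v = cat n u' v' \<longleftrightarrow> u = u' \<and> v = v'"
proof
  assume eq: "cat n u v = cat n u' v'"
  have "u i = u' i" for i
    using fun_cong[OF eq, of i] assms by (cases "i < n") (auto simp: cat_def Rset_iff)
  moreover have "v i = v' i" for i
    using fun_cong[OF eq, of "n + i"] by (simp add: cat_plus)
  ultimately show "u = u' \<and> v = v'"
    by auto
qed auto

lemma open_chart_prod:
  assumes x: "open_chart T (n, U, x)" and y: "open_chart T' (m, V, y)"
  shows "open_chart (prod_topology T T') (n + m, U \<times> V, \<lambda>(p, q). cat n (x p) (y q))"
proof -
  note x' = open_chartD[OF x] and y' = open_chartD[OF y]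
  have "openin (Euclidean_space (n + m)) ((\<lambda>(p, q). cat n (x p) (y q)) ` Q)"
    if Q: "openin (prod_topology T T') Q" "Q \<subseteq> U \<times> V" for Q
  proof (subst openin_subopen, intro ballI)
    fix z assume "z \<in> (\<lambda>(p, q). cat n (x p) (y q)) ` Q"
    then obtain p q where pq: "(p, q) \<in> Q" "z = cat n (x p) (y q)"
      by auto
    then obtain A B where AB: "openin T A" "openin T' B" "p \<in> A" "q \<in> B" "A \<times> B \<subseteq> Q"
      using Q(1) by (metis openin_prod_topology_alt)
    have *: "A \<subseteq> U" "B \<subseteq> V"
      using AB Q(2) by auto
    let ?S = "{cat n u v | u v. u \<in> x ` A \<and> v \<in> y ` B}"
    have "openin (Euclidean_space (n + m)) ?S"
      using x'(3)[OF AB(1) *(1)] y'(3)[OF AB(2) *(2)] by (rule openin_cat)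
    moreover have "z \<in> ?S"
      using pq AB by auto
    moreover have "?S \<subseteq> (\<lambda>(p, q). cat n (x p) (y q)) ` Q"
      using AB(5) by force
    ultimately show "\<exists>S. openin (Euclidean_space (n + m)) S \<and> z \<in> S \<and> S \<subseteq> (\<lambda>(p, q). cat n (x p) (y q)) ` Q"
      by blast
  qed
  moreover have "inj_on (\<lambda>(p, q). cat n (x p) (y q)) (U \<times> V)"
    using x'(2) y'(2) open_chart_in_Rset[OF x] by (auto simp: inj_on_def cat_inject)
  ultimately show ?thesis
    using x'(1) y'(1) by (simp add: openin_prod_Times_iff)
qed

lemma prod_mfld_open_chart:
  assumes "\<And>c. c \<in> atlas X \<Longrightarrow> open_chart (mtop X) c" "\<And>c. c \<in> atlas Y \<Longrightarrow> open_chart (mtop Y) c"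
    and "c \<in> atlas (prod_mfld X Y)"
  shows "open_chart (mtop (prod_mfld X Y)) c"
proof -
  obtain n U x m V y where "c = (n + m, U \<times> V, \<lambda>(p, q). cat n (x p) (y q))"
    "(n, U, x) \<in> atlas X" "(m, V, y) \<in> atlas Y"
    using assms(3) by (auto simp: prod_mfld_def)
  then show ?thesis
    using open_chart_prod[OF assms(1,2)] by (simp add: prod_mfld_def del: open_chart.simps)
qed

text \<open>By injectivity, a slice chart sends the trace on \<open>N\<close> of an open set to the
  image of that set cut with \<open>Rset k\<close>. Since \<open>Rset k\<close> lies in
  \<open>Rset n\<close>, openness in the latter restricts to the former.\<close>

lemma submfld_open_chart:
  assumes "c \<in> atlas (submfld X N)"
  shows "open_chart (mtop (submfld X N)) c"
proof -
  obtain k n U x where c: "c = (k, U \<inter> N, x)" and x: "(n, U, x) \<in> max_atlas X" and k: "k \<le> n"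
    and slice: "x ` (U \<inter> N) = x ` U \<inter> Rset k"
    using assms by (auto simp: submfld_def)
  note ch = open_chartD[OF max_atlasD(2)[OF x]]
  have "openin (Euclidean_space k) (x ` Q)"
    if Q: "openin (subtopology (mtop X) N) Q" "Q \<subseteq> U \<inter> N" for Q
  proof -
    obtain Q' where Q': "openin (mtop X) Q'" "Q = Q' \<inter> N"
      using Q(1) by (auto simp: openin_subtopology)
    have "x ` Q = x ` (Q' \<inter> U) \<inter> x ` (U \<inter> N)"
      using Q' Q(2) ch(2) by (auto simp: inj_on_def)
    also have "\<dots> = x ` (Q' \<inter> U) \<inter> Rset k"
      using slice by auto
    finally have eq: "x ` Q = x ` (Q' \<inter> U) \<inter> Rset k" .
    have "openin (Euclidean_space n) (x ` (Q' \<inter> U))"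
      using ch(1) Q'(1) by (intro ch(3)) auto
    then obtain T where "open T" "x ` (Q' \<inter> U) = Rset n \<inter> T"
      by (auto simp: openin_Euclidean_space)
    moreover have "Rset k \<subseteq> Rset n"
      using k by simp
    ultimately have "x ` Q = Rset k \<inter> T"
      using eq by blast
    then show ?thesis
      using \<open>open T\<close> by (auto simp: openin_Euclidean_space)
  qed
  moreover have "openin (subtopology (mtop X) N) (U \<inter> N)"
    using ch(1) by (auto simp: openin_subtopology)
  moreover have "inj_on x (U \<inter> N)"
    using ch(2) by (rule inj_on_subset) auto
  ultimately show ?thesis
    by (simp add: c submfld_def)
qed

lemma Rmfld_open_chart: "c \<in> atlas (Rmfld n) \<Longrightarrow> open_chart (mtop (Rmfld n)) c"
  by (auto simp: Rmfld_def inj_on_def)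

definition line_chart :: "real \<Rightarrow> nat \<Rightarrow> real" where
  "line_chart = (\<lambda>s i. if i = 0 then s else 0)"

lemma real_line_simps: "mtop real_line = euclideanreal" "atlas real_line = {(1, UNIV, line_chart)}"
  by (auto simp: real_line_def line_chart_def)

lemma smooth_atlas_real_line: "smooth_atlas real_line"
proof -
  have inj: "inj line_chart"
    by (auto simp: inj_def line_chart_def fun_eq_iff)
  have op: "openin (Euclidean_space 1) (line_chart ` Q)" if "open Q" for Q
    unfolding openin_Euclidean_box
  proof (intro conjI ballI)
    show "line_chart ` Q \<subseteq> Rset 1"
      by (auto simp: Rset_iff line_chart_def)
    fix z assume "z \<in> line_chart ` Q"
    then obtain s where s: "z = line_chart s" "s \<in> Q"
      by auto
    have "\<exists>e>0. \<forall>t. dist t s < e \<longrightarrow> t \<in> Q"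
      using that s(2) unfolding open_dist by (rule bspec)
    then obtain e where e: "e > 0" "\<And>t. \<bar>t - s\<bar> < e \<Longrightarrow> t \<in> Q"
      by (metis dist_real_def)
    have "ebox 1 z e \<subseteq> line_chart ` Q"
    proof
      fix w assume w: "w \<in> ebox 1 z e"
      have "w i = line_chart (w 0) i" for i
      proof (cases "i = 0")
        case False
        moreover have "w \<in> Rset 1"
          using w unfolding ebox_def by blast
        ultimately show ?thesis
          by (simp add: Rset_iff line_chart_def)
      qed (simp add: line_chart_def)
      then have "w = line_chart (w 0)"
        by blast
      moreover have "w 0 \<in> Q"
      proof (rule e(2))
        have "\<bar>w 0 - z 0\<bar> < e"
          using w unfolding ebox_def by simp
        then show "\<bar>w 0 - s\<bar> < e"
          by (simp add: s(1) line_chart_def)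
      qed
      ultimately show "w \<in> line_chart ` Q"
        by blast
    qed
    then show "\<exists>e>0. ebox 1 z e \<subseteq> line_chart ` Q"
      using e(1) by blast
  qed
  have W: "openin (Euclidean_space 1) (range line_chart)"
    using op[of UNIV] by simp
  have "Ck_on k 1 (range line_chart) (\<lambda>z. line_chart (inv_into UNIV line_chart z) 0)" for k
    by (rule Ck_on_cong[OF W _ Ck_on_coordinate[OF W, of k 0]]) (use inj in auto)
  moreover have "line_chart s \<in> Rset 1" for s
    by (auto simp: Rset_iff line_chart_def)
  ultimately have "smooth_on 1 1 (range line_chart) (line_chart \<circ> inv_into UNIV line_chart)"
    by (auto simp: smooth_on_def)
  then show ?thesis
    using op inj by (auto simp: smooth_atlas_def real_line_simps)
qed

lemma smooth_map_real_line:
  assumes X: "manifold X"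
  shows "smooth_map X real_line f \<longleftrightarrow>
    continuous_map (mtop X) euclideanreal f \<and> (\<forall>p\<in>pts X. smooth_at X f p)"
proof safe
  assume f: "smooth_map X real_line f"
  then show "continuous_map (mtop X) euclideanreal f"
    by (auto simp: smooth_map_def real_line_simps)
  show "smooth_at X f p" if "p \<in> pts X" for p
    using smooth_map_coordinates_ex[OF X f that smooth_atlas_open[OF smooth_atlas_real_line]]
    by (auto simp: real_line_simps line_chart_def)
next
  assume "continuous_map (mtop X) euclideanreal f" "\<forall>p\<in>pts X. smooth_at X f p"
  then show "smooth_map X real_line f"
    by (intro smooth_mapI[OF X smooth_atlas_real_line]) (auto simp: real_line_simps line_chart_def)
qed

section \<open>Smooth maps into vector bundles\<close>

lemma continuous_map_local:
  assumes "\<And>p. p \<in> topspace X \<Longrightarrow> \<exists>Q. openin X Q \<and> p \<in> Q \<and> continuous_map (subtopology X Q) Y f"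
  shows "continuous_map X Y f"
  unfolding continuous_map_def
proof (intro conjI allI impI)
  show "f \<in> topspace X \<rightarrow> topspace Y"
  proof
    fix p assume "p \<in> topspace X"
    then obtain Q where "p \<in> Q" "continuous_map (subtopology X Q) Y f"
      using assms by blast
    then show "f p \<in> topspace Y"
      using \<open>p \<in> topspace X\<close> by (auto simp: continuous_map_def)
  qed
  fix V assume V: "openin Y V"
  show "openin X {p \<in> topspace X. f p \<in> V}"
  proof (subst openin_subopen, intro ballI)
    fix p assume p: "p \<in> {p \<in> topspace X. f p \<in> V}"
    then obtain Q where Q: "openin X Q" "p \<in> Q" "continuous_map (subtopology X Q) Y f"
      using assms by blast
    have "openin X {q \<in> Q. f q \<in> V}"
      by (rule openin_preimage_subtopology[OF Q(1,3) V])
    moreover have "p \<in> {q \<in> Q. f q \<in> V}"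
      using p Q by simp
    moreover have "{q \<in> Q. f q \<in> V} \<subseteq> {p \<in> topspace X. f p \<in> V}"
      using openin_subset[OF Q(1)] by auto
    ultimately show "\<exists>T. openin X T \<and> p \<in> T \<and> T \<subseteq> {p \<in> topspace X. f p \<in> V}"
      by blast
  qed
qed

text \<open>Needed for maps into a bundle: their continuity is not given but has to be recovered
  from the germs of finitely many components.\<close>

lemma smooth_at_common_continuous:
  assumes X: "manifold X" and "finite J" and "\<And>j. j \<in> J \<Longrightarrow> smooth_at X (f j) p"
    and Q: "openin (mtop X) Q" "p \<in> Q"
  shows "\<exists>Q'. openin (mtop X) Q' \<and> p \<in> Q' \<and> Q' \<subseteq> Q \<and>
    (\<forall>j\<in>J. continuous_map (subtopology (mtop X) Q') euclideanreal (f j))"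
  using assms(2,3)
proof (induction J rule: finite_induct)
  case empty
  then show ?case
    using Q by blast
next
  case (insert j J)
  have "\<exists>Q'. openin (mtop X) Q' \<and> p \<in> Q' \<and> Q' \<subseteq> Q \<and>
    (\<forall>j\<in>J. continuous_map (subtopology (mtop X) Q') euclideanreal (f j))"
    using insert.prems by (intro insert.IH) simp
  then obtain Q1 where Q1: "openin (mtop X) Q1" "p \<in> Q1" "Q1 \<subseteq> Q"
    "\<And>j. j \<in> J \<Longrightarrow> continuous_map (subtopology (mtop X) Q1) euclideanreal (f j)"
    by blast
  obtain Q2 where Q2: "openin (mtop X) Q2" "p \<in> Q2"
    "continuous_map (subtopology (mtop X) Q2) euclideanreal (f j)"
    using smooth_at_continuous[OF X insert.prems[OF insertI1]] by blast
  have "continuous_map (subtopology (mtop X) (Q1 \<inter> Q2)) euclideanreal (f i)" if "i \<in> insert j J" for i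
  proof (cases "i = j")
    case True
    then show ?thesis
      using continuous_map_from_subtopology_mono[OF Q2(3), of "Q1 \<inter> Q2"] by simp
  next
    case False
    then have "i \<in> J"
      using that by simp
    then show ?thesis
      using continuous_map_from_subtopology_mono[OF Q1(4), of i "Q1 \<inter> Q2"] by simp
  qed
  then show ?case
    using Q1 Q2 by (intro exI[of _ "Q1 \<inter> Q2"]) auto
qed

lemma smooth_map_id: "manifold X \<Longrightarrow> smooth_map X X (\<lambda>p. p)"
proof (rule smooth_mapI)
  assume X: "manifold X"
  show "smooth_atlas X"
    using X by (rule manifold_smooth_atlas)
  show "continuous_map (mtop X) (mtop X) (\<lambda>p. p)"
    using continuous_map_id[of "mtop X"] by (simp add: id_def)
  fix p assume "p \<in> pts X"
  then obtain n U x where c: "(n, U, x) \<in> atlas X" "p \<in> U"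
    using manifold_chart[OF X] by blast
  then show "\<exists>m V y. (m, V, y) \<in> atlas X \<and> p \<in> V \<and> (\<forall>j<m. smooth_at X (\<lambda>q. y q j) p)"
    using smooth_at_chart_coordinate[OF X manifold_max_atlas[OF X c(1)] c(2)] by blast
qed

section \<open>Fibers and local trivializations\<close>

lemma vector_bundleD:
  assumes "vector_bundle E"
  shows "manifold (total E)" "manifold (vbase E)" "smooth_map (total E) (vbase E) (proj E)"
  using assms by (auto simp: vector_bundle_def)

lemma vector_bundle_triv:
  assumes "vector_bundle E" "p \<in> pts (vbase E)"
  obtains r U t where "local_triv E (r, U, t)" "p \<in> U"
  using assms unfolding vector_bundle_def by blast

lemma fiberD: "v \<in> fiber E p \<Longrightarrow> v \<in> pts (total E)" "v \<in> fiber E p \<Longrightarrow> proj E v = p"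
  by (auto simp: fiber_def)

abbreviation over :: "('e, 'f) vbundle \<Rightarrow> 'f set \<Rightarrow> 'e set" where
  "over E U \<equiv> {v \<in> pts (total E). proj E v \<in> U}"

lemma local_trivD:
  assumes "local_triv E (r, U, t)"
  shows "openin (mtop (vbase E)) U" "U \<subseteq> pts (vbase E)"
    and "diffeo (submfld (total E) (over E U)) (prod_mfld (submfld (vbase E) U) (Rmfld r)) (\<lambda>v. (proj E v, t v))"
  using assms openin_subset by auto

lemma pts_submfld: "N \<subseteq> pts X \<Longrightarrow> pts (submfld X N) = N"
  by (auto simp: submfld_def)

lemma pts_triv_codomain:
  assumes "local_triv E (r, U, t)"
  shows "pts (prod_mfld (submfld (vbase E) U) (Rmfld r)) = U \<times> Rset r"
  using local_trivD(2)[OF assms] by (auto simp: prod_mfld_def submfld_def Rmfld_def)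

lemma triv_bij:
  assumes "local_triv E (r, U, t)"
  shows "bij_betw (\<lambda>v. (proj E v, t v)) (over E U) (U \<times> Rset r)"
proof -
  have "pts (submfld (total E) (over E U)) = over E U"
    by (rule pts_submfld) auto
  then show ?thesis
    using local_trivD(3)[OF assms] by (simp add: diffeo_def pts_triv_codomain[OF assms])
qed

lemma triv_fiber_bij:
  assumes "local_triv E (r, U, t)" "p \<in> U"
  shows "bij_betw t (fiber E p) (Rset r)"
proof -
  note b = triv_bij[OF assms(1)]
  have "inj_on t (fiber E p)"
  proof (rule inj_onI)
    fix v w assume vw: "v \<in> fiber E p" "w \<in> fiber E p" "t v = t w"
    then have "v \<in> over E U" "w \<in> over E U" "(proj E v, t v) = (proj E w, t w)"
      using assms(2) by (auto simp: fiber_def)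
    then show "v = w"
      using b unfolding bij_betw_def inj_on_def by blast
  qed
  moreover have "t ` fiber E p = Rset r"
  proof
    show "t ` fiber E p \<subseteq> Rset r"
      using bij_betw_imp_surj_on[OF b] assms(2) by (auto simp: fiber_def)
    show "Rset r \<subseteq> t ` fiber E p"
    proof
      fix z assume "z \<in> Rset r"
      then have "(p, z) \<in> (\<lambda>v. (proj E v, t v)) ` over E U"
        using bij_betw_imp_surj_on[OF b] assms(2) by simp
      then show "z \<in> t ` fiber E p"
        by (auto simp: fiber_def)
    qed
  qed
  ultimately show ?thesis
    by (simp add: bij_betw_def)
qed

lemma triv_in_Rset:
  assumes "local_triv E (r, U, t)" "v \<in> over E U"
  shows "t v \<in> Rset r"
  using bij_betwE[OF triv_bij[OF assms(1)]] assms(2) by (simp add: mem_Times_iff del: local_triv.simps)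

lemma vadd_triv:
  assumes "local_triv E (r, U, t)" "p \<in> U" "v \<in> fiber E p" "w \<in> fiber E p"
  shows "vadd E v w \<in> fiber E p" "t (vadd E v w) = (\<lambda>i. t v i + t w i)"
  using assms by auto

lemma vscale_triv:
  assumes "local_triv E (r, U, t)" "p \<in> U" "v \<in> fiber E p"
  shows "vscale E c v \<in> fiber E p" "t (vscale E c v) = (\<lambda>i. c * t v i)"
  using assms by auto

lemma vadd_fiber:
  assumes "vector_bundle E" "p \<in> pts (vbase E)" "v \<in> fiber E p" "w \<in> fiber E p"
  shows "vadd E v w \<in> fiber E p"
  using vector_bundle_triv[OF assms(1,2)] vadd_triv(1)[OF _ _ assms(3,4)] by blast

lemma vscale_fiber:
  assumes "vector_bundle E" "p \<in> pts (vbase E)" "v \<in> fiber E p"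
  shows "vscale E c v \<in> fiber E p"
  using vector_bundle_triv[OF assms(1,2)] vscale_triv(1)[OF _ _ assms(3)] by blast

lemma openin_over:
  assumes "vector_bundle E" "openin (mtop (vbase E)) U"
  shows "openin (mtop (total E)) (over E U)"
  using openin_continuous_map_preimage[OF smooth_map_continuous[OF vector_bundleD(3)[OF assms(1)]] assms(2)] .

lemma submfld_atlasD:
  assumes "(k, V, x) \<in> atlas (submfld X N)"
  shows "\<exists>n U. (n, U, x) \<in> max_atlas X \<and> k \<le> n \<and> V = U \<inter> N \<and> x ` (U \<inter> N) = x ` U \<inter> Rset k"
proof -
  have "atlas (submfld X N) = {(k, U \<inter> N, x) | k n U x.
      (n, U, x) \<in> max_atlas X \<and> k \<le> n \<and> x ` (U \<inter> N) = x ` U \<inter> Rset k}"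
    by (simp add: submfld_def)
  then have "(k, V, x) \<in> {(k, U \<inter> N, x) | k n U x.
      (n, U, x) \<in> max_atlas X \<and> k \<le> n \<and> x ` (U \<inter> N) = x ` U \<inter> Rset k}"
    using assms by simp
  then show ?thesis
    by auto
qed

text \<open>The trivialization is smooth on a submanifold, whereas the germ is wanted on
  \<open>total E\<close>. The identity bridges the two: coordinates of the submanifold are
  restricted coordinates of \<open>total E\<close>, so \<open>smooth_map_compose_germ\<close>
  applies.\<close>

lemma smooth_at_triv:
  assumes E: "vector_bundle E" and t: "local_triv E (r, U, t)" and v: "v \<in> over E U" and j: "j < r"
  shows "smooth_at (total E) (\<lambda>v. t v j) v"
proof -
  let ?N = "over E U"
  note X = vector_bundleD(1)[OF E]
  have "\<exists>m V y. (m, V, y) \<in> atlas (prod_mfld (submfld (vbase E) U) (Rmfld r)) \<and> (proj E v, t v) \<in> V \<and>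
      (\<forall>j<m. smooth_at (total E) (\<lambda>v. y (proj E v, t v) j) v)"
  proof (rule smooth_map_compose_germ[OF X _ v, where f = "\<lambda>v. v" and g = "\<lambda>v. (proj E v, t v)"])
    show "openin (mtop (total E)) ?N"
      by (rule openin_over[OF E local_trivD(1)[OF t]])
    show "continuous_map (subtopology (mtop (total E)) ?N) (mtop (submfld (total E) ?N)) (\<lambda>v. v)"
      using continuous_map_id[of "subtopology (mtop (total E)) ?N"] by (simp add: id_def submfld_def)
    show "open_chart (mtop (submfld (total E) ?N)) c" if "c \<in> atlas (submfld (total E) ?N)" for c
      using that by (rule submfld_open_chart)
    show "smooth_map (submfld (total E) ?N) (prod_mfld (submfld (vbase E) U) (Rmfld r)) (\<lambda>v. (proj E v, t v))"
      using local_trivD(3)[OF t] by (simp add: diffeo_def)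
    show "openin (mtop (prod_mfld (submfld (vbase E) U) (Rmfld r))) (fst (snd c))"
      if "c \<in> atlas (prod_mfld (submfld (vbase E) U) (Rmfld r))" for c
      using prod_mfld_open_chart[OF submfld_open_chart Rmfld_open_chart that] by (cases c) auto
    show "smooth_at (total E) (\<lambda>v. y v i) v"
      if c: "(m, V, y) \<in> atlas (submfld (total E) ?N)" "v \<in> V" "i < m" for m V y i
    proof -
      obtain n V' where y: "(n, V', y) \<in> max_atlas (total E)" "m \<le> n" "V \<subseteq> V'"
        using submfld_atlasD[OF c(1)] by blast
      then show ?thesis
        using c(2,3) by (intro smooth_at_chart_coordinate[OF X y(1)]) auto
    qed
  qed
  \<comment> \<open>In a product chart the fiber coordinates come after the \<open>k\<close>
    coordinates of the base.\<close>
  then obtain k x where "\<forall>i<k + r. smooth_at (total E) (\<lambda>v. cat k (x (proj E v)) (t v) i) v"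
    by (auto simp: prod_mfld_def Rmfld_def)
  then have "smooth_at (total E) (\<lambda>v. cat k (x (proj E v)) (t v) (k + j)) v"
    using j by simp
  then show ?thesis
    by (simp add: cat_plus)
qed

lemma smooth_at_triv_compose:
  assumes X: "manifold X" and E: "vector_bundle E" and h: "smooth_map X (total E) h"
    and t: "local_triv E (r, U, t)" and p: "p \<in> pts X" "proj E (h p) \<in> U" and j: "j < r"
  shows "smooth_at X (\<lambda>q. t (h q) j) p"
  using smooth_at_pullback[OF X vector_bundleD(1)[OF E] h p(1) smooth_at_triv[OF E t _ j]]
    smooth_map_in_pts[OF h p(1)] p(2) by simp

text \<open>Near \<open>p\<close> the map \<open>h\<close> is the inverse trivialization applied to
  the pair of \<open>proj E (h q)\<close> and \<open>t (h q)\<close>. The pair has smooth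
  coordinates in every product chart, by the assumption on the projection and by that on the
  components.\<close>

lemma smooth_map_into_total_germ:
  assumes X: "manifold X" and E: "vector_bundle E"
    and h: "\<And>q. q \<in> pts X \<Longrightarrow> h q \<in> pts (total E)"
    and ph: "smooth_map X (vbase E) (\<lambda>q. proj E (h q))"
    and p: "p \<in> pts X" and t: "local_triv E (r, U, t)" and pU: "proj E (h p) \<in> U"
    and th: "\<And>j. j < r \<Longrightarrow> smooth_at X (\<lambda>q. t (h q) j) p"
  shows "\<exists>Q. openin (mtop X) Q \<and> p \<in> Q \<and> continuous_map (subtopology (mtop X) Q) (mtop (total E)) h"
    and "\<exists>n V y. (n, V, y) \<in> atlas (total E) \<and> h p \<in> V \<and> (\<forall>j<n. smooth_at X (\<lambda>q. y (h q) j) p)"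
proof -
  let ?N = "over E U" and ?Y = "prod_mfld (submfld (vbase E) U) (Rmfld r)"
  let ?Z = "submfld (total E) ?N" and ?\<Psi> = "\<lambda>v. (proj E v, t v)"
  let ?f = "\<lambda>q. (proj E (h q), t (h q))" and ?g = "inv_into (pts ?Z) ?\<Psi>"
  define Q1 where "Q1 = {q \<in> pts X. proj E (h q) \<in> U}"
  have Q1: "openin (mtop X) Q1"
    unfolding Q1_def by (rule openin_continuous_map_preimage[OF smooth_map_continuous[OF ph] local_trivD(1)[OF t]])
  have "p \<in> Q1"
    using p pU by (simp add: Q1_def)
  have "\<exists>Q. openin (mtop X) Q \<and> p \<in> Q \<and> Q \<subseteq> Q1 \<and>
      (\<forall>j\<in>{..<r}. continuous_map (subtopology (mtop X) Q) euclideanreal (\<lambda>q. t (h q) j))"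
    using th by (intro smooth_at_common_continuous[OF X _ _ Q1 \<open>p \<in> Q1\<close>]) auto
  then obtain Q where Q: "openin (mtop X) Q" "p \<in> Q" "Q \<subseteq> Q1"
    and tc: "\<And>j. j < r \<Longrightarrow> continuous_map (subtopology (mtop X) Q) euclideanreal (\<lambda>q. t (h q) j)"
    by auto
  have hN: "h q \<in> ?N" if "q \<in> Q" for q
    using that Q(3) h by (auto simp: Q1_def)
  have ptsZ: "pts ?Z = ?N"
    by (rule pts_submfld) auto
  have gf: "?g (?f q) = h q" if "q \<in> Q" for q
    using inv_into_f_f[of ?\<Psi> ?N "h q"] bij_betw_imp_inj_on[OF triv_bij[OF t]] hN[OF that] ptsZ by simp
  have fcont: "continuous_map (subtopology (mtop X) Q) (mtop ?Y) ?f"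
  proof -
    have "continuous_map (subtopology (mtop X) Q) (mtop (vbase E)) (\<lambda>q. proj E (h q))"
      using smooth_map_continuous[OF ph] by (rule continuous_map_from_subtopology)
    then have 1: "continuous_map (subtopology (mtop X) Q) (subtopology (mtop (vbase E)) U) (\<lambda>q. proj E (h q))"
      by (rule continuous_map_into_subtopology) (use hN in auto)
    have "continuous_map (subtopology (mtop X) Q) (Euclidean_space r) (\<lambda>q i. if i < r then t (h q) i else 0)"
      using tc by (simp add: continuous_map_componentwise_Euclidean_space)
    then have 2: "continuous_map (subtopology (mtop X) Q) (Euclidean_space r) (\<lambda>q. t (h q))"
    proof (rule continuous_map_eq)
      fix q assume "q \<in> topspace (subtopology (mtop X) Q)"
      then have "t (h q) \<in> Rset r"
        using triv_in_Rset[OF t hN] by auto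
      then show "(\<lambda>i. if i < r then t (h q) i else 0) = t (h q)"
        by (auto simp: Rset_iff)
    qed
    show ?thesis
      using 1 2 by (simp add: continuous_map_pairwise comp_def prod_mfld_def submfld_def Rmfld_def)
  qed
  have gsm: "smooth_map ?Y ?Z ?g"
    using local_trivD(3)[OF t] by (simp add: diffeo_def)
  have "continuous_map (subtopology (mtop X) Q) (mtop ?Z) (?g \<circ> ?f)"
    by (rule continuous_map_compose[OF fcont smooth_map_continuous[OF gsm]])
  then have "continuous_map (subtopology (mtop X) Q) (mtop ?Z) h"
    by (rule continuous_map_eq) (simp add: gf)
  then have "continuous_map (subtopology (mtop X) Q) (subtopology (mtop (total E)) ?N) h"
    by (simp add: submfld_def)
  then have hcont: "continuous_map (subtopology (mtop X) Q) (mtop (total E)) h"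
    by (rule continuous_map_into_fulltopology)
  then show "\<exists>Q. openin (mtop X) Q \<and> p \<in> Q \<and> continuous_map (subtopology (mtop X) Q) (mtop (total E)) h"
    using Q by blast
  have "\<exists>m V y. (m, V, y) \<in> atlas ?Z \<and> ?g (?f p) \<in> V \<and> (\<forall>j<m. smooth_at X (\<lambda>q. y (?g (?f q)) j) p)"
  proof (rule smooth_map_compose_germ[OF X Q(1,2) fcont _ _ gsm])
    show "open_chart (mtop ?Y) c" if "c \<in> atlas ?Y" for c
      by (rule prod_mfld_open_chart[OF submfld_open_chart Rmfld_open_chart that])
    show "openin (mtop ?Z) (fst (snd c))" if "c \<in> atlas ?Z" for c
      using submfld_open_chart[OF that] by (cases c) auto
    show "smooth_at X (\<lambda>q. y (?f q) j) p" if y: "(m, V, y) \<in> atlas ?Y" "?f p \<in> V" "j < m" for m V y j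
    proof -
      obtain k n V' x where x: "(n, V', x) \<in> max_atlas (vbase E)" "k \<le> n" "proj E (h p) \<in> V'"
        and m: "m = k + r" and y_eq: "y = (\<lambda>(p, q). cat k (x p) q)"
        using y by (auto simp: prod_mfld_def submfld_def Rmfld_def)
      show ?thesis
      proof (cases "j < k")
        case True
        then have "j < n"
          using x(2) by simp
        then show ?thesis
          using smooth_map_coordinates[OF X vector_bundleD(2)[OF E] ph p x(1,3)] True
          by (simp add: y_eq cat_less)
      next
        case False
        then have "j - k < r"
          using y(3) m by simp
        then show ?thesis
          using th[of "j - k"] False by (simp add: y_eq cat_def)
      qed
    qed
  qed
  then obtain k n V y where y: "(n, V, y) \<in> max_atlas (total E)" "k \<le> n" "y ` (V \<inter> ?N) = y ` V \<inter> Rset k"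
    "?g (?f p) \<in> V" and sm: "\<And>j. j < k \<Longrightarrow> smooth_at X (\<lambda>q. y (?g (?f q)) j) p"
    by (auto simp: submfld_def)
  note ych = max_atlasD(2)[OF y(1)]
  have hV: "h p \<in> V"
    using y(4) gf[OF Q(2)] by simp
  have Q': "openin (mtop X) {q \<in> Q. h q \<in> V}"
    by (rule openin_preimage_subtopology[OF Q(1) hcont open_chartD(1)[OF ych]])
  \<comment> \<open>The slice chart yields its first \<open>k\<close> coordinates only; the
    remaining ones vanish near \<open>p\<close>, because \<open>h\<close> stays over
    \<open>U\<close> there.\<close>
  have smy: "smooth_at X (\<lambda>q. y (h q) j) p" if "j < n" for j
  proof (cases "j < k")
    case True
    show ?thesis
      by (rule smooth_at_cong[OF X sm[OF True] Q(1,2)]) (simp add: gf)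
  next
    case False
    show ?thesis
    proof (rule smooth_at_cong[OF X smooth_at_const[OF X p] Q'])
      show "0 = y (h q) j" if "q \<in> {q \<in> Q. h q \<in> V}" for q
      proof -
        have "y (h q) \<in> y ` (V \<inter> ?N)"
          using that hN by blast
        then have "y (h q) \<in> Rset k"
          using y(3) by blast
        then show ?thesis
          using False by (simp add: Rset_iff)
      qed
    qed (use Q hV in auto)
  qed
  \<comment> \<open>The chart found so far extends to one in \<open>max_atlas\<close>; the claim
    asks for a chart of the atlas itself.\<close>
  obtain m W z where z: "(m, W, z) \<in> atlas (total E)" "h p \<in> W"
    using manifold_chart[OF vector_bundleD(1)[OF E] h[OF p]] by blast
  have "smooth_at X (\<lambda>q. z (h q) j) p" if "j < m" for j
    by (rule smooth_at_change_chart[OF X Q(1,2) hcont ych hV _ z(2) max_atlasD(3)[OF y(1) z(1)] smy that])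
      (use open_chartD(1)[OF manifold_open_chart[OF vector_bundleD(1)[OF E] z(1)]] in auto)
  then show "\<exists>n V y. (n, V, y) \<in> atlas (total E) \<and> h p \<in> V \<and> (\<forall>j<n. smooth_at X (\<lambda>q. y (h q) j) p)"
    using z by blast
qed

lemma smooth_map_into_total:
  assumes X: "manifold X" and E: "vector_bundle E"
    and h: "\<And>q. q \<in> pts X \<Longrightarrow> h q \<in> pts (total E)"
    and ph: "smooth_map X (vbase E) (\<lambda>q. proj E (h q))"
    and th: "\<And>p. p \<in> pts X \<Longrightarrow> \<exists>r U t. local_triv E (r, U, t) \<and> proj E (h p) \<in> U \<and>
      (\<forall>j<r. smooth_at X (\<lambda>q. t (h q) j) p)"
  shows "smooth_map X (total E) h"
proof (rule smooth_mapI[OF X manifold_smooth_atlas[OF vector_bundleD(1)[OF E]]])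
  show "continuous_map (mtop X) (mtop (total E)) h"
  proof (rule continuous_map_local)
    fix p assume p: "p \<in> pts X"
    obtain r U t where t: "local_triv E (r, U, t)" "proj E (h p) \<in> U"
      "\<forall>j<r. smooth_at X (\<lambda>q. t (h q) j) p"
      using th[OF p] by (elim exE conjE)
    show "\<exists>Q. openin (mtop X) Q \<and> p \<in> Q \<and> continuous_map (subtopology (mtop X) Q) (mtop (total E)) h"
      by (rule smooth_map_into_total_germ(1)[OF X E h ph p t(1,2)]) (use t(3) in auto)
  qed
  fix p assume p: "p \<in> pts X"
  obtain r U t where t: "local_triv E (r, U, t)" "proj E (h p) \<in> U"
    "\<forall>j<r. smooth_at X (\<lambda>q. t (h q) j) p"
    using th[OF p] by (elim exE conjE)
  show "\<exists>n V y. (n, V, y) \<in> atlas (total E) \<and> h p \<in> V \<and> (\<forall>j<n. smooth_at X (\<lambda>q. y (h q) j) p)"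
    by (rule smooth_map_into_total_germ(2)[OF X E h ph p t(1,2)]) (use t(3) in auto)
qed

section \<open>Sections\<close>

lemma sectionsD:
  assumes "\<psi> \<in> sections E"
  shows "\<psi> \<in> extensional (pts (vbase E))" "smooth_map (vbase E) (total E) \<psi>"
    "\<And>p. p \<in> pts (vbase E) \<Longrightarrow> \<psi> p \<in> fiber E p"
  using assms by (auto simp: sections_def fiber_def intro: smooth_map_in_pts)

lemma sections_triv:
  assumes E: "vector_bundle E" and \<psi>: "\<psi> \<in> sections E" and t: "local_triv E (r, U, t)" "p \<in> U" "j < r"
  shows "smooth_at (vbase E) (\<lambda>q. t (\<psi> q) j) p"
proof -
  have p: "p \<in> pts (vbase E)"
    using local_trivD(2)[OF t(1)] t(2) by blast
  then show ?thesis
    using smooth_at_triv_compose[OF vector_bundleD(2)[OF E] E sectionsD(2)[OF \<psi>] t(1) p _ t(3)]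
      fiberD(2)[OF sectionsD(3)[OF \<psi> p]] t(2) by simp
qed

text \<open>Together with \<open>sections_triv\<close> this reduces smoothness of a section to that
  of its components, on which \<open>vadd\<close> and \<open>vscale\<close> act
  coordinatewise.\<close>

lemma sectionsI:
  assumes E: "vector_bundle E" and ext: "\<psi> \<in> extensional (pts (vbase E))"
    and fib: "\<And>p. p \<in> pts (vbase E) \<Longrightarrow> \<psi> p \<in> fiber E p"
    and sm: "\<And>r U t p j. local_triv E (r, U, t) \<Longrightarrow> p \<in> U \<Longrightarrow> j < r \<Longrightarrow>
      smooth_at (vbase E) (\<lambda>q. t (\<psi> q) j) p"
  shows "\<psi> \<in> sections E"
proof -
  note B = vector_bundleD(2)[OF E]
  have "smooth_map (vbase E) (total E) \<psi>"
  proof (rule smooth_map_into_total[OF B E])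
    show "\<psi> q \<in> pts (total E)" if "q \<in> pts (vbase E)" for q
      using fib[OF that] by (rule fiberD)
    show "smooth_map (vbase E) (vbase E) (\<lambda>q. proj E (\<psi> q))"
      by (rule smooth_map_cong[OF B manifold_smooth_atlas[OF B] smooth_map_id[OF B]])
        (simp add: fiberD(2)[OF fib])
    fix p assume p: "p \<in> pts (vbase E)"
    obtain r U t where t: "local_triv E (r, U, t)" "p \<in> U"
      using vector_bundle_triv[OF E p] by blast
    have "proj E (\<psi> p) \<in> U"
      using t(2) fiberD(2)[OF fib[OF p]] by simp
    then show "\<exists>r U t. local_triv E (r, U, t) \<and> proj E (\<psi> p) \<in> U \<and>
        (\<forall>j<r. smooth_at (vbase E) (\<lambda>q. t (\<psi> q) j) p)"
      using t(1) sm[OF t] by blast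
  qed
  then show ?thesis
    using ext fib by (auto simp: sections_def fiber_def)
qed

lemma sec_add_sections:
  assumes E: "vector_bundle E" and \<psi>: "\<psi> \<in> sections E" and \<eta>: "\<eta> \<in> sections E"
  shows "sec_add E \<psi> \<eta> \<in> sections E"
proof (rule sectionsI[OF E])
  show "sec_add E \<psi> \<eta> p \<in> fiber E p" if "p \<in> pts (vbase E)" for p
    using that by (simp add: sec_add_def vadd_fiber[OF E that] sectionsD(3)[OF \<psi> that] sectionsD(3)[OF \<eta> that])
  fix r U t p and j :: nat
  assume t: "local_triv E (r, U, t)" "p \<in> U" "j < r"
  show "smooth_at (vbase E) (\<lambda>q. t (sec_add E \<psi> \<eta> q) j) p"
  proof (rule smooth_at_cong[OF vector_bundleD(2)[OF E] _ local_trivD(1)[OF t(1)] t(2)])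
    show "smooth_at (vbase E) (\<lambda>q. t (\<psi> q) j + t (\<eta> q) j) p"
      by (rule smooth_at_add[OF vector_bundleD(2)[OF E] sections_triv[OF E \<psi> t] sections_triv[OF E \<eta> t]])
    fix q assume "q \<in> U"
    moreover from this have "q \<in> pts (vbase E)"
      using local_trivD(2)[OF t(1)] by blast
    ultimately show "t (\<psi> q) j + t (\<eta> q) j = t (sec_add E \<psi> \<eta> q) j"
      using vadd_triv(2)[OF t(1) _ sectionsD(3)[OF \<psi>] sectionsD(3)[OF \<eta>]] by (simp add: sec_add_def)
  qed
qed (simp add: sec_add_def)

lemma sec_mult_sections:
  assumes E: "vector_bundle E" and \<psi>: "\<psi> \<in> sections E"
    and f: "\<And>p. p \<in> pts (vbase E) \<Longrightarrow> smooth_at (vbase E) f p"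
  shows "sec_mult E f \<psi> \<in> sections E"
proof (rule sectionsI[OF E])
  show "sec_mult E f \<psi> p \<in> fiber E p" if "p \<in> pts (vbase E)" for p
    using that by (simp add: sec_mult_def vscale_fiber[OF E that] sectionsD(3)[OF \<psi> that])
  fix r U t p and j :: nat
  assume t: "local_triv E (r, U, t)" "p \<in> U" "j < r"
  show "smooth_at (vbase E) (\<lambda>q. t (sec_mult E f \<psi> q) j) p"
  proof (rule smooth_at_cong[OF vector_bundleD(2)[OF E] _ local_trivD(1)[OF t(1)] t(2)])
    show "smooth_at (vbase E) (\<lambda>q. f q * t (\<psi> q) j) p"
      using local_trivD(2)[OF t(1)] t(2)
      by (intro smooth_at_mult[OF vector_bundleD(2)[OF E] f sections_triv[OF E \<psi> t]]) auto
    fix q assume "q \<in> U"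
    moreover from this have "q \<in> pts (vbase E)"
      using local_trivD(2)[OF t(1)] by blast
    ultimately show "f q * t (\<psi> q) j = t (sec_mult E f \<psi> q) j"
      using vscale_triv(2)[OF t(1) _ sectionsD(3)[OF \<psi>]] by (simp add: sec_mult_def)
  qed
qed (simp add: sec_mult_def)

section \<open>Semi-linear isomorphisms induced by bundle automorphisms\<close>

text \<open>The formula of \<open>induces\<close>, made extensional in the section and in the point,
  so that equations in \<open>semilinear_group\<close> can be proved pointwise.\<close>

definition push_section :: "('e, 'f) vbundle \<Rightarrow> ('e \<Rightarrow> 'e) \<Rightarrow> ('f \<Rightarrow> 'f) \<Rightarrow> ('f \<Rightarrow> 'e) \<Rightarrow> 'f \<Rightarrow> 'e" where
  "push_section E \<nu> \<nu>F =
     (\<lambda>\<psi>\<in>sections E. \<lambda>p\<in>pts (vbase E). \<nu> (\<psi> (inv_into (pts (vbase E)) \<nu>F p)))"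

lemma diffeoD:
  assumes "diffeo X Y f"
  shows "bij_betw f (pts X) (pts Y)" "smooth_map X Y f" "smooth_map Y X (inv_into (pts X) f)"
  using assms by (auto simp: diffeo_def)

context
  fixes E :: "('e, 'f) vbundle" and \<nu> :: "'e \<Rightarrow> 'e" and \<nu>F :: "'f \<Rightarrow> 'f"
  assumes E: "vector_bundle E" and aut: "vb_automorphism E \<nu> \<nu>F"
begin

private abbreviation (input) "F \<equiv> vbase E"
private abbreviation (input) "\<nu>F' \<equiv> inv_into (pts (vbase E)) \<nu>F"
private abbreviation (input) "\<nu>' \<equiv> inv_into (pts (total E)) \<nu>"

lemma vb_automorphismD:
  "diffeo (total E) (total E) \<nu>" "diffeo (vbase E) (vbase E) \<nu>F"
  "\<And>v. v \<in> pts (total E) \<Longrightarrow> proj E (\<nu> v) = \<nu>F (proj E v)"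
  "\<And>p. p \<in> pts (vbase E) \<Longrightarrow> linear_iso E p (\<nu>F p) \<nu>"
  using aut by (auto simp: vb_automorphism_def)

lemma inv_base:
  assumes "p \<in> pts F"
  shows "\<nu>F' p \<in> pts F" "\<nu>F (\<nu>F' p) = p" "\<nu>F' (\<nu>F p) = p" "\<nu>F p \<in> pts F"
proof -
  note b = diffeoD(1)[OF vb_automorphismD(2)]
  have surj: "\<nu>F ` pts F = pts F"
    using b by (rule bij_betw_imp_surj_on)
  show "\<nu>F' p \<in> pts F" "\<nu>F (\<nu>F' p) = p"
    using assms inv_into_into[of p \<nu>F "pts F"] f_inv_into_f[of p \<nu>F "pts F"] by (simp_all add: surj)
  show "\<nu>F' (\<nu>F p) = p"
    using bij_betw_imp_inj_on[OF b] assms by simp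
  show "\<nu>F p \<in> pts F"
    using assms surj by blast
qed

lemma push_section_apply:
  "\<psi> \<in> sections E \<Longrightarrow> p \<in> pts F \<Longrightarrow> push_section E \<nu> \<nu>F \<psi> p = \<nu> (\<psi> (\<nu>F' p))"
  by (simp add: push_section_def)

lemma push_section_in_sections:
  assumes \<psi>: "\<psi> \<in> sections E"
  shows "push_section E \<nu> \<nu>F \<psi> \<in> sections E"
proof -
  note B = vector_bundleD(2)[OF E] and T = vector_bundleD(1)[OF E]
  have "smooth_map F (total E) (\<lambda>p. \<nu> (\<psi> (\<nu>F' p)))"
    by (rule smooth_map_compose[OF B T manifold_smooth_atlas[OF T] smooth_map_compose[OF B B manifold_smooth_atlas[OF T]]])
      (fact diffeoD(3)[OF vb_automorphismD(2)] sectionsD(2)[OF \<psi>] diffeoD(2)[OF vb_automorphismD(1)])+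
  then have "smooth_map F (total E) (push_section E \<nu> \<nu>F \<psi>)"
    by (rule smooth_map_cong[OF B manifold_smooth_atlas[OF T]]) (simp add: push_section_apply[OF \<psi>])
  moreover have "proj E (push_section E \<nu> \<nu>F \<psi> p) = p" if "p \<in> pts F" for p
    using sectionsD(3)[OF \<psi> inv_base(1)[OF that]] inv_base(2)[OF that] that
    by (simp add: push_section_apply[OF \<psi>] vb_automorphismD(3) fiber_def)
  moreover have "push_section E \<nu> \<nu>F \<psi> \<in> extensional (pts F)"
    using \<psi> by (simp add: push_section_def)
  ultimately show ?thesis
    by (simp add: sections_def)
qed

lemma inv_total:
  assumes "v \<in> pts (total E)"
  shows "\<nu>' v \<in> pts (total E)" "\<nu> (\<nu>' v) = v" "\<nu>' (\<nu> v) = v"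
proof -
  note b = diffeoD(1)[OF vb_automorphismD(1)]
  have surj: "\<nu> ` pts (total E) = pts (total E)"
    using b by (rule bij_betw_imp_surj_on)
  show "\<nu>' v \<in> pts (total E)" "\<nu> (\<nu>' v) = v"
    using assms inv_into_into[of v \<nu> "pts (total E)"] f_inv_into_f[of v \<nu> "pts (total E)"]
    by (simp_all add: surj)
  show "\<nu>' (\<nu> v) = v"
    using bij_betw_imp_inj_on[OF b] assms by simp
qed

lemma pull_section_in_sections:
  assumes \<psi>: "\<psi> \<in> sections E"
  shows "(\<lambda>p\<in>pts F. \<nu>' (\<psi> (\<nu>F p))) \<in> sections E" (is "?\<eta> \<in> _")
proof -
  note B = vector_bundleD(2)[OF E] and T = vector_bundleD(1)[OF E]
  have "smooth_map F (total E) (\<lambda>p. \<nu>' (\<psi> (\<nu>F p)))"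
    by (rule smooth_map_compose[OF B T manifold_smooth_atlas[OF T] smooth_map_compose[OF B B manifold_smooth_atlas[OF T]]])
      (fact diffeoD(2)[OF vb_automorphismD(2)] sectionsD(2)[OF \<psi>] diffeoD(3)[OF vb_automorphismD(1)])+
  then have "smooth_map F (total E) ?\<eta>"
    by (rule smooth_map_cong[OF B manifold_smooth_atlas[OF T]]) simp
  moreover have "proj E (?\<eta> p) = p" if p: "p \<in> pts F" for p
  proof -
    have v: "\<psi> (\<nu>F p) \<in> fiber E (\<nu>F p)"
      by (rule sectionsD(3)[OF \<psi> inv_base(4)[OF p]])
    note w = inv_total[OF fiberD(1)[OF v]]
    have pw: "proj E (\<nu>' (\<psi> (\<nu>F p))) \<in> pts F"
      by (rule smooth_map_in_pts[OF vector_bundleD(3)[OF E] w(1)])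
    \<comment> \<open>\<open>vb_automorphism\<close> says how \<open>\<nu>\<close> projects, not how
      its inverse does; the latter follows by applying \<open>\<nu>F\<close> and cancelling
      it.\<close>
    have "\<nu>F (proj E (\<nu>' (\<psi> (\<nu>F p)))) = \<nu>F p"
      using vb_automorphismD(3)[OF w(1)] w(2) fiberD(2)[OF v] by simp
    then have "proj E (\<nu>' (\<psi> (\<nu>F p))) = p"
      using inv_base(3)[OF pw] inv_base(3)[OF p] by metis
    then show ?thesis
      using p by simp
  qed
  ultimately show ?thesis
    by (simp add: sections_def)
qed

lemma push_section_bij: "bij_betw (push_section E \<nu> \<nu>F) (sections E) (sections E)"
proof (rule bij_betw_byWitness[where f' = "\<lambda>\<psi>. \<lambda>p\<in>pts F. \<nu>' (\<psi> (\<nu>F p))"])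
  show "\<forall>\<psi>\<in>sections E. (\<lambda>p\<in>pts F. \<nu>' (push_section E \<nu> \<nu>F \<psi> (\<nu>F p))) = \<psi>"
  proof
    fix \<psi> assume \<psi>: "\<psi> \<in> sections E"
    show "(\<lambda>p\<in>pts F. \<nu>' (push_section E \<nu> \<nu>F \<psi> (\<nu>F p))) = \<psi>"
      by (rule extensionalityI[of _ "pts F"])
        (auto simp: sectionsD(1)[OF \<psi>] push_section_apply[OF \<psi>] inv_base inv_total fiberD(1)[OF sectionsD(3)[OF \<psi>]])
  qed
  show "\<forall>\<psi>\<in>sections E. push_section E \<nu> \<nu>F (\<lambda>p\<in>pts F. \<nu>' (\<psi> (\<nu>F p))) = \<psi>"
  proof
    fix \<psi> assume \<psi>: "\<psi> \<in> sections E"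
    note \<eta> = pull_section_in_sections[OF \<psi>]
    show "push_section E \<nu> \<nu>F (\<lambda>p\<in>pts F. \<nu>' (\<psi> (\<nu>F p))) = \<psi>"
      by (rule extensionalityI[of _ "pts F"])
        (auto simp: sectionsD(1)[OF \<psi>] sectionsD(1)[OF push_section_in_sections[OF \<eta>]]
          push_section_apply[OF \<eta>] inv_base inv_total fiberD(1)[OF sectionsD(3)[OF \<psi>]])
  qed
qed (use push_section_in_sections pull_section_in_sections in auto)

text \<open>This is the companion \<open>\<theta>\<close> of the push-forward: functions are
  transported by the same diffeomorphism of the base as sections.\<close>

lemma fun_linear_iso_push: "fun_linear_iso F (\<lambda>f. \<lambda>p\<in>pts F. f (\<nu>F' p))"
proof -
  note B = vector_bundleD(2)[OF E]
  have comp: "(\<lambda>p\<in>pts F. f (g p)) \<in> smooth_functions F"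
    if "f \<in> smooth_functions F" "smooth_map F F g" for f g
  proof -
    have "smooth_map F real_line f"
      using that(1) by (simp add: smooth_functions_def)
    then have "smooth_map F real_line (\<lambda>p. f (g p))"
      by (rule smooth_map_compose[OF B B smooth_atlas_real_line that(2)])
    then have "smooth_map F real_line (\<lambda>p\<in>pts F. f (g p))"
      by (rule smooth_map_cong[OF B smooth_atlas_real_line]) simp
    then show ?thesis
      by (simp add: smooth_functions_def)
  qed
  have "bij_betw (\<lambda>f. \<lambda>p\<in>pts F. f (\<nu>F' p)) (smooth_functions F) (smooth_functions F)"
  proof (rule bij_betw_byWitness[where f' = "\<lambda>f. \<lambda>p\<in>pts F. f (\<nu>F p)"])
    show "(\<lambda>f. \<lambda>p\<in>pts F. f (\<nu>F' p)) ` smooth_functions F \<subseteq> smooth_functions F"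
      using comp[OF _ diffeoD(3)[OF vb_automorphismD(2)]] by blast
    show "(\<lambda>f. \<lambda>p\<in>pts F. f (\<nu>F p)) ` smooth_functions F \<subseteq> smooth_functions F"
      using comp[OF _ diffeoD(2)[OF vb_automorphismD(2)]] by blast
  qed (auto simp: inv_base smooth_functions_def intro!: extensionalityI[of _ "pts F"])
  then show ?thesis
    by (auto simp: fun_linear_iso_def inv_base)
qed

lemma push_section_semilinear: "push_section E \<nu> \<nu>F \<in> semilinear_isos E"
proof -
  note B = vector_bundleD(2)[OF E]
  \<comment> \<open>Stated for any \<open>f\<close> with smooth germs, extensional or not, so that
    it yields both the constants and the elements of \<open>smooth_functions\<close>.\<close>
  have mult: "push_section E \<nu> \<nu>F (sec_mult E f \<psi>) = sec_mult E (\<lambda>p. f (\<nu>F' p)) (push_section E \<nu> \<nu>F \<psi>)"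
    if \<psi>: "\<psi> \<in> sections E" and f: "\<And>p. p \<in> pts F \<Longrightarrow> smooth_at F f p" for f \<psi>
  proof (rule extensionalityI[of _ "pts F"])
    note m = sec_mult_sections[OF E \<psi> f]
    show "push_section E \<nu> \<nu>F (sec_mult E f \<psi>) \<in> extensional (pts F)"
      by (rule sectionsD(1)[OF push_section_in_sections[OF m]])
    show "push_section E \<nu> \<nu>F (sec_mult E f \<psi>) p = sec_mult E (\<lambda>p. f (\<nu>F' p)) (push_section E \<nu> \<nu>F \<psi>) p"
      if p: "p \<in> pts F" for p
    proof -
      have "push_section E \<nu> \<nu>F (sec_mult E f \<psi>) p = \<nu> (vscale E (f (\<nu>F' p)) (\<psi> (\<nu>F' p)))"
        using push_section_apply[OF m p] inv_base(1)[OF p] by (simp add: sec_mult_def)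
      also have "\<dots> = vscale E (f (\<nu>F' p)) (\<nu> (\<psi> (\<nu>F' p)))"
        using vb_automorphismD(4)[OF inv_base(1)[OF p]] sectionsD(3)[OF \<psi> inv_base(1)[OF p]]
        by (simp add: linear_iso_def)
      finally show ?thesis
        using p by (simp add: sec_mult_def push_section_apply[OF \<psi>])
    qed
  qed (simp add: sec_mult_def)
  have const: "push_section E \<nu> \<nu>F (sec_mult E (\<lambda>_. c) \<psi>) = sec_mult E (\<lambda>_. c) (push_section E \<nu> \<nu>F \<psi>)"
    if "\<psi> \<in> sections E" for \<psi> c
    using mult[OF that, of "\<lambda>_. c"] smooth_at_const[OF B] by simp
  have fmult: "push_section E \<nu> \<nu>F (sec_mult E f \<psi>)
      = sec_mult E (\<lambda>p\<in>pts F. f (\<nu>F' p)) (push_section E \<nu> \<nu>F \<psi>)"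
    if "\<psi> \<in> sections E" "f \<in> smooth_functions F" for f \<psi>
  proof -
    have "smooth_at F f p" if "p \<in> pts F" for p
      using \<open>f \<in> smooth_functions F\<close> that by (simp add: smooth_functions_def smooth_map_real_line[OF B])
    from mult[OF that(1) this] show ?thesis
      by (simp add: sec_mult_def cong: restrict_cong)
  qed
  have add: "push_section E \<nu> \<nu>F (sec_add E \<psi> \<eta>)
      = sec_add E (push_section E \<nu> \<nu>F \<psi>) (push_section E \<nu> \<nu>F \<eta>)"
    if \<psi>: "\<psi> \<in> sections E" and \<eta>: "\<eta> \<in> sections E" for \<psi> \<eta>
  proof (rule extensionalityI[of _ "pts F"])
    note a = sec_add_sections[OF E \<psi> \<eta>]
    show "push_section E \<nu> \<nu>F (sec_add E \<psi> \<eta>) \<in> extensional (pts F)"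
      by (rule sectionsD(1)[OF push_section_in_sections[OF a]])
    show "push_section E \<nu> \<nu>F (sec_add E \<psi> \<eta>) p
        = sec_add E (push_section E \<nu> \<nu>F \<psi>) (push_section E \<nu> \<nu>F \<eta>) p" if p: "p \<in> pts F" for p
    proof -
      have "push_section E \<nu> \<nu>F (sec_add E \<psi> \<eta>) p = \<nu> (vadd E (\<psi> (\<nu>F' p)) (\<eta> (\<nu>F' p)))"
        using push_section_apply[OF a p] inv_base(1)[OF p] by (simp add: sec_add_def)
      also have "\<dots> = vadd E (\<nu> (\<psi> (\<nu>F' p))) (\<nu> (\<eta> (\<nu>F' p)))"
        using vb_automorphismD(4)[OF inv_base(1)[OF p]] sectionsD(3)[OF \<psi> inv_base(1)[OF p]]
          sectionsD(3)[OF \<eta> inv_base(1)[OF p]]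
        by (simp add: linear_iso_def)
      finally show ?thesis
        using p by (simp add: sec_add_def push_section_apply[OF \<psi>] push_section_apply[OF \<eta>])
    qed
  qed (simp add: sec_add_def)
  have "push_section E \<nu> \<nu>F \<in> extensional (sections E)"
    by (simp add: push_section_def)
  moreover have "\<exists>\<theta>. fun_linear_iso F \<theta> \<and> (\<forall>f\<in>smooth_functions F. \<forall>\<psi>\<in>sections E.
      push_section E \<nu> \<nu>F (sec_mult E f \<psi>) = sec_mult E (\<theta> f) (push_section E \<nu> \<nu>F \<psi>))"
    using fun_linear_iso_push fmult by (intro exI[of _ "\<lambda>f. \<lambda>p\<in>pts F. f (\<nu>F' p)"]) auto
  ultimately show ?thesis
    using push_section_bij add const by (simp add: semilinear_isos_def)
qed

end

section \<open>Matrix coordinates of fiber isomorphisms\<close>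

text \<open>Induction on the number \<open>m\<close> of coordinates that may be nonzero, splitting
  off the last one. The space \<open>Rset r\<close> on which \<open>L\<close> is linear stays
  fixed.\<close>

lemma linear_functional_Rset:
  assumes add: "\<And>z w. z \<in> Rset r \<Longrightarrow> w \<in> Rset r \<Longrightarrow> L (\<lambda>i. z i + w i) = L z + L w"
    and scale: "\<And>z c. z \<in> Rset r \<Longrightarrow> L (\<lambda>i. c * z i) = c * L z"
    and "m \<le> r" "z \<in> Rset m"
  shows "(L z :: real) = (\<Sum>j<m. L (\<lambda>i. if i = j then 1 else 0) * z j)"
  using assms(3,4)
proof (induction m arbitrary: z)
  case 0
  then have "z = (\<lambda>i. 0)"
    by (auto simp: Rset_iff)
  moreover have "L (\<lambda>i. 0) = 0"
    using scale[of "\<lambda>i. 0" 0] by (simp add: Rset_iff)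
  ultimately show ?case
    by simp
next
  case (Suc m)
  let ?d = "\<lambda>i. if i = m then 1 else 0 :: real"
  have zm: "z(m := 0) \<in> Rset m"
    using Suc.prems(2) by (auto simp: Rset_iff Suc_le_eq)
  have "Rset m \<subseteq> Rset r"
    using Suc.prems(1) by simp
  then have "z(m := 0) \<in> Rset r"
    using zm by blast
  moreover have "?d \<in> Rset r" "(\<lambda>i. z m * ?d i) \<in> Rset r"
    using Suc.prems(1) by (auto simp: Rset_iff)
  moreover have "z = (\<lambda>i. (z(m := 0)) i + z m * ?d i)"
    by auto
  ultimately have "L z = L (z(m := 0)) + z m * L ?d"
    using add scale by metis
  also have "L (z(m := 0)) = (\<Sum>j<m. L (\<lambda>i. if i = j then 1 else 0) * (z(m := 0)) j)"
    by (rule Suc.IH[OF _ zm]) (use Suc.prems(1) in simp)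
  also have "\<dots> = (\<Sum>j<m. L (\<lambda>i. if i = j then 1 else 0) * z j)"
    by (intro sum.cong) auto
  finally show ?case
    by simp
qed

text \<open>For fixed \<open>i\<close>, the \<open>i\<close>-th component of \<open>A\<close> read
  in the two frames is a linear functional of the coordinates \<open>t v\<close>. Its values on the
  standard basis are the \<open>i\<close>-th row of the matrix.\<close>

lemma triv_matrix_coords:
  assumes t: "local_triv E (r, V, t)" "p \<in> V" and t': "local_triv E (r, V', t')" "p' \<in> V'"
    and A: "linear_iso E p p' A" and v: "v \<in> fiber E p" and i: "i < r"
  shows "t' (A v) i = (\<Sum>j<r. matrix_coords E r t t' (p, A, p') (i * r + j) * t v j)"
proof -
  define s where "s = inv_into (fiber E p) t"
  define L where "L z = t' (A (s z)) i" for z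
  note b = triv_fiber_bij[OF t]
  have inj: "inj_on t (fiber E p)" and surj: "t ` fiber E p = Rset r"
    using b by (auto simp: bij_betw_def)
  have s: "s z \<in> fiber E p" "t (s z) = z" if "z \<in> Rset r" for z
    using that inv_into_into[of z t "fiber E p"] f_inv_into_f[of z t "fiber E p"] by (simp_all add: s_def surj)
  have st: "s (t w) = w" if "w \<in> fiber E p" for w
    using inj that by (simp add: s_def)
  have Afib: "A w \<in> fiber E p'" if "w \<in> fiber E p" for w
    using A that by (auto simp: linear_iso_def bij_betw_def)
  have add: "L (\<lambda>i. z i + w i) = L z + L w" if z: "z \<in> Rset r" and w: "w \<in> Rset r" for z w
  proof -
    note a = vadd_triv[OF t s(1)[OF z] s(1)[OF w]]
    have "s (\<lambda>i. z i + w i) = vadd E (s z) (s w)"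
      using st[OF a(1)] a(2) s(2)[OF z] s(2)[OF w] by simp
    moreover have "A (vadd E (s z) (s w)) = vadd E (A (s z)) (A (s w))"
      using A s(1)[OF z] s(1)[OF w] by (simp add: linear_iso_def)
    ultimately show ?thesis
      using vadd_triv(2)[OF t' Afib[OF s(1)[OF z]] Afib[OF s(1)[OF w]]] by (simp add: L_def)
  qed
  have scale: "L (\<lambda>i. c * z i) = c * L z" if z: "z \<in> Rset r" for z c
  proof -
    note a = vscale_triv[OF t s(1)[OF z], of c]
    have "s (\<lambda>i. c * z i) = vscale E c (s z)"
      using st[OF a(1)] a(2) s(2)[OF z] by simp
    moreover have "A (vscale E c (s z)) = vscale E c (A (s z))"
      using A s(1)[OF z] by (simp add: linear_iso_def)
    ultimately show ?thesis
      using vscale_triv(2)[OF t' Afib[OF s(1)[OF z]]] by (simp add: L_def)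
  qed
  have "t v \<in> Rset r"
    using v surj by blast
  then have "L (t v) = (\<Sum>j<r. L (\<lambda>i. if i = j then 1 else 0) * t v j)"
    by (intro linear_functional_Rset[OF add scale order_refl])
  moreover have "L (\<lambda>i. if i = j then 1 else 0) = matrix_coords E r t t' (p, A, p') (i * r + j)"
    if j: "j < r" for j
  proof -
    \<comment> \<open>The index must fall into the first branch of \<open>matrix_coords\<close>; its
      quotient and remainder by \<open>r\<close> are then \<open>i\<close> and
      \<open>j\<close>.\<close>
    have "i * r + j < Suc i * r"
      using j by simp
    also have "Suc i * r \<le> r * r"
      using i by (intro mult_le_mono1) simp
    finally show ?thesis
      using j by (simp add: matrix_coords_def L_def s_def)
  qed
  ultimately show ?thesis
    by (simp add: L_def st[OF v])
qed

section \<open>The action of a smooth section of the source map\<close>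

definition base_map :: "('f \<Rightarrow> 'm) \<Rightarrow> ('g \<Rightarrow> 'f \<Rightarrow> 'f) \<Rightarrow> ('m \<Rightarrow> 'g) \<Rightarrow> 'f \<Rightarrow> 'f" where
  "base_map \<phi> S b p = S (b (\<phi> p)) p"

text \<open>\<open>fst (snd _)\<close> extracts the isomorphism from the triple that represents an
  element of \<open>Phi E\<close>.\<close>

definition total_map ::
    "('e, 'f) vbundle \<Rightarrow> ('f \<Rightarrow> 'm) \<Rightarrow> ('g \<times> 'f \<Rightarrow> ('e, 'f) fiber_iso) \<Rightarrow> ('m \<Rightarrow> 'g) \<Rightarrow> 'e \<Rightarrow> 'e" where
  "total_map E \<phi> \<rho> b v = fst (snd (\<rho> (b (\<phi> (proj E v)), proj E v))) v"

lemma prod_mfld_chart: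
  assumes "(n, U, x) \<in> atlas X" "(m, V, y) \<in> atlas Y"
  shows "(n + m, U \<times> V, \<lambda>(p, q). cat n (x p) (y q)) \<in> atlas (prod_mfld X Y)"
  using assms by (simp add: prod_mfld_def del: prod.inject) blast

lemma diffeoI:
  assumes X: "manifold X" "manifold Y" and f: "smooth_map X Y f" and g: "smooth_map Y X g"
    and gf: "\<And>p. p \<in> pts X \<Longrightarrow> g (f p) = p" and fg: "\<And>q. q \<in> pts Y \<Longrightarrow> f (g q) = q"
  shows "diffeo X Y f"
proof -
  have b: "bij_betw f (pts X) (pts Y)"
    by (rule bij_betw_byWitness[where f' = g])
      (use gf fg smooth_map_in_pts[OF f] smooth_map_in_pts[OF g] in auto)
  have "smooth_map Y X (inv_into (pts X) f)"
  proof (rule smooth_map_cong[OF X(2) manifold_smooth_atlas[OF X(1)] g])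
    show "g q = inv_into (pts X) f q" if "q \<in> pts Y" for q
      using inv_into_f_eq[OF bij_betw_imp_inj_on[OF b] smooth_map_in_pts[OF g that] fg[OF that]] by simp
  qed
  then show ?thesis
    using b f by (simp add: diffeo_def)
qed

lemma pts_Phi: "pts (arrows (Phi E)) \<subseteq> fiber_isos E"
  by (auto simp: Phi_def Phi_mfld_def topology_generated_by_topspace Phi_atlas_def)

lemma Phi_atlasD:
  assumes "(N, D, \<kappa>) \<in> atlas (arrows (Phi E))"
  obtains n U x n' U' x' r V t V' t' where
    "(n, U, x) \<in> atlas (vbase E)" "(n', U', x') \<in> atlas (vbase E)"
    "local_triv E (r, V, t)" "local_triv E (r, V', t')"
    "N = n + (r * r + n')" "D = {(p, A, p') \<in> fiber_isos E. p \<in> U \<inter> V \<and> p' \<in> U' \<inter> V'}"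
    "\<kappa> = (\<lambda>(p, A, p'). cat n (x p) (cat (r * r) (matrix_coords E r t t' (p, A, p')) (x' p')))"
  using assms unfolding Phi_def Phi_mfld_def Phi_atlas_def
  by (simp del: local_triv.simps) (elim exE conjE, blast)

text \<open>A chart domain is the generator of the topology that belongs to
  \<open>Q = Rset N\<close>. For this the chart must take values in \<open>Rset N\<close>, which
  holds because its last block \<open>x' p'\<close> vanishes from \<open>n'\<close> on.\<close>

lemma Phi_atlas_open:
  assumes E: "vector_bundle E" and c: "c \<in> atlas (arrows (Phi E))"
  shows "openin (mtop (arrows (Phi E))) (fst (snd c))"
proof -
  obtain N D \<kappa> where c_eq: "c = (N, D, \<kappa>)"
    by (cases c)
  obtain n U x n' U' x' r V t V' t' where *:
    "(n, U, x) \<in> atlas (vbase E)" "(n', U', x') \<in> atlas (vbase E)"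
    "local_triv E (r, V, t)" "local_triv E (r, V', t')"
    "N = n + (r * r + n')" "D = {(p, A, p') \<in> fiber_isos E. p \<in> U \<inter> V \<and> p' \<in> U' \<inter> V'}"
    "\<kappa> = (\<lambda>(p, A, p'). cat n (x p) (cat (r * r) (matrix_coords E r t t' (p, A, p')) (x' p')))"
    using Phi_atlasD[OF c[unfolded c_eq]] .
  have "\<kappa> z \<in> Rset N" if "z \<in> D" for z
  proof -
    obtain p A p' where z: "z = (p, A, p')" "p' \<in> U'"
      using \<open>z \<in> D\<close> *(6) by (cases z) auto
    have "x' p' \<in> Rset n'"
      by (rule open_chart_in_Rset[OF manifold_open_chart[OF vector_bundleD(2)[OF E] *(2)] z(2)])
    then show ?thesis
      by (auto simp: z(1) *(5,7) Rset_iff cat_def)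
  qed
  then have D: "D = D \<inter> \<kappa> -` Rset N"
    by auto
  have "D \<in> {D \<inter> \<kappa> -` Q | N D \<kappa> Q. (N, D, \<kappa>) \<in> Phi_atlas E \<and> openin (Euclidean_space N) Q}"
  proof (intro CollectI exI conjI)
    show "(N, D, \<kappa>) \<in> Phi_atlas E"
      using c by (simp add: c_eq Phi_def Phi_mfld_def)
  qed (rule D, rule openin_topspace)
  then show ?thesis
    by (simp add: c_eq Phi_def Phi_mfld_def topology_generated_by_Basis)
qed

text \<open>The part of being a bisection on which smoothness and multiplicativity of the induced
  maps depend. The pointwise inverse of a bisection fits it as it stands, without restriction to an
  extensional function.\<close>

definition source_section :: "('g, 'm) groupoid \<Rightarrow> ('m \<Rightarrow> 'g) \<Rightarrow> bool" where
  "source_section G b \<longleftrightarrow>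
     smooth_map (gbase G) (arrows G) b \<and> (\<forall>m\<in>pts (gbase G). gsrc G (b m) = m)"

lemma bisection_source_section: "b \<in> bisections G \<Longrightarrow> source_section G b"
  by (simp add: bisections_def source_section_def)

section \<open>The maps of \<open>F\<close> and \<open>E\<close> induced by a source section\<close>

locale action_groupoid_rep =
  fixes G :: "('g, 'm) groupoid" and F :: "'f mfld" and \<phi> :: "'f \<Rightarrow> 'm"
    and S :: "'g \<Rightarrow> 'f \<Rightarrow> 'f" and E :: "('e, 'f) vbundle"
    and \<rho> :: "'g \<times> 'f \<Rightarrow> ('e, 'f) fiber_iso"
  assumes G: "lie_groupoid G"
    and F: "fibered_manifold F (gbase G) \<phi>"
    and S: "groupoid_action G F \<phi> S"
    and E: "vector_bundle E" and EF: "vbase E = F"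
    and rep: "groupoid_rep (action_groupoid G F \<phi> S) E \<rho>"
begin

abbreviation (input) "M \<equiv> gbase G"
abbreviation (input) "P \<equiv> pullback_arrows G F \<phi>"
abbreviation (input) "H \<equiv> action_groupoid G F \<phi> S"

lemma manifolds: "manifold (arrows G)" "manifold M" "manifold F"
  using G F by (auto simp: lie_groupoid_def fibered_manifold_def)

lemma groupoid_maps:
  "smooth_map (arrows G) M (gsrc G)" "smooth_map (arrows G) M (gtgt G)"
  "smooth_map (arrows G) (arrows G) (ginv G)" "smooth_map M (arrows G) (gunit G)" "smooth_map F M \<phi>"
  using G F by (auto simp: lie_groupoid_def submersion_def fibered_manifold_def)

lemma laws: "groupoid_laws G"
  using G by (simp add: lie_groupoid_def)

lemma \<phi>_in: "p \<in> pts F \<Longrightarrow> \<phi> p \<in> pts M"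
  by (rule smooth_map_in_pts[OF groupoid_maps(5)])

lemma proj_in: "v \<in> pts (total E) \<Longrightarrow> proj E v \<in> pts F"
  using smooth_map_in_pts[OF vector_bundleD(3)[OF E]] EF by simp

lemma source_sectionD:
  assumes "source_section G b"
  shows "smooth_map M (arrows G) b" "\<And>m. m \<in> pts M \<Longrightarrow> gsrc G (b m) = m"
    "\<And>m. m \<in> pts M \<Longrightarrow> b m \<in> pts (arrows G)"
    "\<And>m. m \<in> pts M \<Longrightarrow> gtgt G (b m) \<in> pts M"
  using assms smooth_map_in_pts[OF groupoid_maps(2)]
  by (auto simp: source_section_def dest: smooth_map_in_pts)

lemma pts_pullback: "pts P = {(g, p). g \<in> pts (arrows G) \<and> p \<in> pts F \<and> gsrc G g = \<phi> p}"
  by (auto simp: pullback_arrows_def submfld_def prod_mfld_def)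

lemma \<rho>_smooth: "smooth_map P (arrows (Phi E)) \<rho>"
proof -
  have "smooth_map (arrows H) (arrows (Phi E)) \<rho>"
    using rep unfolding groupoid_rep_def base_preserving_morphism_def by blast
  then show ?thesis
    by (simp add: action_groupoid_def)
qed

text \<open>A base-preserving morphism keeps sources and targets, and those of \<open>(g, p)\<close>
  are \<open>p\<close> and \<open>S g p\<close>. Being associated to \<open>S\<close> comes from
  here.\<close>

lemma \<rho>_value:
  assumes "(g, p) \<in> pts P"
  obtains A where "\<rho> (g, p) = (p, A, S g p)" "linear_iso E p (S g p) A" "S g p \<in> pts F"
proof -
  obtain q A q' where eq: "\<rho> (g, p) = (q, A, q')"
    by (cases "\<rho> (g, p)")
  have "gsrc (Phi E) (\<rho> (g, p)) = p" "gtgt (Phi E) (\<rho> (g, p)) = S g p"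
    using rep assms by (auto simp: groupoid_rep_def base_preserving_morphism_def action_groupoid_def)
  then have "q = p" "q' = S g p"
    by (simp_all add: eq Phi_def)
  moreover have "\<rho> (g, p) \<in> fiber_isos E"
    using smooth_map_in_pts[OF \<rho>_smooth assms] pts_Phi by blast
  ultimately show ?thesis
    using that eq EF by (auto simp: fiber_isos_def)
qed

lemma S_fiber:
  assumes "(g, p) \<in> pts P"
  shows "\<phi> (S g p) = gtgt G g"
proof -
  have "p \<in> fib F \<phi> (gsrc G g)" "bij_betw (S g) (fib F \<phi> (gsrc G g)) (fib F \<phi> (gtgt G g))"
    using assms S by (auto simp: pts_pullback fib_def groupoid_action_def)
  then have "S g p \<in> fib F \<phi> (gtgt G g)"
    by (rule bij_betwE[rule_format, rotated])
  then show ?thesis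
    by (simp add: fib_def)
qed

text \<open>In the action groupoid \<open>(g2, S g1 p)\<close> and \<open>(g1, p)\<close> are
  composable with product \<open>(gmul G g2 g1, p)\<close>; the morphism property is applied to this
  pair.\<close>

lemma \<rho>_mult:
  assumes p: "(g1, p) \<in> pts P" and g: "(g2, g1) \<in> composable G"
  shows "S (gmul G g2 g1) p = S g2 (S g1 p)"
    and "\<And>v. v \<in> fiber E p \<Longrightarrow>
      fst (snd (\<rho> (gmul G g2 g1, p))) v = fst (snd (\<rho> (g2, S g1 p))) (fst (snd (\<rho> (g1, p))) v)"
proof -
  have "p \<in> fib F \<phi> (gsrc G g1)"
    using p by (simp add: pts_pullback fib_def)
  then show "S (gmul G g2 g1) p = S g2 (S g1 p)"
    using S g unfolding groupoid_action_def by blast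
  obtain A1 where A1: "\<rho> (g1, p) = (p, A1, S g1 p)" "S g1 p \<in> pts F"
    using \<rho>_value[OF p] by metis
  have p2: "(g2, S g1 p) \<in> pts P"
    using g S_fiber[OF p] A1(2) by (auto simp: pts_pullback composable_def)
  obtain A2 where A2: "\<rho> (g2, S g1 p) = (S g1 p, A2, S g2 (S g1 p))"
    using \<rho>_value[OF p2] by metis
  have "((g2, S g1 p), (g1, p)) \<in> composable H"
    using p p2 by (simp add: composable_def action_groupoid_def)
  then have "\<rho> (gmul H (g2, S g1 p) (g1, p)) = gmul (Phi E) (\<rho> (g2, S g1 p)) (\<rho> (g1, p))"
    using rep unfolding groupoid_rep_def base_preserving_morphism_def by blast
  then have "\<rho> (gmul G g2 g1, p) = (p, compose (fiber E p) A2 A1, S g2 (S g1 p))"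
    by (simp add: action_groupoid_def Phi_def A1 A2)
  then show "fst (snd (\<rho> (gmul G g2 g1, p))) v = fst (snd (\<rho> (g2, S g1 p))) (fst (snd (\<rho> (g1, p))) v)"
    if "v \<in> fiber E p" for v
    using that by (simp add: A1 A2 compose_def)
qed

text \<open>\<open>groupoid_action\<close> does not list a unit law. Here it is read off from
  \<open>\<rho>\<close>: the value at the unit is the identity of the fiber over \<open>p\<close>,
  so its target \<open>S (gunit G (\<phi> p)) p\<close> is \<open>p\<close>.\<close>

lemma \<rho>_unit:
  assumes p: "p \<in> pts F"
  shows "S (gunit G (\<phi> p)) p = p"
    and "\<And>v. v \<in> fiber E p \<Longrightarrow> fst (snd (\<rho> (gunit G (\<phi> p), p))) v = v"
proof -
  have "\<rho> (gunit H p) = gunit (Phi E) p"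
    using rep p by (simp add: groupoid_rep_def base_preserving_morphism_def action_groupoid_def)
  then have eq: "\<rho> (gunit G (\<phi> p), p) = (p, \<lambda>v\<in>fiber E p. v, p)"
    by (simp add: action_groupoid_def Phi_def)
  have "gsrc G (gunit G (\<phi> p)) = \<phi> p"
    using laws \<phi>_in[OF p] by (simp add: groupoid_laws_def)
  then have "(gunit G (\<phi> p), p) \<in> pts P"
    using p smooth_map_in_pts[OF groupoid_maps(4) \<phi>_in[OF p]] by (simp add: pts_pullback)
  then obtain A where "\<rho> (gunit G (\<phi> p), p) = (p, A, S (gunit G (\<phi> p)) p)"
    using \<rho>_value by metis
  with eq show "S (gunit G (\<phi> p)) p = p"
    by simp
  show "fst (snd (\<rho> (gunit G (\<phi> p), p))) v = v" if "v \<in> fiber E p" for v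
    using that by (simp add: eq)
qed

lemma graph_in_pullback:
  "source_section G b \<Longrightarrow> p \<in> pts F \<Longrightarrow> (b (\<phi> p), p) \<in> pts P"
  by (simp add: pts_pullback source_sectionD \<phi>_in)

lemma \<phi>_base_map: "source_section G b \<Longrightarrow> p \<in> pts F \<Longrightarrow> \<phi> (base_map \<phi> S b p) = gtgt G (b (\<phi> p))"
  unfolding base_map_def by (rule S_fiber[OF graph_in_pullback])

lemma total_map_linear_iso:
  assumes b: "source_section G b" and p: "p \<in> pts F"
  shows "linear_iso E p (base_map \<phi> S b p) (total_map E \<phi> \<rho> b)"
proof -
  obtain A where A: "\<rho> (b (\<phi> p), p) = (p, A, S (b (\<phi> p)) p)" "linear_iso E p (S (b (\<phi> p)) p) A"
    using \<rho>_value[OF graph_in_pullback[OF b p]] by metis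
  have eq: "total_map E \<phi> \<rho> b v = A v" if "v \<in> fiber E p" for v
    using fiberD(2)[OF that] A(1) by (simp add: total_map_def)
  have "vadd E v w \<in> fiber E p" "vscale E c v \<in> fiber E p" if "v \<in> fiber E p" "w \<in> fiber E p" for v w c
    using that p vadd_fiber[OF E] vscale_fiber[OF E] EF by auto
  then show ?thesis
    using A(2) eq unfolding linear_iso_def base_map_def
    by (simp cong: bij_betw_cong)
qed

lemma total_map_fiber:
  assumes "source_section G b" "p \<in> pts F" "v \<in> fiber E p"
  shows "total_map E \<phi> \<rho> b v \<in> fiber E (base_map \<phi> S b p)"
  using total_map_linear_iso[OF assms(1,2)] assms(3) by (auto simp: linear_iso_def bij_betw_def)

lemma pts_total_fiber: "v \<in> pts (total E) \<Longrightarrow> v \<in> fiber E (proj E v)"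
  by (simp add: fiber_def)

lemma total_map_in:
  assumes "source_section G b" "v \<in> pts (total E)"
  shows "total_map E \<phi> \<rho> b v \<in> pts (total E)"
    and "proj E (total_map E \<phi> \<rho> b v) = base_map \<phi> S b (proj E v)"
  using total_map_fiber[OF assms(1) proj_in[OF assms(2)] pts_total_fiber[OF assms(2)]]
  by (auto simp: fiber_def)

section \<open>Smoothness of the induced maps\<close>

lemma graph_continuous:
  assumes b: "source_section G b"
  shows "continuous_map (mtop F) (mtop P) (\<lambda>p. (b (\<phi> p), p))"
proof -
  have "continuous_map (mtop F) (mtop (arrows G)) (\<lambda>p. b (\<phi> p))"
    using continuous_map_compose[OF smooth_map_continuous[OF groupoid_maps(5)]
        smooth_map_continuous[OF source_sectionD(1)[OF b]]] by (simp add: comp_def)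
  moreover have "continuous_map (mtop F) (mtop F) (\<lambda>p. p)"
    using continuous_map_id[of "mtop F"] by (simp add: id_def)
  ultimately have "continuous_map (mtop F) (prod_topology (mtop (arrows G)) (mtop F)) (\<lambda>p. (b (\<phi> p), p))"
    by (simp add: continuous_map_pairwise comp_def)
  then show ?thesis
    unfolding pullback_arrows_def submfld_def prod_mfld_def
    by simp (rule continuous_map_into_subtopology, assumption,
        use graph_in_pullback[OF b] in \<open>auto simp: pts_pullback\<close>)
qed

text \<open>The implicit function theorem is not needed here: charts of the pullback around the graph exist
  because the action and the representation are smooth on it, and any such chart is a slice chart.\<close>

lemma graph_coordinates:
  assumes b: "source_section G b" and p: "p \<in> pts F"
    and c: "(k, V, y) \<in> atlas P" "(b (\<phi> p), p) \<in> V" and j: "j < k"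
  shows "smooth_at F (\<lambda>q. y (b (\<phi> q), q) j) p"
proof -
  let ?X = "prod_mfld (arrows G) F" and ?\<sigma> = "\<lambda>q. (b (\<phi> q), q)"
  note M = manifolds
  obtain n U where y: "(n, U, y) \<in> max_atlas ?X" "k \<le> n" "?\<sigma> p \<in> U"
    using submfld_atlasD[OF c(1)[unfolded pullback_arrows_def]] c(2) by blast
  have bp: "b (\<phi> p) \<in> pts (arrows G)"
    by (rule source_sectionD(3)[OF b \<phi>_in[OF p]])
  have bs: "smooth_map F (arrows G) (\<lambda>p. b (\<phi> p))"
    by (rule smooth_map_compose[OF M(3,2) manifold_smooth_atlas[OF M(1)] groupoid_maps(5) source_sectionD(1)[OF b]])
  obtain n1 U1 x1 where x1: "(n1, U1, x1) \<in> atlas (arrows G)" "b (\<phi> p) \<in> U1"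
    using manifold_chart[OF M(1) bp] by blast
  obtain n2 U2 x2 where x2: "(n2, U2, x2) \<in> atlas F" "p \<in> U2"
    using manifold_chart[OF M(3) p] by blast
  \<comment> \<open>In a product chart the coordinates of the graph are those of
    \<open>b (\<phi> q)\<close> followed by those of \<open>q\<close>, all smooth. Compatibility
    carries this over to \<open>y\<close>.\<close>
  let ?x = "\<lambda>(g, q). cat n1 (x1 g) (x2 q)"
  have d: "(n1 + n2, U1 \<times> U2, ?x) \<in> atlas ?X"
    by (rule prod_mfld_chart[OF x1(1) x2(1)])
  have "smooth_at F (\<lambda>q. ?x (?\<sigma> q) i) p" if "i < n1 + n2" for i
  proof (cases "i < n1")
    case True
    then show ?thesis
      using smooth_map_coordinates[OF M(3,1) bs p manifold_max_atlas[OF M(1) x1(1)] x1(2) True]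
      by (simp add: cat_less)
  next
    case False
    then have "i - n1 < n2"
      using that by simp
    then show ?thesis
      using smooth_at_chart_coordinate[OF M(3) manifold_max_atlas[OF M(3) x2(1)] x2(2)] False
      by (simp add: cat_def)
  qed
  note x_sm = this
  have cont: "continuous_map (subtopology (mtop F) (pts F)) (mtop ?X) ?\<sigma>"
    using graph_continuous[OF b] by (auto simp: pullback_arrows_def submfld_def intro: continuous_map_into_fulltopology)
  show ?thesis
  proof (rule smooth_at_change_chart[OF M(3) _ p cont _ _ _ y(3) compatible_sym[OF max_atlasD(3)[OF y(1) d]] x_sm])
    show "open_chart (mtop ?X) (n1 + n2, U1 \<times> U2, ?x)"
      by (rule prod_mfld_open_chart[OF manifold_open_chart[OF M(1)] manifold_open_chart[OF M(3)] d])
    show "openin (mtop ?X) U"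
      by (rule open_chartD(1)[OF max_atlasD(2)[OF y(1)]])
  qed (use x1 x2 j y(2) in auto)
qed

lemma smooth_graph_compose:
  assumes b: "source_section G b" and p: "p \<in> pts F"
    and g: "smooth_map P Z g" and Z: "\<And>c. c \<in> atlas Z \<Longrightarrow> openin (mtop Z) (fst (snd c))"
  shows "\<exists>m V y. (m, V, y) \<in> atlas Z \<and> g (b (\<phi> p), p) \<in> V \<and>
    (\<forall>j<m. smooth_at F (\<lambda>q. y (g (b (\<phi> q), q)) j) p)"
proof (rule smooth_map_compose_germ[OF manifolds(3) _ p _ _ _ g Z])
  show "continuous_map (subtopology (mtop F) (pts F)) (mtop P) (\<lambda>p. (b (\<phi> p), p))"
    using graph_continuous[OF b] by simp
  show "open_chart (mtop P) c" if "c \<in> atlas P" for c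
    using that unfolding pullback_arrows_def by (rule submfld_open_chart)
qed (use graph_coordinates[OF b p] in auto)

lemma base_map_smooth:
  assumes b: "source_section G b"
  shows "smooth_map F F (base_map \<phi> S b)"
proof (rule smooth_mapI[OF manifolds(3) manifold_smooth_atlas[OF manifolds(3)]])
  have g: "smooth_map P F (\<lambda>(g, p). S g p)"
    using S by (simp add: groupoid_action_def)
  show "continuous_map (mtop F) (mtop F) (base_map \<phi> S b)"
    using continuous_map_compose[OF graph_continuous[OF b] smooth_map_continuous[OF g]]
    by (simp add: comp_def base_map_def[abs_def])
  show "\<exists>m V y. (m, V, y) \<in> atlas F \<and> base_map \<phi> S b p \<in> V \<and>
      (\<forall>j<m. smooth_at F (\<lambda>q. y (base_map \<phi> S b q) j) p)" if "p \<in> pts F" for p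
    using smooth_graph_compose[OF b that g smooth_atlas_open[OF manifold_smooth_atlas[OF manifolds(3)]]]
    by (simp add: base_map_def)
qed

lemma total_map_smooth:
  assumes b: "source_section G b"
  shows "smooth_map (total E) (total E) (total_map E \<phi> \<rho> b)"
proof (rule smooth_map_into_total[OF vector_bundleD(1)[OF E] E])
  note T = vector_bundleD(1)[OF E]
  have pr: "smooth_map (total E) F (proj E)"
    using vector_bundleD(3)[OF E] EF by simp
  have "smooth_map (total E) F (\<lambda>v. base_map \<phi> S b (proj E v))"
    by (rule smooth_map_compose[OF T manifolds(3) manifold_smooth_atlas[OF manifolds(3)] pr base_map_smooth[OF b]])
  then show "smooth_map (total E) (vbase E) (\<lambda>v. proj E (total_map E \<phi> \<rho> b v))"
    unfolding EF by (rule smooth_map_cong[OF T manifold_smooth_atlas[OF manifolds(3)]])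
      (simp add: total_map_in(2)[OF b])
  show "total_map E \<phi> \<rho> b v \<in> pts (total E)" if "v \<in> pts (total E)" for v
    by (rule total_map_in(1)[OF b that])
  fix v0 assume v0: "v0 \<in> pts (total E)"
  define p0 where "p0 = proj E v0"
  let ?\<sigma> = "\<lambda>q. (b (\<phi> q), q)"
  have p0: "p0 \<in> pts F"
    unfolding p0_def by (rule proj_in[OF v0])
  obtain N D \<kappa> where \<kappa>: "(N, D, \<kappa>) \<in> atlas (arrows (Phi E))" "\<rho> (?\<sigma> p0) \<in> D"
    "\<And>j. j < N \<Longrightarrow> smooth_at F (\<lambda>q. \<kappa> (\<rho> (?\<sigma> q)) j) p0"
    using smooth_graph_compose[OF b p0 \<rho>_smooth Phi_atlas_open[OF E]] by blast
  obtain n U x n' U' x' r V t V' t' where *: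
    "(n, U, x) \<in> atlas (vbase E)" "(n', U', x') \<in> atlas (vbase E)"
    "local_triv E (r, V, t)" "local_triv E (r, V', t')"
    "N = n + (r * r + n')" "D = {(p, A, p') \<in> fiber_isos E. p \<in> U \<inter> V \<and> p' \<in> U' \<inter> V'}"
    "\<kappa> = (\<lambda>(p, A, p'). cat n (x p) (cat (r * r) (matrix_coords E r t t' (p, A, p')) (x' p')))"
    using Phi_atlasD[OF \<kappa>(1)] .
  have \<rho>_eq: "\<rho> (?\<sigma> p) = (p, fst (snd (\<rho> (?\<sigma> p))), base_map \<phi> S b p)"
    "linear_iso E p (base_map \<phi> S b p) (fst (snd (\<rho> (?\<sigma> p))))" if "p \<in> pts F" for p
    using \<rho>_value[OF graph_in_pullback[OF b that]] unfolding base_map_def by (metis fst_conv snd_conv)+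
  have V: "p0 \<in> V" "base_map \<phi> S b p0 \<in> V'"
    using \<kappa>(2) \<rho>_eq(1)[OF p0] *(6) by auto
  \<comment> \<open>In a chart of \<open>Phi E\<close> the \<open>r * r\<close> matrix entries
    follow the \<open>n\<close> coordinates of the source point.\<close>
  have mat: "smooth_at F (\<lambda>q. matrix_coords E r t t' (\<rho> (?\<sigma> q)) k) p0" if k: "k < r * r" for k
  proof -
    have "\<kappa> z (n + k) = matrix_coords E r t t' z k" for z
      using k by (cases z) (simp add: *(7) cat_plus cat_less)
    then show ?thesis
      using \<kappa>(3)[of "n + k"] k *(5) by simp
  qed
  \<comment> \<open>The open set on which one pair of trivializations describes both
    \<open>v\<close> and its image, so that the matrix formula is valid throughout.\<close>
  define Q where "Q = {v \<in> over E V. base_map \<phi> S b (proj E v) \<in> V'}"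
  have Q: "openin (mtop (total E)) Q"
  proof -
    have "openin (mtop (total E)) {v \<in> pts (total E). base_map \<phi> S b (proj E v) \<in> V'}"
      using local_trivD(1)[OF *(4)] EF
      by (intro openin_continuous_map_preimage[OF smooth_map_continuous[OF
              \<open>smooth_map (total E) F (\<lambda>v. base_map \<phi> S b (proj E v))\<close>]]) simp
    then have "openin (mtop (total E)) (over E V \<inter> {v \<in> pts (total E). base_map \<phi> S b (proj E v) \<in> V'})"
      using openin_over[OF E local_trivD(1)[OF *(3)]] by blast
    moreover have "over E V \<inter> {v \<in> pts (total E). base_map \<phi> S b (proj E v) \<in> V'} = Q"
      by (auto simp: Q_def)
    ultimately show ?thesis
      by simp
  qed
  have v0Q: "v0 \<in> Q"
    using V v0 by (simp add: Q_def p0_def)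
  have "smooth_at (total E) (\<lambda>v. t' (total_map E \<phi> \<rho> b v) i) v0" if i: "i < r" for i
  proof (rule smooth_at_cong[OF T _ Q v0Q])
    show "smooth_at (total E) (\<lambda>v. \<Sum>j<r. matrix_coords E r t t' (\<rho> (?\<sigma> (proj E v))) (i * r + j) * t v j) v0"
    proof (intro smooth_at_sum[OF T v0] smooth_at_mult[OF T])
      fix j assume "j \<in> {..<r}"
      then have j: "j < r"
        by simp
      have "i * r + j < Suc i * r"
        using j by simp
      also have "Suc i * r \<le> r * r"
        using i by (intro mult_le_mono1) simp
      finally show "smooth_at (total E) (\<lambda>v. matrix_coords E r t t' (\<rho> (?\<sigma> (proj E v))) (i * r + j)) v0"
        using smooth_at_pullback[OF T manifolds(3) pr v0 mat[unfolded p0_def]] by blast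
      show "smooth_at (total E) (\<lambda>v. t v j) v0"
        by (rule smooth_at_triv[OF E *(3) _ j]) (use v0Q in \<open>simp add: Q_def\<close>)
    qed
    fix v assume "v \<in> Q"
    then have v: "v \<in> pts (total E)" "proj E v \<in> V" "base_map \<phi> S b (proj E v) \<in> V'"
      by (auto simp: Q_def)
    note e = \<rho>_eq[OF proj_in[OF v(1)]]
    show "(\<Sum>j<r. matrix_coords E r t t' (\<rho> (?\<sigma> (proj E v))) (i * r + j) * t v j)
        = t' (total_map E \<phi> \<rho> b v) i"
      using triv_matrix_coords[OF *(3) v(2) *(4) v(3) e(2) pts_total_fiber[OF v(1)] i] e(1)
      by (simp add: total_map_def)
  qed
  then show "\<exists>r U t. local_triv E (r, U, t) \<and> proj E (total_map E \<phi> \<rho> b v0) \<in> U \<and>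
      (\<forall>j<r. smooth_at (total E) (\<lambda>v. t (total_map E \<phi> \<rho> b v) j) v0)"
    using *(4) V(2) total_map_in(2)[OF b v0] by (auto simp: p0_def simp del: local_triv.simps)
qed

text \<open>The point \<open>base_map \<phi> S b2 p\<close> lies over
  \<open>gtgt G (b2 (\<phi> p))\<close>, which is where the product evaluates \<open>b1\<close>. As
  \<open>b\<close> enters through its values on \<open>pts M\<close> alone, it may be a product of
  bisections or the unit section.\<close>

lemma maps_mult:
  assumes b1: "source_section G b1" and b2: "source_section G b2"
    and b: "\<And>m. m \<in> pts M \<Longrightarrow> b m = gmul G (b1 (gtgt G (b2 m))) (b2 m)"
  shows "p \<in> pts F \<Longrightarrow> base_map \<phi> S b p = base_map \<phi> S b1 (base_map \<phi> S b2 p)"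
    and "v \<in> pts (total E) \<Longrightarrow> total_map E \<phi> \<rho> b v = total_map E \<phi> \<rho> b1 (total_map E \<phi> \<rho> b2 v)"
proof -
  have comp: "(b1 (gtgt G (b2 m)), b2 m) \<in> composable G" if "m \<in> pts M" for m
    using source_sectionD[OF b2] source_sectionD[OF b1] that by (simp add: composable_def)
  show "base_map \<phi> S b p = base_map \<phi> S b1 (base_map \<phi> S b2 p)" if p: "p \<in> pts F"
    using \<rho>_mult(1)[OF graph_in_pullback[OF b2 p] comp[OF \<phi>_in[OF p]]] \<phi>_base_map[OF b2 p]
    by (simp add: base_map_def b[OF \<phi>_in[OF p]])
  show "total_map E \<phi> \<rho> b v = total_map E \<phi> \<rho> b1 (total_map E \<phi> \<rho> b2 v)" if v: "v \<in> pts (total E)"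
    using \<rho>_mult(2)[OF graph_in_pullback[OF b2 proj_in[OF v]] comp[OF \<phi>_in[OF proj_in[OF v]]] pts_total_fiber[OF v]]
      \<phi>_base_map[OF b2 proj_in[OF v]] total_map_in(2)[OF b2 v]
    by (simp add: total_map_def base_map_def b[OF \<phi>_in[OF proj_in[OF v]]])
qed

lemma maps_unit:
  assumes b: "\<And>m. m \<in> pts M \<Longrightarrow> b m = gunit G m"
  shows "p \<in> pts F \<Longrightarrow> base_map \<phi> S b p = p"
    and "v \<in> pts (total E) \<Longrightarrow> total_map E \<phi> \<rho> b v = v"
  using \<rho>_unit \<phi>_in proj_in pts_total_fiber by (simp_all add: base_map_def total_map_def b)

text \<open>\<open>c\<close> undoes \<open>gtgt G \<circ> b\<close>, so the arrow
  \<open>b (c m)\<close> ends at \<open>m\<close> and its inverse starts there. The two product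
  formulas have the shape that \<open>maps_mult\<close> expects.\<close>

lemma inverse_section:
  assumes b: "b \<in> bisections G"
  defines "c \<equiv> inv_into (pts M) (gtgt G \<circ> b)"
  shows "source_section G (\<lambda>m. ginv G (b (c m)))"
    and "\<And>m. m \<in> pts M \<Longrightarrow> gmul G (ginv G (b (c (gtgt G (b m))))) (b m) = gunit G m"
    and "\<And>m. m \<in> pts M \<Longrightarrow> gmul G (b (gtgt G (ginv G (b (c m))))) (ginv G (b (c m))) = gunit G m"
proof -
  have bs: "smooth_map M (arrows G) b" and src: "\<And>m. m \<in> pts M \<Longrightarrow> gsrc G (b m) = m"
    and d: "diffeo M M (gtgt G \<circ> b)"
    using b by (auto simp: bisections_def)
  note bij = diffeoD(1)[OF d]
  have cs: "smooth_map M M c"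
    unfolding c_def by (rule diffeoD(3)[OF d])
  have surj: "(gtgt G \<circ> b) ` pts M = pts M"
    using bij by (rule bij_betw_imp_surj_on)
  have c: "c m \<in> pts M" "gtgt G (b (c m)) = m" "c (gtgt G (b m)) = m" if m: "m \<in> pts M" for m
  proof -
    show "c m \<in> pts M"
      by (rule smooth_map_in_pts[OF cs m])
    show "gtgt G (b (c m)) = m"
      using f_inv_into_f[of m "gtgt G \<circ> b" "pts M"] m surj by (simp add: c_def)
    show "c (gtgt G (b m)) = m"
      using inv_into_f_f[OF bij_betw_imp_inj_on[OF bij] m] by (simp add: c_def)
  qed
  have inv: "gsrc G (ginv G g) = gtgt G g" "gtgt G (ginv G g) = gsrc G g"
    "gmul G (ginv G g) g = gunit G (gsrc G g)" "gmul G g (ginv G g) = gunit G (gtgt G g)"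
    if "g \<in> pts (arrows G)" for g
    using laws that by (auto simp: groupoid_laws_def)
  have bin: "b m \<in> pts (arrows G)" if "m \<in> pts M" for m
    by (rule smooth_map_in_pts[OF bs that])
  note A = manifold_smooth_atlas[OF manifolds(1)]
  have "smooth_map M (arrows G) (\<lambda>m. ginv G (b (c m)))"
    by (rule smooth_map_compose[OF manifolds(2,1) A smooth_map_compose[OF manifolds(2,2) A cs bs] groupoid_maps(3)])
  then show "source_section G (\<lambda>m. ginv G (b (c m)))"
    using inv(1)[OF bin[OF c(1)]] c(2) by (simp add: source_section_def)
  show "gmul G (ginv G (b (c (gtgt G (b m))))) (b m) = gunit G m" if "m \<in> pts M" for m
    using inv(3)[OF bin[OF that]] c(3)[OF that] src[OF that] by simp
  show "gmul G (b (gtgt G (ginv G (b (c m))))) (ginv G (b (c m))) = gunit G m" if "m \<in> pts M" for m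
    using inv(2,4)[OF bin[OF c(1)[OF that]]] src[OF c(1)[OF that]] c(2)[OF that] by simp
qed

lemma bisection_automorphism:
  assumes b: "b \<in> bisections G"
  shows "vb_automorphism E (total_map E \<phi> \<rho> b) (base_map \<phi> S b)"
proof -
  define b' where "b' = (\<lambda>m. ginv G (b (inv_into (pts M) (gtgt G \<circ> b) m)))"
  note T = vector_bundleD(1)[OF E]
  have s: "source_section G b" "source_section G b'"
    using bisection_source_section[OF b] inverse_section(1)[OF b] by (simp_all add: b'_def)
  \<comment> \<open>\<open>l\<close> and \<open>r\<close> write the unit section as a product in
    both orders. With \<open>maps_unit\<close> this makes the maps of \<open>b'\<close> two-sided
    inverses of those of \<open>b\<close>.\<close>
  have l: "gunit G m = gmul G (b' (gtgt G (b m))) (b m)" if "m \<in> pts M" for m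
    using inverse_section(2)[OF b that] by (simp add: b'_def)
  have r: "gunit G m = gmul G (b (gtgt G (b' m))) (b' m)" if "m \<in> pts M" for m
    using inverse_section(3)[OF b that] by (simp add: b'_def)
  have "diffeo F F (base_map \<phi> S b)"
    by (rule diffeoI[OF manifolds(3,3) base_map_smooth[OF s(1)] base_map_smooth[OF s(2)]])
      (use maps_mult(1)[OF s(2,1) l] maps_mult(1)[OF s r] maps_unit(1)[OF refl] in simp_all)
  moreover have "diffeo (total E) (total E) (total_map E \<phi> \<rho> b)"
    by (rule diffeoI[OF T T total_map_smooth[OF s(1)] total_map_smooth[OF s(2)]])
      (use maps_mult(2)[OF s(2,1) l] maps_mult(2)[OF s r] maps_unit(2)[OF refl] in simp_all)
  ultimately show ?thesis
    using total_map_in(2)[OF s(1)] total_map_linear_iso[OF s(1)] by (simp add: vb_automorphism_def EF)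
qed

lemma push_section_mult:
  assumes b1: "b1 \<in> bisections G" and b2: "b2 \<in> bisections G"
    and b: "\<And>m. m \<in> pts M \<Longrightarrow> b m = gmul G (b1 (gtgt G (b2 m))) (b2 m)"
  defines "R \<equiv> \<lambda>b. push_section E (total_map E \<phi> \<rho> b) (base_map \<phi> S b)"
  shows "R b = compose (sections E) (R b1) (R b2)"
proof (rule extensionalityI[of _ "sections E"])
  note s = bisection_source_section[OF b1] bisection_source_section[OF b2]
  note a = bisection_automorphism[OF b1] bisection_automorphism[OF b2]
  note i1 = inv_base[OF E a(1), unfolded EF] and i2 = inv_base[OF E a(2), unfolded EF]
  let ?inv = "\<lambda>b. inv_into (pts F) (base_map \<phi> S b)"
  \<comment> \<open>The base inverse of a product is the product of the inverses in reverse order,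
    so the push-forwards compose in the order of the bisections. Injectivity of
    \<open>base_map \<phi> S b\<close> is inherited from \<open>b1\<close> and
    \<open>b2\<close>.\<close>
  have inv: "?inv b p = ?inv b2 (?inv b1 p)" if p: "p \<in> pts F" for p
  proof (rule inv_into_f_eq)
    show "inj_on (base_map \<phi> S b) (pts F)"
    proof (rule inj_onI)
      fix q q' assume q: "q \<in> pts F" "q' \<in> pts F" "base_map \<phi> S b q = base_map \<phi> S b q'"
      then have "base_map \<phi> S b1 (base_map \<phi> S b2 q) = base_map \<phi> S b1 (base_map \<phi> S b2 q')"
        using maps_mult(1)[OF s b] by simp
      then show "q = q'"
        using i1(3)[OF i2(4)] i2(3) q(1,2) by metis
    qed
    show "?inv b2 (?inv b1 p) \<in> pts F"
      by (rule i2(1)[OF i1(1)[OF p]])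
    then show "base_map \<phi> S b (?inv b2 (?inv b1 p)) = p"
      using maps_mult(1)[OF s b] i1(1,2)[OF p] i2(2)[OF i1(1)[OF p]] by simp
  qed
  fix \<psi> assume \<psi>: "\<psi> \<in> sections E"
  note \<psi>2 = push_section_in_sections[OF E a(2) \<psi>]
  show "R b \<psi> = compose (sections E) (R b1) (R b2) \<psi>"
  proof
    fix p
    show "R b \<psi> p = compose (sections E) (R b1) (R b2) \<psi> p"
    proof (cases "p \<in> pts F")
      case True
      have "\<psi> (?inv b2 (?inv b1 p)) \<in> pts (total E)"
        using fiberD(1)[OF sectionsD(3)[OF \<psi>]] i2(1)[OF i1(1)[OF True]] EF by simp
      then have "R b \<psi> p = total_map E \<phi> \<rho> b1 (total_map E \<phi> \<rho> b2 (\<psi> (?inv b2 (?inv b1 p))))"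
        using True \<psi> by (simp add: R_def push_section_def EF inv maps_mult(2)[OF s b])
      also have "\<dots> = R b1 (R b2 \<psi>) p"
        using True \<psi> \<psi>2 i1(1)[OF True] by (simp add: R_def push_section_def EF)
      finally show ?thesis
        using \<psi> by (simp add: compose_def)
    next
      case False
      then show ?thesis
        using \<psi> \<psi>2 by (simp add: R_def compose_def push_section_def EF)
    qed
  qed
qed (simp_all add: R_def push_section_def compose_def)

lemma ex_associated_hom: "\<exists>R \<in> hom (bisection_group G) (semilinear_group E). associated G \<phi> S E R"
proof
  let ?R = "\<lambda>b. push_section E (total_map E \<phi> \<rho> b) (base_map \<phi> S b)"
  show "?R \<in> hom (bisection_group G) (semilinear_group E)"
  proof (rule homI)
    show "?R b \<in> carrier (semilinear_group E)" if "b \<in> carrier (bisection_group G)" for b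
      using that push_section_semilinear[OF E bisection_automorphism]
      by (simp add: bisection_group_def semilinear_group_def)
    show "?R (b1 \<otimes>\<^bsub>bisection_group G\<^esub> b2) = ?R b1 \<otimes>\<^bsub>semilinear_group E\<^esub> ?R b2"
      if "b1 \<in> carrier (bisection_group G)" "b2 \<in> carrier (bisection_group G)" for b1 b2
      using that push_section_mult[of b1 b2 "b1 \<otimes>\<^bsub>bisection_group G\<^esub> b2"]
      by (simp add: bisection_group_def semilinear_group_def)
  qed
  show "associated G \<phi> S E ?R"
    unfolding associated_def
  proof (intro ballI exI conjI)
    fix b assume b: "b \<in> bisections G"
    show "vb_automorphism E (total_map E \<phi> \<rho> b) (base_map \<phi> S b)"
      by (rule bisection_automorphism[OF b])
    show "induces E (total_map E \<phi> \<rho> b) (base_map \<phi> S b) (?R b)"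
      by (simp add: induces_def push_section_def)
    fix p v assume "p \<in> pts (vbase E)" "v \<in> fiber E p"
    then show "total_map E \<phi> \<rho> b v \<in> fiber E (S (b (\<phi> p)) p)"
      using total_map_fiber[OF bisection_source_section[OF b]] by (simp add: EF base_map_def)
  qed
qed

end

theorem proposition5p5:
  fixes G :: "('g, 'm) groupoid" and F :: "'f mfld" and \<phi> :: "'f \<Rightarrow> 'm"
    and S :: "'g \<Rightarrow> 'f \<Rightarrow> 'f" and E :: "('e, 'f) vbundle"
    and \<rho> :: "'g \<times> 'f \<Rightarrow> ('e, 'f) fiber_iso"
  assumes "lie_groupoid G"
    and "fibered_manifold F (gbase G) \<phi>"
    and "groupoid_action G F \<phi> S"
    and "vector_bundle E" and "vbase E = F"
    and "groupoid_rep (action_groupoid G F \<phi> S) E \<rho>"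
  shows "\<exists>R \<in> hom (bisection_group G) (semilinear_group E). associated G \<phi> S E R"
  by (rule action_groupoid_rep.ex_associated_hom, unfold_locales) (fact assms)+

end
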